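(* Let $ST(SG)=(C(SG),H_{SG},D_{SG})$ be the spectral triple of the Sierpinski gasket $SG$ defined in the context. The metric on $SG$ induced by this spectral triple, $$d_{SG}(p,q)=\sup\{|f(p)-f(q)| : f\in C(SG),\ \|[D_{SG},\pi_{SG}(f)]\|\le 1\},$$ coincides with the geodesic distance on $SG$: $d_{SG}(p,q)=d_{geo}(p,q)$ for all $p,q\in SG$.
   Context: The geodesic distance $d_{geo}(p,q)$ between $p,q\in SG$ is the minimal length of a rectifiable continuous curve contained in $SG$ connecting $p$ and $q$. The condition $\|[D,\pi(f)]\|\le1$ means that $[D,\pi(f)]$ is densely defined and extends to a bounded operator of norm at most $1$. The Sierpinski gasket: let $SG_0\subset\mathbb{R}^2$ be the boundary (three sides) of an equilateral triangle with side length $2\pi/3$, vertices $v_1,v_2,v_3$, and horizontal bottom edge. Let $F_j(x)=(x+v_j)/2$, $j=1,2,3$. Let $SG_n$ be the union of the $3^n$ triangles $F_{j_1}\circ\cdots\circ F_{j_n}(SG_0)$, each an equilateral triangle (boundary only) of side length $2^{1-n}\pi/3$ and perimeter $2^{1-n}\pi$; number these triangles $\Delta_{n,i}$, $1\le i\le 3^n$. Then $SG$ is the closure of $\bigcup_n SG_n$. For each $n\in\mathbb{N}_0=\{0,1,2,\dots\}$ and $i\in\{1,\dots,3^n\}$ let $r_{n,i}:[-2^{-n}\pi,2^{-n}\pi]\to\Delta_{n,i}$ be the parameterization by arclength (modulo $2^{1-n}\pi$), counterclockwise, with $r_{n,i}(0)$ the lower right-hand corner of $\Delta_{n,i}$.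 Let $H_{n,i}=L^2([-2^{-n}\pi,2^{-n}\pi])$ with respect to normalized Lebesgue measure, let $\pi_{n,i}(f)$, for $f\in C(SG)$, be multiplication by $f\circ r_{n,i}$, and let $D_{n,i}$ be the self-adjoint operator on $H_{n,i}$ with $D_{n,i}\phi_k=2^n(k+\tfrac12)\phi_k$ for $k\in\mathbb{Z}$, where $\phi_k(t)=\exp(i2^nkt)$ is an orthonormal basis of $H_{n,i}$. Then $H_{SG}=\bigoplus_{n,i}H_{n,i}$, $\pi_{SG}=\bigoplus_{n,i}\pi_{n,i}$, $D_{SG}=\bigoplus_{n,i}D_{n,i}$.
   Formalization: The condition ‖[D,π(f)]‖≤1 is read with the commutator defined on all of dom D, so π(f) must map dom D into itself; if only density of its maximal domain were required, Cantor-type functions would make d_SG infinite. *)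

theory Defs
  imports "HOL-Analysis.Analysis"
begin

text \<open>The plane is identified with \<^typ>\<open>complex\<close>. The triangle is fixed up to a translation: \<open>a\<close> is
  its lower left corner.\<close>

datatype corner = Lower_Left | Lower_Right | Apex

fun vertex :: "complex \<Rightarrow> corner \<Rightarrow> complex" where
  "vertex a Lower_Left = a"
| "vertex a Lower_Right = a + of_real (2 * pi / 3)"
| "vertex a Apex = a + of_real (2 * pi / 3) * cis (pi / 3)"

definition triangle_sides :: "complex \<Rightarrow> complex set" where
  "triangle_sides a =
     closed_segment (vertex a Lower_Left) (vertex a Lower_Right) \<union>
     closed_segment (vertex a Lower_Right) (vertex a Apex) \<union>
     closed_segment (vertex a Apex) (vertex a Lower_Left)"

definition contraction :: "complex \<Rightarrow> corner \<Rightarrow> complex \<Rightarrow> complex" where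
  "contraction a j x = (x + vertex a j) / 2"

text \<open>The triangles of generation \<open>n\<close> are indexed by the words of length \<open>n\<close>, so that all triangles
  together are indexed by the type \<^typ>\<open>corner list\<close>.\<close>

fun cell_map :: "complex \<Rightarrow> corner list \<Rightarrow> complex \<Rightarrow> complex" where
  "cell_map a [] = id"
| "cell_map a (j # w) = contraction a j \<circ> cell_map a w"

definition gasket_level :: "complex \<Rightarrow> nat \<Rightarrow> complex set" where
  "gasket_level a n = (\<Union>w\<in>{w. length w = n}. cell_map a w ` triangle_sides a)"

definition gasket :: "complex \<Rightarrow> complex set" where
  "gasket a = closure (\<Union>n. gasket_level a n)"

text \<open>The counterclockwise parameterization of the triangle \<open>w\<close> by arclength, for \<open>t\<close> between
  \<open>-pi / 2 ^ n\<close> and \<open>pi / 2 ^ n\<close>, i.e. \<open>u\<close> between \<open>-3/2\<close> and \<open>3/2\<close>. It starts in the lower right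
  corner at \<open>t = 0\<close>; both ends of the interval are mapped to the midpoint of the left side.\<close>

definition cell_param :: "complex \<Rightarrow> corner list \<Rightarrow> real \<Rightarrow> complex" where
  "cell_param a w t =
     (let A = cell_map a w (vertex a Lower_Left);
          B = cell_map a w (vertex a Lower_Right);
          C = cell_map a w (vertex a Apex);
          u = t / (2 * pi / 3 / 2 ^ length w)
      in if u < -1 then linepath C A (u + 2)
         else if u < 0 then linepath A B (u + 1)
         else if u < 1 then linepath B C u
         else linepath C A (u - 1))"


subsection \<open>Geodesic distance\<close>

definition curve_length :: "(real \<Rightarrow> 'a::metric_space) \<Rightarrow> ereal" where
  "curve_length g =
     (SUP (n, x)\<in>{(n::nat, x::nat \<Rightarrow> real). mono x \<and> range x \<subseteq> {0..1}}.
        ereal (\<Sum>i<n. dist (g (x i)) (g (x (Suc i)))))"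

definition rectifiable :: "(real \<Rightarrow> 'a::metric_space) \<Rightarrow> bool" where
  "rectifiable g \<longleftrightarrow> curve_length g < \<infinity>"

definition geodesic_dist :: "'a::metric_space set \<Rightarrow> 'a \<Rightarrow> 'a \<Rightarrow> ereal" where
  "geodesic_dist S p q =
     (INF g\<in>{g. path g \<and> rectifiable g \<and> path_image g \<subseteq> S \<and> pathstart g = p \<and> pathfinish g = q}.
        curve_length g)"


subsection \<open>Unbounded operators\<close>

text \<open>The condition that the commutator of the operator \<open>D\<close> with domain \<open>Dm\<close> and the bounded operator
  \<open>A\<close> is densely defined and extends to a bounded operator of norm at most \<open>1\<close>; \<open>sc\<close> is the complex
  scalar multiplication of the Hilbert space. The commutator \<open>D A - A D\<close> is understood, as usual for
  spectral triples, as an operator with domain \<open>Dm\<close>, so that \<open>A\<close> has to preserve \<open>Dm\<close>.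
  It would not do to ask only that \<open>{x \<in> Dm. A x \<in> Dm}\<close> is dense: on a circle, where \<open>Dm\<close>
  consists of absolutely continuous functions, this set is dense and the commutator is zero on it
  if \<open>A\<close> is the multiplication by any multiple of a continuous function of Cantor type.\<close>

definition commutator_le_1 ::
  "(complex \<Rightarrow> 'h \<Rightarrow> 'h) \<Rightarrow> 'h set \<Rightarrow> ('h \<Rightarrow> 'h) \<Rightarrow> ('h::real_normed_vector \<Rightarrow> 'h) \<Rightarrow> bool" where
  "commutator_le_1 sc Dm D A \<longleftrightarrow>
     closure Dm = UNIV \<and> A ` Dm \<subseteq> Dm \<and>
     (\<exists>T. bounded_linear T \<and> (\<forall>c x. T (sc c x) = sc c (T x)) \<and> onorm T \<le> 1 \<and>
          (\<forall>x\<in>Dm. T x = D (A x) - A (D x)))"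


subsection \<open>Some geometry of the gasket\<close>

lemma cell_map_linepath: "cell_map a w (linepath x y t) = linepath (cell_map a w x) (cell_map a w y) t"
proof (induction w)
  case (Cons j w)
  have "contraction a j (linepath u v t) = linepath (contraction a j u) (contraction a j v) t" for u v
    by (simp add: contraction_def linepath_def scaleR_conv_of_real field_simps)
  then show ?case
    by (simp add: Cons)
qed auto

lemma cell_param_in_cell:
  assumes "t \<in> {- (pi / 2 ^ length w)..pi / 2 ^ length w}"
  shows "cell_param a w t \<in> cell_map a w ` triangle_sides a"
proof -
  define u where "u = t / (2 * pi / 3 / 2 ^ length w)"
  have u: "u * (2 * pi) = 3 * (t * 2 ^ length w)"
    unfolding u_def by (simp add: field_simps)
  have "- pi \<le> t * 2 ^ length w" "t * 2 ^ length w \<le> pi"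
    using assms by (auto simp: field_simps)
  then have "-3/2 * (2 * pi) \<le> u * (2 * pi)" "u * (2 * pi) \<le> 3/2 * (2 * pi)"
    unfolding u by linarith+
  then have ub: "-3/2 \<le> u" "u \<le> 3/2"
    by (simp_all only: mult_le_cancel_right) (use pi_gt_zero in linarith)+
  have eq: "cell_param a w t = cell_map a w
      (if u < -1 then linepath (vertex a Apex) (vertex a Lower_Left) (u + 2)
       else if u < 0 then linepath (vertex a Lower_Left) (vertex a Lower_Right) (u + 1)
       else if u < 1 then linepath (vertex a Lower_Right) (vertex a Apex) u
       else linepath (vertex a Apex) (vertex a Lower_Left) (u - 1))"
    unfolding cell_param_def Let_def u_def[symmetric] by (simp add: cell_map_linepath)
  show ?thesis
    unfolding eq triangle_sides_def
    by (rule imageI) (use ub in \<open>auto simp del: vertex.simps intro: linepath_in_path\<close>)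
qed

lemma cell_param_in_gasket:
  assumes "t \<in> {- (pi / 2 ^ length w)..pi / 2 ^ length w}"
  shows "cell_param a w t \<in> gasket a"
proof -
  have "cell_param a w t \<in> (\<Union>n. gasket_level a n)"
    using cell_param_in_cell[OF assms, of a] unfolding gasket_level_def by auto
  then show ?thesis
    unfolding gasket_def by (rule subsetD[OF closure_subset])
qed

lemma continuous_on_cell_param: "continuous_on UNIV (cell_param a w)"
proof -
  define A where "A = cell_map a w (vertex a Lower_Left)"
  define B where "B = cell_map a w (vertex a Lower_Right)"
  define C where "C = cell_map a w (vertex a Apex)"
  define g where "g = (\<lambda>u::real. if u \<le> -1 then linepath C A (u + 2)
         else if u \<le> 0 then linepath A B (u + 1)
         else if u \<le> 1 then linepath B C u else linepath C A (u - 1))"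
  have eq: "cell_param a w t = g (t / (2 * pi / 3 / 2 ^ length w))" for t
    unfolding cell_param_def Let_def A_def[symmetric] B_def[symmetric] C_def[symmetric] g_def
    by (auto simp: linepath_def)
  have "continuous_on UNIV g"
    unfolding g_def linepath_def
    by (intro continuous_on_cases_le continuous_intros) (auto simp: algebra_simps)
  then have "continuous_on UNIV (\<lambda>t. g (t / (2 * pi / 3 / 2 ^ length w)))"
    by (rule continuous_on_compose2) (auto intro!: continuous_intros)
  then show ?thesis
    using eq by presburger
qed

lemma cell_map_cball:
  assumes "x \<in> cball a (2 * pi / 3)"
  shows "cell_map a w x \<in> cball a (2 * pi / 3)"
proof (induction w)
  case (Cons j w)
  let ?y = "cell_map a w x"
  have 1: "cmod (?y - a) \<le> 2 * pi / 3"
    using Cons by (simp add: dist_norm norm_minus_commute)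
  have 2: "cmod (vertex a j - a) \<le> 2 * pi / 3"
    by (cases j) (auto simp: norm_mult)
  have "cmod (contraction a j ?y - a) = cmod ((?y - a) + (vertex a j - a)) / 2"
    unfolding contraction_def by (simp add: norm_divide[symmetric] field_simps)
  also have "\<dots> \<le> (cmod (?y - a) + cmod (vertex a j - a)) / 2"
    by (intro divide_right_mono norm_triangle_ineq) auto
  also have "\<dots> \<le> 2 * pi / 3"
    using 1 2 by simp
  finally show ?case
    by (simp add: dist_norm norm_minus_commute)
qed (use assms in simp)

lemma compact_gasket: "compact (gasket a)"
proof -
  have v: "vertex a j \<in> cball a (2 * pi / 3)" for j
    by (cases j) (auto simp: dist_norm norm_mult)
  have "triangle_sides a \<subseteq> cball a (2 * pi / 3)"
    unfolding triangle_sides_def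
    by (intro Un_least closed_segment_subset v convex_cball)
  then have "(\<Union>n. gasket_level a n) \<subseteq> cball a (2 * pi / 3)"
    unfolding gasket_level_def using cell_map_cball
    by (intro UN_least image_subsetI) (auto simp del: mem_cball)
  then show ?thesis
    unfolding gasket_def by (meson bounded_cball bounded_subset compact_closure)
qed


subsection \<open>The Hilbert space\<close>

definition arc_measure :: "nat \<Rightarrow> real measure" where
  "arc_measure n = uniform_measure (lebesgue_on {- (pi / 2 ^ n)..pi / 2 ^ n}) {- (pi / 2 ^ n)..pi / 2 ^ n}"

definition square_integrable :: "'a measure \<Rightarrow> ('a \<Rightarrow> complex) \<Rightarrow> bool" where
  "square_integrable M f \<longleftrightarrow> f \<in> borel_measurable M \<and> integrable M (\<lambda>t. (cmod (f t))\<^sup>2)"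

definition direct_sum_carrier :: "(corner list \<Rightarrow> real \<Rightarrow> complex) \<Rightarrow> bool" where
  "direct_sum_carrier \<psi> \<longleftrightarrow>
     (\<forall>w. square_integrable (arc_measure (length w)) (\<psi> w)) \<and>
     (\<lambda>w. \<integral>t. (cmod (\<psi> w t))\<^sup>2 \<partial>arc_measure (length w)) summable_on UNIV"

definition direct_sum_eq ::
  "(corner list \<Rightarrow> real \<Rightarrow> complex) \<Rightarrow> (corner list \<Rightarrow> real \<Rightarrow> complex) \<Rightarrow> bool" where
  "direct_sum_eq \<psi> \<eta> \<longleftrightarrow> direct_sum_carrier \<psi> \<and> direct_sum_carrier \<eta> \<and>
     (\<forall>w. AE t in arc_measure (length w). \<psi> w t = \<eta> w t)"

lemma borel_measurable_cnj [measurable (raw)]: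
  "f \<in> borel_measurable M \<Longrightarrow> (\<lambda>t. cnj (f t)) \<in> borel_measurable M"
  by (rule borel_measurable_continuous_on[of cnj]) (auto intro!: continuous_intros)

lemma square_integrable_zero: "square_integrable M (\<lambda>_. 0)"
  by (simp add: square_integrable_def)

lemma square_integrable_cmult:
  assumes "square_integrable M f"
  shows "square_integrable M (\<lambda>t. c * f t)"
  using assms by (auto simp: square_integrable_def norm_mult power_mult_distrib)

lemma cmod_add_square_le: "(cmod (x + y))\<^sup>2 \<le> 2 * (cmod x)\<^sup>2 + 2 * (cmod y)\<^sup>2"
proof -
  have "(cmod (x + y))\<^sup>2 \<le> (cmod x + cmod y)\<^sup>2"
    by (intro power_mono norm_triangle_ineq) auto
  also have "\<dots> \<le> 2 * (cmod x)\<^sup>2 + 2 * (cmod y)\<^sup>2"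
    using zero_le_power2[of "cmod x - cmod y"] by (simp add: power2_eq_square algebra_simps)
  finally show ?thesis .
qed

lemma cmod_mult_le: "cmod (cnj x * y) \<le> (cmod x)\<^sup>2 + (cmod y)\<^sup>2"
proof -
  have "2 * (cmod x * cmod y) \<le> (cmod x)\<^sup>2 + (cmod y)\<^sup>2"
    using zero_le_power2[of "cmod x - cmod y"] by (simp add: power2_eq_square algebra_simps)
  moreover have "0 \<le> cmod x * cmod y"
    by simp
  ultimately show ?thesis
    unfolding norm_mult complex_mod_cnj by linarith
qed

lemma square_integrable_add:
  assumes "square_integrable M f" "square_integrable M g"
  shows "square_integrable M (\<lambda>t. f t + g t)"
proof -
  have [measurable]: "f \<in> borel_measurable M" "g \<in> borel_measurable M"
    using assms by (auto simp: square_integrable_def)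
  have "integrable M (\<lambda>t. 2 * (cmod (f t))\<^sup>2 + 2 * (cmod (g t))\<^sup>2)"
    using assms by (auto simp: square_integrable_def)
  then have "integrable M (\<lambda>t. (cmod (f t + g t))\<^sup>2)"
    by (rule Bochner_Integration.integrable_bound) (auto intro!: AE_I2 cmod_add_square_le)
  then show ?thesis
    by (simp add: square_integrable_def)
qed

lemma integrable_cnj_mult:
  assumes "square_integrable M f" "square_integrable M g"
  shows "integrable M (\<lambda>t. cnj (f t) * g t)"
proof -
  have [measurable]: "f \<in> borel_measurable M" "g \<in> borel_measurable M"
    using assms by (auto simp: square_integrable_def)
  have "integrable M (\<lambda>t. (cmod (f t))\<^sup>2 + (cmod (g t))\<^sup>2)"
    using assms by (auto simp: square_integrable_def)
  then show ?thesis
    by (rule Bochner_Integration.integrable_bound)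
      (auto intro!: AE_I2 order_trans[OF cmod_mult_le])
qed

lemma direct_sum_carrier_zero: "direct_sum_carrier (\<lambda>_ _. 0)"
  by (simp add: direct_sum_carrier_def square_integrable_zero)

lemma direct_sum_carrier_cmult:
  assumes "direct_sum_carrier \<psi>"
  shows "direct_sum_carrier (\<lambda>w t. c * \<psi> w t)"
  using assms unfolding direct_sum_carrier_def
  by (auto simp: square_integrable_cmult norm_mult power_mult_distrib intro!: summable_on_cmult_right)

lemma direct_sum_carrier_add:
  assumes "direct_sum_carrier \<psi>" "direct_sum_carrier \<eta>"
  shows "direct_sum_carrier (\<lambda>w t. \<psi> w t + \<eta> w t)"
proof -
  let ?M = "\<lambda>w::corner list. arc_measure (length w)"
  have sq: "square_integrable (?M w) (\<psi> w)" "square_integrable (?M w) (\<eta> w)"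
    "square_integrable (?M w) (\<lambda>t. \<psi> w t + \<eta> w t)" for w
    using assms by (auto simp: direct_sum_carrier_def intro!: square_integrable_add)
  have "(\<lambda>w. 2 * (\<integral>t. (cmod (\<psi> w t))\<^sup>2 \<partial>?M w) + 2 * (\<integral>t. (cmod (\<eta> w t))\<^sup>2 \<partial>?M w)) summable_on UNIV"
    using assms by (auto simp: direct_sum_carrier_def intro!: summable_on_add summable_on_cmult_right)
  moreover have "(\<integral>t. (cmod (\<psi> w t + \<eta> w t))\<^sup>2 \<partial>?M w)
      \<le> 2 * (\<integral>t. (cmod (\<psi> w t))\<^sup>2 \<partial>?M w) + 2 * (\<integral>t. (cmod (\<eta> w t))\<^sup>2 \<partial>?M w)" for w
  proof -
    have "(\<integral>t. (cmod (\<psi> w t + \<eta> w t))\<^sup>2 \<partial>?M w)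
        \<le> (\<integral>t. 2 * (cmod (\<psi> w t))\<^sup>2 + 2 * (cmod (\<eta> w t))\<^sup>2 \<partial>?M w)"
      using sq by (intro integral_mono cmod_add_square_le) (auto simp: square_integrable_def)
    also have "\<dots> = 2 * (\<integral>t. (cmod (\<psi> w t))\<^sup>2 \<partial>?M w) + 2 * (\<integral>t. (cmod (\<eta> w t))\<^sup>2 \<partial>?M w)"
      using sq by (subst Bochner_Integration.integral_add) (auto simp: square_integrable_def)
    finally show ?thesis .
  qed
  ultimately have "(\<lambda>w. \<integral>t. (cmod (\<psi> w t + \<eta> w t))\<^sup>2 \<partial>?M w) summable_on UNIV"
    by (rule summable_on_comparison_test) auto
  with sq show ?thesis
    by (auto simp: direct_sum_carrier_def)
qed

lemma direct_sum_inner_summable: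
  assumes "direct_sum_carrier \<psi>" "direct_sum_carrier \<eta>"
  shows "(\<lambda>w. \<integral>t. cnj (\<psi> w t) * \<eta> w t \<partial>arc_measure (length w)) summable_on UNIV"
proof -
  let ?M = "\<lambda>w::corner list. arc_measure (length w)"
  have sq: "square_integrable (?M w) (\<psi> w)" "square_integrable (?M w) (\<eta> w)" for w
    using assms by (auto simp: direct_sum_carrier_def)
  have le: "norm (\<integral>t. cnj (\<psi> w t) * \<eta> w t \<partial>?M w)
      \<le> (\<integral>t. (cmod (\<psi> w t))\<^sup>2 \<partial>?M w) + (\<integral>t. (cmod (\<eta> w t))\<^sup>2 \<partial>?M w)" for w
  proof -
    have "norm (\<integral>t. cnj (\<psi> w t) * \<eta> w t \<partial>?M w) \<le> (\<integral>t. cmod (cnj (\<psi> w t) * \<eta> w t) \<partial>?M w)"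
      by (rule integral_norm_bound)
    also have "\<dots> \<le> (\<integral>t. (cmod (\<psi> w t))\<^sup>2 + (cmod (\<eta> w t))\<^sup>2 \<partial>?M w)"
      using sq integrable_cnj_mult[OF sq]
      by (intro integral_mono cmod_mult_le) (auto simp: square_integrable_def)
    also have "\<dots> = (\<integral>t. (cmod (\<psi> w t))\<^sup>2 \<partial>?M w) + (\<integral>t. (cmod (\<eta> w t))\<^sup>2 \<partial>?M w)"
      using sq by (subst Bochner_Integration.integral_add) (auto simp: square_integrable_def)
    finally show ?thesis .
  qed
  have "(\<lambda>w. (\<integral>t. (cmod (\<psi> w t))\<^sup>2 \<partial>?M w) + (\<integral>t. (cmod (\<eta> w t))\<^sup>2 \<partial>?M w)) summable_on UNIV"
    using assms by (auto simp: direct_sum_carrier_def intro!: summable_on_add)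
  then have "(\<lambda>w. norm (\<integral>t. cnj (\<psi> w t) * \<eta> w t \<partial>?M w)) summable_on UNIV"
    by (rule summable_on_comparison_test) (use le in auto)
  then show ?thesis
    by (rule abs_summable_summable)
qed

lemma part_equivp_direct_sum_eq: "part_equivp direct_sum_eq"
proof (rule part_equivpI)
  show "\<exists>\<psi>. direct_sum_eq \<psi> \<psi>"
    using direct_sum_carrier_zero by (auto simp: direct_sum_eq_def)
  show "symp direct_sum_eq"
    by (auto simp: symp_def direct_sum_eq_def eq_commute)
  show "transp direct_sum_eq"
  proof (rule transpI)
    fix \<psi> \<eta> \<zeta>
    assume 1: "direct_sum_eq \<psi> \<eta>" and 2: "direct_sum_eq \<eta> \<zeta>"
    have "AE t in arc_measure (length w). \<psi> w t = \<zeta> w t" for w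
    proof -
      have "AE t in arc_measure (length w). \<psi> w t = \<eta> w t" "AE t in arc_measure (length w). \<eta> w t = \<zeta> w t"
        using 1 2 by (auto simp: direct_sum_eq_def)
      then show ?thesis
        by eventually_elim simp
    qed
    with 1 2 show "direct_sum_eq \<psi> \<zeta>"
      by (auto simp: direct_sum_eq_def)
  qed
qed

text \<open>The Hilbert space direct sum of the spaces \<open>L\<^sup>2\<close> of all triangles: square summable families of
  square integrable functions up to equality almost everywhere.\<close>

quotient_type gasket_l2 = "corner list \<Rightarrow> real \<Rightarrow> complex" / partial: direct_sum_eq
  by (rule part_equivp_direct_sum_eq)

lift_definition scaleC :: "complex \<Rightarrow> gasket_l2 \<Rightarrow> gasket_l2" (infixr "*\<^sub>C" 75)
  is "\<lambda>c \<psi> w t. c * \<psi> w t"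
  by (auto simp: direct_sum_eq_def direct_sum_carrier_cmult)

lift_definition cinner :: "gasket_l2 \<Rightarrow> gasket_l2 \<Rightarrow> complex"
  is "\<lambda>\<psi> \<eta>. \<Sum>\<^sub>\<infinity>w. \<integral>t. cnj (\<psi> w t) * \<eta> w t \<partial>arc_measure (length w)"
proof (rule infsum_cong)
  fix \<psi> \<psi>' \<eta> \<eta>' :: "corner list \<Rightarrow> real \<Rightarrow> complex" and w
  assume 1: "direct_sum_eq \<psi> \<psi>'" and 2: "direct_sum_eq \<eta> \<eta>'"
  then have [measurable]: "\<psi> w \<in> borel_measurable (arc_measure (length w))"
    "\<psi>' w \<in> borel_measurable (arc_measure (length w))"
    "\<eta> w \<in> borel_measurable (arc_measure (length w))"
    "\<eta>' w \<in> borel_measurable (arc_measure (length w))"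
    by (auto simp: direct_sum_eq_def direct_sum_carrier_def square_integrable_def)
  have "AE t in arc_measure (length w). \<psi> w t = \<psi>' w t" "AE t in arc_measure (length w). \<eta> w t = \<eta>' w t"
    using 1 2 by (auto simp: direct_sum_eq_def)
  then have "AE t in arc_measure (length w). cnj (\<psi> w t) * \<eta> w t = cnj (\<psi>' w t) * \<eta>' w t"
    by eventually_elim simp
  then show "(\<integral>t. cnj (\<psi> w t) * \<eta> w t \<partial>arc_measure (length w)) =
      (\<integral>t. cnj (\<psi>' w t) * \<eta>' w t \<partial>arc_measure (length w))"
    by (intro integral_cong_AE) measurable
qed

instantiation gasket_l2 :: real_vector
begin

lift_definition zero_gasket_l2 :: gasket_l2 is "\<lambda>_ _. 0"
  by (simp add: direct_sum_eq_def direct_sum_carrier_zero)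

lift_definition plus_gasket_l2 :: "gasket_l2 \<Rightarrow> gasket_l2 \<Rightarrow> gasket_l2" is "\<lambda>\<psi> \<eta> w t. \<psi> w t + \<eta> w t"
proof -
  fix \<psi> \<psi>' \<eta> \<eta>' :: "corner list \<Rightarrow> real \<Rightarrow> complex"
  assume 1: "direct_sum_eq \<psi> \<psi>'" and 2: "direct_sum_eq \<eta> \<eta>'"
  have "AE t in arc_measure (length w). \<psi> w t + \<eta> w t = \<psi>' w t + \<eta>' w t" for w
  proof -
    have "AE t in arc_measure (length w). \<psi> w t = \<psi>' w t" "AE t in arc_measure (length w). \<eta> w t = \<eta>' w t"
      using 1 2 by (auto simp: direct_sum_eq_def)
    then show ?thesis
      by eventually_elim simp
  qed
  with 1 2 show "direct_sum_eq (\<lambda>w t. \<psi> w t + \<eta> w t) (\<lambda>w t. \<psi>' w t + \<eta>' w t)"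
    by (auto simp: direct_sum_eq_def direct_sum_carrier_add)
qed

definition scaleR_gasket_l2 :: "real \<Rightarrow> gasket_l2 \<Rightarrow> gasket_l2" where
  "r *\<^sub>R x = of_real r *\<^sub>C (x::gasket_l2)"

definition uminus_gasket_l2 :: "gasket_l2 \<Rightarrow> gasket_l2" where
  "- x = (-1) *\<^sub>C (x::gasket_l2)"

definition minus_gasket_l2 :: "gasket_l2 \<Rightarrow> gasket_l2 \<Rightarrow> gasket_l2" where
  "x - y = x + - (y::gasket_l2)"

instance
proof
  fix x y z :: gasket_l2 and r s :: real
  show "x + y + z = x + (y + z)"
    by transfer (auto simp: direct_sum_eq_def direct_sum_carrier_add add.assoc)
  show "x + y = y + x"
    by transfer (auto simp: direct_sum_eq_def direct_sum_carrier_add add.commute)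
  show "0 + x = x"
    by transfer (auto simp: direct_sum_eq_def)
  show "- x + x = 0"
    unfolding uminus_gasket_l2_def
    by transfer (auto simp: direct_sum_eq_def direct_sum_carrier_zero)
  show "x - y = x + - y"
    by (rule minus_gasket_l2_def)
  show "r *\<^sub>R (x + y) = r *\<^sub>R x + r *\<^sub>R y"
    unfolding scaleR_gasket_l2_def
    by transfer (auto simp: direct_sum_eq_def direct_sum_carrier_add direct_sum_carrier_cmult algebra_simps)
  show "(r + s) *\<^sub>R x = r *\<^sub>R x + s *\<^sub>R x"
    unfolding scaleR_gasket_l2_def
    by transfer (auto simp: direct_sum_eq_def direct_sum_carrier_add direct_sum_carrier_cmult algebra_simps)
  show "r *\<^sub>R s *\<^sub>R x = (r * s) *\<^sub>R x"
    unfolding scaleR_gasket_l2_def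
    by transfer (auto simp: direct_sum_eq_def direct_sum_carrier_cmult algebra_simps)
  show "1 *\<^sub>R x = x"
    unfolding scaleR_gasket_l2_def by transfer (auto simp: direct_sum_eq_def)
qed

end

lemma cinner_add_left: "cinner (x + y) z = cinner x z + cinner y z"
proof transfer
  fix \<psi> \<psi>' \<eta> :: "corner list \<Rightarrow> real \<Rightarrow> complex"
  let ?M = "\<lambda>w::corner list. arc_measure (length w)"
  assume "direct_sum_eq \<psi> \<psi>" "direct_sum_eq \<psi>' \<psi>'" "direct_sum_eq \<eta> \<eta>"
  then have c: "direct_sum_carrier \<psi>" "direct_sum_carrier \<psi>'" "direct_sum_carrier \<eta>"
    by (auto simp: direct_sum_eq_def)
  then have sq: "square_integrable (?M w) (\<psi> w)" "square_integrable (?M w) (\<psi>' w)"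
    "square_integrable (?M w) (\<eta> w)" for w
    by (auto simp: direct_sum_carrier_def)
  have "(\<integral>t. cnj (\<psi> w t + \<psi>' w t) * \<eta> w t \<partial>?M w) =
      (\<integral>t. cnj (\<psi> w t) * \<eta> w t \<partial>?M w) + (\<integral>t. cnj (\<psi>' w t) * \<eta> w t \<partial>?M w)" for w
    using integrable_cnj_mult[OF sq(1,3)] integrable_cnj_mult[OF sq(2,3)]
    by (subst Bochner_Integration.integral_add[symmetric]) (auto simp: algebra_simps)
  then show "(\<Sum>\<^sub>\<infinity>w. \<integral>t. cnj (\<psi> w t + \<psi>' w t) * \<eta> w t \<partial>?M w) =
      (\<Sum>\<^sub>\<infinity>w. \<integral>t. cnj (\<psi> w t) * \<eta> w t \<partial>?M w) + (\<Sum>\<^sub>\<infinity>w. \<integral>t. cnj (\<psi>' w t) * \<eta> w t \<partial>?M w)"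
    using c by (simp add: infsum_add direct_sum_inner_summable)
qed

lemma cinner_scaleC_left: "cinner (c *\<^sub>C x) y = cnj c * cinner x y"
  by transfer (simp add: mult.assoc infsum_cmult_right')

lemma cnj_cinner: "cnj (cinner x y) = cinner y x"
proof transfer
  fix \<psi> \<eta> :: "corner list \<Rightarrow> real \<Rightarrow> complex"
  let ?M = "\<lambda>w::corner list. arc_measure (length w)"
  have "cnj (\<integral>t. cnj (\<psi> w t) * \<eta> w t \<partial>?M w) = (\<integral>t. cnj (\<eta> w t) * \<psi> w t \<partial>?M w)" for w
    by (subst Bochner_Integration.integral_cnj[symmetric]) (simp add: mult.commute)
  then show "cnj (\<Sum>\<^sub>\<infinity>w. \<integral>t. cnj (\<psi> w t) * \<eta> w t \<partial>?M w) =
      (\<Sum>\<^sub>\<infinity>w. \<integral>t. cnj (\<eta> w t) * \<psi> w t \<partial>?M w)"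
    by (simp add: infsum_cnj[symmetric] del: infsum_cnj)
qed

lemma square_integral_conv:
  "(\<integral>t. cnj (f t) * f t \<partial>M) = of_real (\<integral>t. (cmod (f t))\<^sup>2 \<partial>M)"
proof -
  have "cnj z * z = of_real ((cmod z)\<^sup>2)" for z
    by (simp only: complex_norm_square mult.commute[of z])
  then show ?thesis
    by (simp only: Bochner_Integration.integral_complex_of_real)
qed

lemma Re_cinner_self:
  "0 \<le> Re (cinner x x) \<and> (Re (cinner x x) = 0 \<longrightarrow> x = 0)"
proof transfer
  fix \<psi> :: "corner list \<Rightarrow> real \<Rightarrow> complex"
  let ?M = "\<lambda>w::corner list. arc_measure (length w)"
  let ?N = "\<lambda>w. \<integral>t. (cmod (\<psi> w t))\<^sup>2 \<partial>?M w"
  assume "direct_sum_eq \<psi> \<psi>"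
  then have c: "direct_sum_carrier \<psi>" 
    by (auto simp: direct_sum_eq_def)
  then have sq: "square_integrable (?M w) (\<psi> w)" for w
    by (auto simp: direct_sum_carrier_def)
  have s: "?N summable_on UNIV"
    using c by (auto simp: direct_sum_carrier_def)
  have eq: "Re (\<Sum>\<^sub>\<infinity>w. \<integral>t. cnj (\<psi> w t) * \<psi> w t \<partial>?M w) = (\<Sum>\<^sub>\<infinity>w. ?N w)"
    using direct_sum_inner_summable[OF c c]
    by (subst infsum_Re[symmetric]) (simp_all add: square_integral_conv)
  have nn: "0 \<le> ?N w" for w
    by simp
  have "direct_sum_eq \<psi> (\<lambda>_ _. 0)" if "(\<Sum>\<^sub>\<infinity>w. ?N w) = 0"
  proof -
    have "?N w = 0" for w
      by (rule nonneg_infsum_le_0D[of ?N UNIV]) (use that s nn in auto)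
    then have "AE t in ?M w. (cmod (\<psi> w t))\<^sup>2 = 0" for w
      using sq[of w] by (subst integral_nonneg_eq_0_iff_AE[symmetric]) (auto simp: square_integrable_def)
    then have "AE t in ?M w. \<psi> w t = 0" for w
      by simp
    then show ?thesis
      using c direct_sum_carrier_zero by (auto simp: direct_sum_eq_def)
  qed
  then show "0 \<le> Re (\<Sum>\<^sub>\<infinity>w. \<integral>t. cnj (\<psi> w t) * \<psi> w t \<partial>?M w) \<and>
      (Re (\<Sum>\<^sub>\<infinity>w. \<integral>t. cnj (\<psi> w t) * \<psi> w t \<partial>?M w) = 0 \<longrightarrow> direct_sum_eq \<psi> (\<lambda>_ _. 0))"
    unfolding eq using nn by (auto intro: infsum_nonneg)
qed

instantiation gasket_l2 :: real_inner
begin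

definition inner_gasket_l2 :: "gasket_l2 \<Rightarrow> gasket_l2 \<Rightarrow> real" where
  "x \<bullet> y = Re (cinner x y)"

definition norm_gasket_l2 :: "gasket_l2 \<Rightarrow> real" where
  "norm (x::gasket_l2) = sqrt (x \<bullet> x)"

definition sgn_gasket_l2 :: "gasket_l2 \<Rightarrow> gasket_l2" where
  "sgn (x::gasket_l2) = x /\<^sub>R norm x"

definition dist_gasket_l2 :: "gasket_l2 \<Rightarrow> gasket_l2 \<Rightarrow> real" where
  "dist (x::gasket_l2) y = norm (x - y)"

definition uniformity_gasket_l2 :: "(gasket_l2 \<times> gasket_l2) filter" where
  "uniformity_gasket_l2 = (INF e\<in>{0<..}. principal {(x, y). dist (x::gasket_l2) y < e})"

definition open_gasket_l2 :: "gasket_l2 set \<Rightarrow> bool" where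
  "open_gasket_l2 U \<longleftrightarrow> (\<forall>x\<in>U. \<forall>\<^sub>F (x', y) in uniformity. x' = x \<longrightarrow> y \<in> U)"

instance
proof
  fix x y z :: gasket_l2 and r :: real
  show "dist x y = norm (x - y)"
    by (rule dist_gasket_l2_def)
  show "sgn x = x /\<^sub>R norm x"
    by (rule sgn_gasket_l2_def)
  show "(uniformity :: (gasket_l2 \<times> gasket_l2) filter) = (INF e\<in>{0<..}. principal {(x, y). dist x y < e})"
    by (rule uniformity_gasket_l2_def)
  show "open U \<longleftrightarrow> (\<forall>x\<in>U. \<forall>\<^sub>F (x', y) in uniformity. x' = x \<longrightarrow> y \<in> U)" for U :: "gasket_l2 set"
    by (rule open_gasket_l2_def)
  show "x \<bullet> y = y \<bullet> x"
    unfolding inner_gasket_l2_def by (subst cnj_cinner[symmetric]) simp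
  show "(x + y) \<bullet> z = x \<bullet> z + y \<bullet> z"
    by (simp add: inner_gasket_l2_def cinner_add_left)
  show "(r *\<^sub>R x) \<bullet> y = r * (x \<bullet> y)"
    by (simp add: inner_gasket_l2_def scaleR_gasket_l2_def cinner_scaleC_left)
  show "0 \<le> x \<bullet> x"
    using Re_cinner_self by (simp add: inner_gasket_l2_def)
  have "(0::gasket_l2) = 0 *\<^sub>C 0"
    by transfer (simp add: direct_sum_eq_def direct_sum_carrier_zero)
  then have "cinner 0 0 = 0"
    by (metis cinner_scaleC_left complex_cnj_zero mult_zero_left)
  then show "x \<bullet> x = 0 \<longleftrightarrow> x = 0"
    using Re_cinner_self by (auto simp: inner_gasket_l2_def)
  show "norm x = sqrt (x \<bullet> x)"
    by (rule norm_gasket_l2_def)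
qed

end



subsection \<open>The spectral triple\<close>

lemma arc_measure_space [simp]: "space (arc_measure n) = {- (pi / 2 ^ n)..pi / 2 ^ n}"
  by (simp add: arc_measure_def)

lemma emeasure_arc_measure_space: "emeasure (arc_measure n) (space (arc_measure n)) = 1"
proof -
  let ?I = "{- (pi / 2 ^ n)..pi / 2 ^ n}"
  have "emeasure (lebesgue_on ?I) ?I = ennreal (pi / 2 ^ n - (- (pi / 2 ^ n)))"
    by (subst emeasure_restrict_space) auto
  moreover have "0 < pi / 2 ^ n"
    by simp
  then have "0 < pi / 2 ^ n - (- (pi / 2 ^ n))"
    by linarith
  ultimately show ?thesis
    by (simp only: arc_measure_space) (simp add: arc_measure_def emeasure_uniform_measure_1)
qed

lemma finite_measure_arc_measure: "finite_measure (arc_measure n)"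
  by (rule finite_measureI) (simp only: emeasure_arc_measure_space, simp)

lemma continuous_measurable_arc_measure:
  assumes "continuous_on {- (pi / 2 ^ n)..pi / 2 ^ n} (f :: real \<Rightarrow> complex)"
  shows "f \<in> borel_measurable (arc_measure n)"
proof -
  have "f \<in> borel_measurable (lebesgue_on {- (pi / 2 ^ n)..pi / 2 ^ n})"
    by (rule continuous_imp_measurable_on_sets_lebesgue[OF assms]) auto
  then show ?thesis
    by (simp add: arc_measure_def uniform_measure_def)
qed

lemma direct_sum_carrier_single:
  assumes "square_integrable (arc_measure (length w)) f"
  shows "direct_sum_carrier (\<lambda>v t. if v = w then f t else 0)"
proof -
  have "(\<lambda>v. \<integral>t. (cmod (if v = w then f t else 0))\<^sup>2 \<partial>arc_measure (length v)) summable_on {w}"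
    by simp
  then have "(\<lambda>v. \<integral>t. (cmod (if v = w then f t else 0))\<^sup>2 \<partial>arc_measure (length v)) summable_on UNIV"
    by (rule summable_on_cong_neutral[THEN iffD1, rotated -1]) auto
  moreover have "square_integrable (arc_measure (length v)) (\<lambda>t. if v = w then f t else 0)" for v
    using assms by (cases "v = w") (auto simp: square_integrable_zero)
  ultimately show ?thesis
    by (auto simp: direct_sum_carrier_def)
qed

text \<open>The summand of a triangle \<open>w\<close> is regarded as a subspace of the direct sum; this is the
  orthogonal projection onto it.\<close>

lift_definition summand_proj :: "corner list \<Rightarrow> gasket_l2 \<Rightarrow> gasket_l2"
  is "\<lambda>w \<psi> v t. if v = w then \<psi> v t else 0"
proof -
  fix w and \<psi> \<eta> :: "corner list \<Rightarrow> real \<Rightarrow> complex"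
  assume *: "direct_sum_eq \<psi> \<eta>"
  have "direct_sum_carrier (\<lambda>v t. if v = w then \<zeta> v t else 0)" if "direct_sum_carrier \<zeta>" for \<zeta>
  proof -
    have "(\<lambda>v t. if v = w then \<zeta> v t else 0) = (\<lambda>v t. if v = w then \<zeta> w t else 0)"
      by (intro ext) auto
    moreover have "square_integrable (arc_measure (length w)) (\<zeta> w)"
      using that by (simp add: direct_sum_carrier_def)
    ultimately show ?thesis
      using direct_sum_carrier_single by simp
  qed
  with * show "direct_sum_eq (\<lambda>v t. if v = w then \<psi> v t else 0) (\<lambda>v t. if v = w then \<eta> v t else 0)"
    by (auto simp: direct_sum_eq_def)
qed

text \<open>The function \<open>\<phi>\<^sub>k\<close> on the triangle \<open>w\<close>, as an element of the direct sum.\<close>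

lift_definition fourier_vec :: "corner list \<Rightarrow> int \<Rightarrow> gasket_l2"
  is "\<lambda>w k v t. if v = w then exp (\<i> * 2 ^ length w * of_int k * of_real t) else 0"
proof -
  fix w :: "corner list" and k
  let ?f = "\<lambda>t::real. exp (\<i> * 2 ^ length w * of_int k * of_real t)"
  have eq: "?f t = cis (2 ^ length w * of_int k * t)" for t
    by (simp add: cis_conv_exp algebra_simps)
  have n: "cmod (?f t) = 1" for t
    unfolding eq by simp
  have m: "?f \<in> borel_measurable (arc_measure (length w))"
    by (intro continuous_measurable_arc_measure continuous_intros)
  interpret finite_measure "arc_measure (length w)"
    by (rule finite_measure_arc_measure)
  have "square_integrable (arc_measure (length w)) ?f"
    using m unfolding square_integrable_def n by simp
  then have "direct_sum_carrier (\<lambda>v t. if v = w then ?f t else 0)"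
    by (rule direct_sum_carrier_single)
  then show "direct_sum_eq (\<lambda>v t. if v = w then ?f t else 0) (\<lambda>v t. if v = w then ?f t else 0)"
    by (simp add: direct_sum_eq_def)
qed

text \<open>The self-adjoint operator on the summand \<open>w\<close> with eigenvectors \<^term>\<open>fourier_vec w k\<close>. By the
  Riesz-Fischer theorem, the eigenvector series converges iff its coefficients are square summable.\<close>

definition dirac_eigenvalue :: "corner list \<Rightarrow> int \<Rightarrow> real" where
  "dirac_eigenvalue w k = 2 ^ length w * (of_int k + 1 / 2)"

definition dirac_summand_dom :: "corner list \<Rightarrow> gasket_l2 set" where
  "dirac_summand_dom w =
     {x \<in> range (summand_proj w).
        (\<lambda>k. (of_real (dirac_eigenvalue w k) * cinner (fourier_vec w k) x) *\<^sub>C fourier_vec w k)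
          summable_on UNIV}"

definition dirac_summand :: "corner list \<Rightarrow> gasket_l2 \<Rightarrow> gasket_l2" where
  "dirac_summand w x =
     (\<Sum>\<^sub>\<infinity>k. (of_real (dirac_eigenvalue w k) * cinner (fourier_vec w k) x) *\<^sub>C fourier_vec w k)"

definition dirac_dom :: "gasket_l2 set" where
  "dirac_dom =
     {x. (\<forall>w. summand_proj w x \<in> dirac_summand_dom w) \<and>
         (\<lambda>w. (norm (dirac_summand w (summand_proj w x)))\<^sup>2) summable_on UNIV}"

definition dirac :: "gasket_l2 \<Rightarrow> gasket_l2" where
  "dirac x = (\<Sum>\<^sub>\<infinity>w. dirac_summand w (summand_proj w x))"

text \<open>The representation of the continuous functions on the gasket; it is only used for functions
  that are continuous there.\<close>

lift_definition mult_op :: "complex \<Rightarrow> (complex \<Rightarrow> complex) \<Rightarrow> gasket_l2 \<Rightarrow> gasket_l2"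
  is "\<lambda>a f \<psi>. if continuous_on (gasket a) f then (\<lambda>w t. f (cell_param a w t) * \<psi> w t) else (\<lambda>_ _. 0)"
proof -
  fix a :: complex and f and \<psi> \<eta> :: "corner list \<Rightarrow> real \<Rightarrow> complex"
  assume *: "direct_sum_eq \<psi> \<eta>"
  have car: "direct_sum_carrier (\<lambda>w t. f (cell_param a w t) * \<zeta> w t)"
    if f: "continuous_on (gasket a) f" and \<zeta>: "direct_sum_carrier \<zeta>" for \<zeta>
  proof -
    let ?M = "\<lambda>w::corner list. arc_measure (length w)"
    obtain B where B: "\<And>z. z \<in> gasket a \<Longrightarrow> cmod (f z) \<le> B"
      using compact_imp_bounded[OF compact_continuous_image[OF f compact_gasket]]
      by (auto simp: bounded_iff)
    have sq: "square_integrable (?M w) (\<zeta> w)" for w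
      using \<zeta> by (auto simp: direct_sum_carrier_def)
    have le: "(cmod (f (cell_param a w t) * \<zeta> w t))\<^sup>2 \<le> B\<^sup>2 * (cmod (\<zeta> w t))\<^sup>2" if "t \<in> space (?M w)" for w t
    proof -
      have "cmod (f (cell_param a w t)) \<le> B"
        using that by (intro B cell_param_in_gasket) simp
      then have "(cmod (f (cell_param a w t)))\<^sup>2 \<le> B\<^sup>2"
        by (intro power_mono) auto
      then show ?thesis
        by (simp add: norm_mult power_mult_distrib mult_right_mono)
    qed
    have sq': "square_integrable (?M w) (\<lambda>t. f (cell_param a w t) * \<zeta> w t)" for w
    proof -
      have [measurable]: "(\<lambda>t. f (cell_param a w t)) \<in> borel_measurable (?M w)"
        by (intro continuous_measurable_arc_measure continuous_on_compose2[OF f]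
            continuous_on_subset[OF continuous_on_cell_param]) (auto intro!: cell_param_in_gasket)
      have [measurable]: "\<zeta> w \<in> borel_measurable (?M w)"
        using sq[of w] by (simp add: square_integrable_def)
      have "integrable (?M w) (\<lambda>t. B\<^sup>2 * (cmod (\<zeta> w t))\<^sup>2)"
        using sq[of w] by (simp add: square_integrable_def)
      then have "integrable (?M w) (\<lambda>t. (cmod (f (cell_param a w t) * \<zeta> w t))\<^sup>2)"
      proof (rule Bochner_Integration.integrable_bound)
        show "AE t in ?M w. norm ((cmod (f (cell_param a w t) * \<zeta> w t))\<^sup>2) \<le> norm (B\<^sup>2 * (cmod (\<zeta> w t))\<^sup>2)"
          using le by (intro AE_I2) simp
      qed measurable
      then show ?thesis
        by (simp add: square_integrable_def)
    qed
    have "(\<lambda>w. B\<^sup>2 * (\<integral>t. (cmod (\<zeta> w t))\<^sup>2 \<partial>?M w)) summable_on UNIV"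
      using \<zeta> by (auto simp: direct_sum_carrier_def intro!: summable_on_cmult_right)
    moreover have "(\<integral>t. (cmod (f (cell_param a w t) * \<zeta> w t))\<^sup>2 \<partial>?M w)
        \<le> B\<^sup>2 * (\<integral>t. (cmod (\<zeta> w t))\<^sup>2 \<partial>?M w)" for w
    proof -
      have "(\<integral>t. (cmod (f (cell_param a w t) * \<zeta> w t))\<^sup>2 \<partial>?M w) \<le> (\<integral>t. B\<^sup>2 * (cmod (\<zeta> w t))\<^sup>2 \<partial>?M w)"
        using sq[of w] sq'[of w] by (intro integral_mono le) (auto simp: square_integrable_def)
      then show ?thesis
        by simp
    qed
    ultimately have "(\<lambda>w. \<integral>t. (cmod (f (cell_param a w t) * \<zeta> w t))\<^sup>2 \<partial>?M w) summable_on UNIV"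
      by (rule summable_on_comparison_test) auto
    with sq' show ?thesis
      by (auto simp: direct_sum_carrier_def)
  qed
  have ae: "AE t in arc_measure (length w). f (cell_param a w t) * \<psi> w t = f (cell_param a w t) * \<eta> w t" for w
  proof -
    have "AE t in arc_measure (length w). \<psi> w t = \<eta> w t"
      using * by (auto simp: direct_sum_eq_def)
    then show ?thesis
      by eventually_elim simp
  qed
  show "direct_sum_eq
      (if continuous_on (gasket a) f then (\<lambda>w t. f (cell_param a w t) * \<psi> w t) else (\<lambda>_ _. 0))
      (if continuous_on (gasket a) f then (\<lambda>w t. f (cell_param a w t) * \<eta> w t) else (\<lambda>_ _. 0))"
    using * car ae direct_sum_carrier_zero by (auto simp: direct_sum_eq_def)
qed

definition spectral_dist :: "complex \<Rightarrow> complex \<Rightarrow> complex \<Rightarrow> ereal" where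
  "spectral_dist a p q =
     (SUP f\<in>{f. continuous_on (gasket a) f \<and> commutator_le_1 scaleC dirac_dom dirac (mult_op a f)}.
        ereal (cmod (f p - f q)))"

end

theory Submission
  imports Defs "HOL-Complex_Analysis.Great_Picard"
begin

text \<open>If the commutator with \<open>f\<close> has norm at most 1, then testing it on the vectors
  \<open>\<Sum>\<^sub>j a\<^sub>j exp (- i j s) \<phi>\<^sub>j\<close> shows that the convolutions of \<open>f \<circ> r\<close> with the de la Vallee-Poussin
  kernels \<open>\<bar>\<Sum>\<^sub>j a\<^sub>j \<phi>\<^sub>j\<bar>\<^sup>2\<close> have derivatives bounded by 1, hence \<open>f\<close> is 1-Lipschitz along the sides of
  all triangles. A curve in the gasket passes from one triangle of generation \<open>n\<close> to another only
  through a common corner, so \<open>f\<close> changes along it by at most its length, up to an error that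
  vanishes as \<open>n\<close> grows. Conversely, for a function \<open>f\<close> that is 1-Lipschitz along the sides of all
  triangles, the convolutions with the same kernels are trigonometric polynomials for which the
  commutator is the multiplication by a derivative of modulus at most 1; this bound survives in the
  limit by Bessel's inequality and completeness of the Fourier basis. It applies to the geodesic
  distance from \<open>p\<close>.\<close>

subsection \<open>Self-similarity of the gasket\<close>

text \<open>The sharp constant 1 dictates the construction. A kernel that is the squared modulus of
  a polynomial with unit coefficient vector makes the derivative of the mean at a point, up to a
  factor \<i>, a single matrix element of the commutator at a unit vector, so no constant is lost.
  The same kernels are positive, have mass one and concentrate at 0, so they also serve as an
  approximate identity and yield completeness of the Fourier basis. Binomial coefficients give them
  a closed form, a power of \<open>2 + 2 * cos x\<close> divided by a central binomial coefficient.

  On curves the obstacle is that \<open>f\<close> is controlled only along sides, while a curve need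
  not follow any side. Hence \<open>f\<close> is replaced in each generation by a function that uses
  only its values at corners and whose increments are locally bounded by the Euclidean distance.

  In the converse direction it is not known in advance that multiplication preserves the domain. The
  commutator is therefore first bounded through its formal Fourier coefficients, and square
  summability then gives membership in the domain.\<close>

lemma corner_UNIV: "UNIV = {Lower_Left, Lower_Right, Apex}"
  using corner.exhaust by auto

lemma finite_words: "finite {w :: corner list. length w = n}"
proof -
  have "finite (UNIV :: corner set)" by (simp add: corner_UNIV)
  from finite_lists_length_eq[OF this, of n] show ?thesis by simp
qed

lemma contraction_vertex_self [simp]: "contraction a j (vertex a j) = vertex a j"
  by (simp add: contraction_def)

lemma cell_map_diff: "cell_map a w x - cell_map a w y = (x - y) / 2 ^ length w"
proof (induction w)
  case (Cons j w)
  have "contraction a j u - contraction a j v = (u - v) / 2" for u v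
    by (simp add: contraction_def flip: diff_divide_distrib)
  then have "cell_map a (j # w) x - cell_map a (j # w) y = (cell_map a w x - cell_map a w y) / 2" by simp
  then show ?case by (simp add: Cons)
qed auto

lemma dist_cell_map: "dist (cell_map a w x) (cell_map a w y) = dist x y / 2 ^ length w"
  by (simp add: dist_norm cell_map_diff norm_divide norm_power)

lemma cell_map_eq_iff [simp]: "cell_map a w x = cell_map a w y \<longleftrightarrow> x = y"
  using dist_cell_map[of a w x y] by auto

lemma continuous_on_cell_map: "continuous_on S (cell_map a w)"
proof -
  have "(1 / 2 ^ length w)-lipschitz_on S (cell_map a w)"
    by (rule lipschitz_onI) (auto simp: dist_cell_map)
  then show ?thesis by (rule lipschitz_on_continuous_on)
qed

lemma cell_map_closed_segment:
  "cell_map a w ` closed_segment x y = closed_segment (cell_map a w x) (cell_map a w y)"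
  unfolding path_image_linepath[symmetric] path_image_def image_image cell_map_linepath ..

lemma dist_vertex: "dist (vertex a i) (vertex a j) = (if i = j then 0 else 2 * pi / 3)"
proof -
  have "cmod (cis (pi/3) - 1) = 1" "cmod (1 - cis (pi/3)) = 1"
    by (simp_all add: cmod_def power2_eq_square cos_60 sin_60 algebra_simps)
  moreover have "dist (c + complex_of_real r) (c + of_real r * z) = \<bar>r\<bar> * cmod (1 - z)" for c r z
  proof -
    have "c + complex_of_real r - (c + of_real r * z) = of_real r * (1 - z)" by (simp add: algebra_simps)
    then show ?thesis by (simp only: dist_norm norm_mult norm_of_real)
  qed
  ultimately have "dist (vertex a Lower_Right) (vertex a Apex) = 2 * pi / 3"
    by (simp only: vertex.simps) simp
  moreover have "dist (vertex a Lower_Left) (vertex a Lower_Right) = 2 * pi / 3"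
    "dist (vertex a Lower_Left) (vertex a Apex) = 2 * pi / 3"
    by (auto simp: dist_norm norm_mult)
  ultimately show ?thesis
    by (cases i; cases j) (simp_all only: dist_commute corner.distinct if_False dist_self if_True refl)
qed

text \<open>Barycentric coordinates with respect to the three corners; \<open>pi / sqrt 3\<close> is
  the height of a triangle of side \<open>2 * pi / 3\<close>. They turn the question of where cells
  meet into inequalities between reals.\<close>

fun bary :: "complex \<Rightarrow> corner \<Rightarrow> complex \<Rightarrow> real" where
  "bary a Apex x = Im (x - a) / (pi / sqrt 3)"
| "bary a Lower_Right x = Re (x - a) / (2 * pi / 3) - Im (x - a) / (2 * pi / sqrt 3)"
| "bary a Lower_Left x = 1 - Re (x - a) / (2 * pi / 3) - Im (x - a) / (2 * pi / sqrt 3)"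

lemma bary_vertex: "bary a i (vertex a j) = (if i = j then 1 else 0)"
proof -
  have "Im (vertex a Apex - a) = pi / sqrt 3"
    by (simp add: sin_60 real_div_sqrt field_simps)
  moreover have "Re (vertex a Apex - a) = pi / 3"
    by (simp add: cos_60)
  ultimately show ?thesis
    by (cases i; cases j) (simp_all del: vertex.simps(3))
qed

lemma bary_affine: "bary a i ((1 - u) *\<^sub>R x + u *\<^sub>R y) = (1 - u) * bary a i x + u * bary a i y"
proof -
  have "Re ((1 - u) *\<^sub>R x + u *\<^sub>R y - a) = (1 - u) * Re (x - a) + u * Re (y - a)"
    "Im ((1 - u) *\<^sub>R x + u *\<^sub>R y - a) = (1 - u) * Im (x - a) + u * Im (y - a)"
    by (auto simp: algebra_simps)
  then show ?thesis
    by (cases i) (simp_all only: bary.simps, simp_all only: add_divide_distrib mult.assoc times_divide_eq_right[symmetric], simp_all only: algebra_simps)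
qed

text \<open>\<open>contraction a j\<close> is the midpoint with corner \<open>j\<close>, whose
  coordinates form a unit vector, and the coordinates are affine.\<close>

lemma bary_contraction: "bary a i (contraction a j x) = (bary a i x + (if i = j then 1 else 0)) / 2"
proof -
  have "contraction a j x = (1 - 1/2) *\<^sub>R x + (1/2) *\<^sub>R vertex a j"
    by (simp add: contraction_def scaleR_conv_of_real field_simps)
  then show ?thesis
    by (simp only: bary_affine bary_vertex) simp
qed

lemma bary_inject:
  assumes "\<And>i. bary a i x = bary a i y"
  shows "x = y"
proof -
  have "Im x = Im y" using assms[of Apex] by simp
  moreover have "Re x = Re y" using assms[of Lower_Right] \<open>Im x = Im y\<close> by simp
  ultimately show ?thesis by (rule complex_eqI[rotated])
qed

lemma continuous_on_bary: "continuous_on S (bary a i)"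
  by (cases i) (auto intro!: continuous_intros)

section \<open>The gasket as attractor of the three contractions\<close>

lemma triangle_sides_eq: "triangle_sides a = (\<Union>i j. closed_segment (vertex a i) (vertex a j))"
proof -
  have "closed_segment (vertex a i) (vertex a j) \<subseteq> triangle_sides a" for i j
    by (cases i; cases j) (auto simp: triangle_sides_def closed_segment_commute simp del: vertex.simps)
  then show ?thesis
    unfolding triangle_sides_def by blast
qed

lemma gasket_level_Suc: "gasket_level a (Suc n) = (\<Union>j. contraction a j ` gasket_level a n)"
proof -
  have "{w. length w = Suc n} = (\<Union>j. (\<lambda>w. j # w) ` {w :: corner list. length w = n})"
    by (auto simp: length_Suc_conv)
  then show ?thesis
    by (auto simp: gasket_level_def image_comp)
qed

lemma gasket_level_0 [simp]: "gasket_level a 0 = triangle_sides a"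
  by (simp add: gasket_level_def)

text \<open>The half of a side next to one of its ends is the image of the whole side under the
  contraction that fixes this end. This absorbs generation 0 when the union of all levels is written
  as a union of contracted copies.\<close>

lemma gasket_level_0_subset: "gasket_level a 0 \<subseteq> gasket_level a (Suc 0)"
proof
  fix x assume "x \<in> gasket_level a 0"
  then obtain i j where x: "x \<in> closed_segment (vertex a i) (vertex a j)"
    by (auto simp: triangle_sides_eq)
  define m where "m = (vertex a i + vertex a j) / 2"
  have m: "contraction a i (vertex a j) = m" "contraction a j (vertex a i) = m"
    by (auto simp: contraction_def m_def algebra_simps)
  have "m = midpoint (vertex a i) (vertex a j)"
    by (simp add: m_def midpoint_def scaleR_conv_of_real)
  then have "x \<in> closed_segment (vertex a i) m \<union> closed_segment m (vertex a j)"
    using x by (subst Un_closed_segment) auto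
  moreover have "closed_segment (vertex a i) m = contraction a i ` closed_segment (vertex a i) (vertex a j)"
    using cell_map_closed_segment[of a "[i]"] by (simp add: m)
  moreover have "closed_segment m (vertex a j) = contraction a j ` closed_segment (vertex a i) (vertex a j)"
    using cell_map_closed_segment[of a "[j]"] by (simp add: m)
  moreover have "closed_segment (vertex a i) (vertex a j) \<subseteq> gasket_level a 0"
    by (auto simp: triangle_sides_eq)
  ultimately have "x \<in> contraction a i ` gasket_level a 0 \<union> contraction a j ` gasket_level a 0"
    by blast
  then show "x \<in> gasket_level a (Suc 0)"
    unfolding gasket_level_Suc by (elim UnE) (rule UN_I[OF UNIV_I], assumption)+
qed

text \<open>The union \<open>U\<close> of all levels satisfies the equation, and the closure
  commutes with finite unions and with the contractions, which are translated scalings.\<close>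

lemma gasket_eq_contractions: "gasket a = (\<Union>j. contraction a j ` gasket a)"
proof -
  define U where "U = (\<Union>n. gasket_level a n)"
  have "U \<subseteq> (\<Union>j. contraction a j ` U)"
  proof
    fix x assume "x \<in> U"
    then obtain n where "x \<in> gasket_level a n" by (auto simp: U_def)
    then obtain m where "x \<in> gasket_level a (Suc m)"
      using gasket_level_0_subset by (cases n) auto
    then show "x \<in> (\<Union>j. contraction a j ` U)"
      unfolding gasket_level_Suc U_def by blast
  qed
  moreover have "contraction a j ` U \<subseteq> U" for j
  proof
    fix x assume "x \<in> contraction a j ` U"
    then obtain n where "x \<in> gasket_level a (Suc n)" unfolding U_def gasket_level_Suc by blast
    then show "x \<in> U" unfolding U_def by blast
  qed
  ultimately have U: "U = (\<Union>j. contraction a j ` U)" by blast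
  have c: "contraction a j ` closure U = closure (contraction a j ` U)" for j
  proof -
    have "contraction a j = (\<lambda>x. vertex a j / 2 + (1/2) *\<^sub>R x)"
      by (auto simp: contraction_def fun_eq_iff scaleR_conv_of_real field_simps)
    moreover have "(\<lambda>x. vertex a j / 2 + (1/2) *\<^sub>R x) ` S = (+) (vertex a j / 2) ` (*\<^sub>R) (1/2) ` S" for S
      by (auto simp: image_image)
    ultimately show ?thesis
      by (simp add: closure_translation closure_scaleR)
  qed
  have "closure U = closure (\<Union>j. contraction a j ` U)" using U by simp
  also have "\<dots> = (\<Union>j. closure (contraction a j ` U))"
    by (simp add: corner_UNIV)
  finally show ?thesis
    unfolding gasket_def U_def[symmetric] c .
qed

lemma contraction_in_gasket: "x \<in> gasket a \<Longrightarrow> contraction a j x \<in> gasket a"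
  by (subst gasket_eq_contractions) blast

lemma cell_map_in_gasket: "x \<in> gasket a \<Longrightarrow> cell_map a w x \<in> gasket a"
  by (induction w) (auto intro: contraction_in_gasket)

lemma gasket_cells:
  assumes "x \<in> gasket a"
  shows "\<exists>w. length w = n \<and> x \<in> cell_map a w ` gasket a"
  using assms
proof (induction n arbitrary: x)
  case (Suc n)
  then obtain j y where y: "x = contraction a j y" "y \<in> gasket a"
    using gasket_eq_contractions[of a] by blast
  with Suc.IH obtain w where "length w = n" "y \<in> cell_map a w ` gasket a" by blast
  then show ?case
    using y by (intro exI[of _ "j # w"]) auto
qed (rule exI[of _ "[]"], simp)

lemma triangle_sides_subset_gasket: "triangle_sides a \<subseteq> gasket a"
proof -
  have "triangle_sides a \<subseteq> (\<Union>n. gasket_level a n)" using gasket_level_0 by blast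
  then show ?thesis unfolding gasket_def by (rule order_trans[OF _ closure_subset])
qed

lemma segment_subset_gasket: "closed_segment (vertex a i) (vertex a j) \<subseteq> gasket a"
  using triangle_sides_subset_gasket unfolding triangle_sides_eq by blast

lemma vertex_in_gasket: "vertex a j \<in> gasket a"
  using segment_subset_gasket by blast

section \<open>Position of the cells relative to each other\<close>

lemma closed_cell: "closed (cell_map a w ` gasket a)"
  using compact_continuous_image[OF continuous_on_cell_map compact_gasket] by (rule compact_imp_closed)

text \<open>The points with nonnegative coordinates form the solid triangle: a closed set that
  contains the sides and is mapped into itself by the contractions.\<close>

lemma bary_nonneg:
  assumes "x \<in> gasket a"
  shows "0 \<le> bary a i x"
proof -
  let ?S = "{x. \<forall>i. 0 \<le> bary a i x}"
  have cl: "closed ?S"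
    by (intro closed_Collect_all closed_Collect_le continuous_on_bary continuous_on_const)
  have seg: "closed_segment (vertex a i) (vertex a j) \<subseteq> ?S" for i j
    by (auto simp: closed_segment_def bary_affine bary_vertex simp del: bary.simps)
  have "gasket_level a n \<subseteq> ?S" for n
  proof (induction n)
    case 0
    show ?case using seg unfolding gasket_level_0 triangle_sides_eq by blast
  next
    case (Suc n)
    then show ?case
      unfolding gasket_level_Suc by (auto simp: bary_contraction simp del: bary.simps intro!: add_nonneg_nonneg)
  qed
  then have "gasket a \<subseteq> ?S"
    unfolding gasket_def using cl by (intro closure_minimal) auto
  then show ?thesis using assms by blast
qed

lemma bary_sum: "bary a Lower_Left x + bary a Lower_Right x + bary a Apex x = 1"
  by simp

lemma bary_eq_1:
  assumes "x \<in> gasket a" "1 \<le> bary a j x"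
  shows "x = vertex a j"
proof (rule bary_inject)
  fix i
  have "bary a i x = (if i = j then 1 else 0)"
    using bary_nonneg[OF assms(1), of Lower_Left] bary_nonneg[OF assms(1), of Lower_Right]
      bary_nonneg[OF assms(1), of Apex] assms(2) bary_sum[of a x]
    by (cases i; cases j; simp only: corner.distinct if_True if_False simp_thms; linarith)
  then show "bary a i x = bary a i (vertex a j)"
    using bary_nonneg[OF assms(1)] bary_vertex[of a i j] by simp
qed

text \<open>A contraction averages coordinate \<open>k\<close> with 0 or 1. If the average is 1, the
  coordinate was at least 1 before, so the point was already the corner.\<close>

lemma cell_contains_vertex:
  assumes "x \<in> gasket a" "cell_map a w x = vertex a k"
  shows "x = vertex a k"
  using assms
proof (induction w)
  case (Cons j u)
  let ?y = "cell_map a u x"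
  have y: "?y \<in> gasket a" using Cons.prems by (intro cell_map_in_gasket)
  have e: "contraction a j ?y = vertex a k" using Cons.prems by simp
  have "(bary a k ?y + (if k = j then 1 else 0)) / 2 = 1"
    unfolding bary_contraction[symmetric] e by (simp add: bary_vertex del: bary.simps)
  then have "1 \<le> bary a k ?y" by (auto split: if_splits simp del: bary.simps)
  then have "?y = vertex a k" using y by (rule bary_eq_1[rotated])
  then show ?case using Cons by simp
qed simp

text \<open>Where the words first differ, with letters \<open>j\<close> and \<open>k\<close>,
  comparing coordinate \<open>k\<close> of the two images shows that the point contracted by
  \<open>j\<close> has coordinate at least 1 beforehand, so it is corner \<open>k\<close>. By
  \<open>cell_contains_vertex\<close> a cell reaches this corner only at its own corner.\<close>

lemma cells_meet_at_vertices:
  assumes "length w = length w'" "w \<noteq> w'" "x \<in> gasket a" "y \<in> gasket a"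
    "cell_map a w x = cell_map a w' y"
  shows "x \<in> range (vertex a)"
  using assms
proof (induction w w' rule: list_induct2)
  case (Cons j u k u')
  show ?case
  proof (cases "j = k")
    case True
    have "contraction a k (cell_map a u x) = contraction a k (cell_map a u' y)"
      using Cons.prems True by simp
    then have "cell_map a u x = cell_map a u' y"
      using cell_map_eq_iff[of a "[k]"] by simp
    then show ?thesis using Cons True by auto
  next
    case False
    let ?x = "cell_map a u x" and ?y = "cell_map a u' y"
    have g: "?x \<in> gasket a" "?y \<in> gasket a" using Cons.prems by (auto intro: cell_map_in_gasket)
    have "bary a k (contraction a j ?x) = bary a k (contraction a k ?y)"
      using Cons.prems by simp
    then have "bary a k ?x = bary a k ?y + 1"
      using False by (simp add: bary_contraction del: bary.simps)
    then have "1 \<le> bary a k ?x" using bary_nonneg[OF g(2), of k] by linarith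
    then have "?x = vertex a k" using g(1) by (rule bary_eq_1[rotated])
    then show ?thesis using cell_contains_vertex Cons.prems by blast
  qed
qed simp

text \<open>Only finitely many cells of generation \<open>n\<close> avoid \<open>x\<close>, and they
  are closed, so a ball around \<open>x\<close> misses them all: a nearby point lies only in cells
  that also contain \<open>x\<close>.\<close>

lemma common_cell_nearby:
  assumes "x \<in> gasket a"
  obtains e where "e > 0"
    "\<And>y. y \<in> gasket a \<Longrightarrow> dist x y < e \<Longrightarrow>
       \<exists>w. length w = n \<and> x \<in> cell_map a w ` gasket a \<and> y \<in> cell_map a w ` gasket a"
proof -
  let ?W = "{w. length w = n \<and> x \<notin> cell_map a w ` gasket a}"
  have "finite ?W" by (rule finite_subset[OF _ finite_words[of n]]) blast
  then have "closed (\<Union>w\<in>?W. cell_map a w ` gasket a)" by (rule closed_UN) (simp add: closed_cell)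
  then have "open (- (\<Union>w\<in>?W. cell_map a w ` gasket a))" by (rule open_Compl)
  moreover have "x \<in> - (\<Union>w\<in>?W. cell_map a w ` gasket a)" by auto
  ultimately obtain e where e: "e > 0" "ball x e \<subseteq> - (\<Union>w\<in>?W. cell_map a w ` gasket a)"
    by (rule openE)
  show ?thesis
  proof (rule that[OF e(1)])
    fix y assume y: "y \<in> gasket a" "dist x y < e"
    obtain w where w: "length w = n" "y \<in> cell_map a w ` gasket a" using gasket_cells[OF y(1)] by blast
    moreover have "y \<in> ball x e" using y by simp
    ultimately have "x \<in> cell_map a w ` gasket a" using e(2) by blast
    then show "\<exists>w. length w = n \<and> x \<in> cell_map a w ` gasket a \<and> y \<in> cell_map a w ` gasket a"
      using w by (intro exI[of _ w] conjI)
  qed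
qed

lemma gasket_diameter:
  assumes "x \<in> gasket a" "y \<in> gasket a"
  shows "dist x y \<le> 4 * pi / 3"
proof -
  have v: "vertex a j \<in> cball a (2 * pi / 3)" for j
    by (cases j) (auto simp: dist_norm norm_mult)
  have "triangle_sides a \<subseteq> cball a (2 * pi / 3)"
    unfolding triangle_sides_eq by (intro UN_least closed_segment_subset v convex_cball)
  then have "(\<Union>n. gasket_level a n) \<subseteq> cball a (2 * pi / 3)"
    unfolding gasket_level_def using cell_map_cball
    by (intro UN_least image_subsetI) (auto simp del: mem_cball)
  then have "gasket a \<subseteq> cball a (2 * pi / 3)"
    unfolding gasket_def by (intro closure_minimal) auto
  then have "dist a x \<le> 2 * pi / 3" "dist a y \<le> 2 * pi / 3" using assms by auto
  then show ?thesis using dist_triangle3[of x y a] by linarith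
qed

subsection \<open>Lipschitz functions along curves\<close>

lemma curve_length_upper:
  assumes "mono x" "range x \<subseteq> {0..1}"
  shows "ereal (\<Sum>i<n. dist (g (x i)) (g (x (Suc i)))) \<le> curve_length g"
  unfolding curve_length_def by (rule SUP_upper2[of "(n, x)"]) (use assms in auto)

lemma sum_lessThan_add:
  fixes F :: "nat \<Rightarrow> 'a::comm_monoid_add"
  shows "(\<Sum>i<n + m. F i) = (\<Sum>i<n. F i) + (\<Sum>i<m. F (n + i))"
  by (induction m) (auto simp: add.assoc)

text \<open>The hypothesis compares \<open>t\<close> with nearby points, but not nearby points with
  each other. Bisection still yields a partition: short intervals are subdivided at
  \<open>t\<close>, and partitions of adjacent intervals are concatenated.\<close>

lemma variation_le_curve_length:
  fixes \<phi> :: "real \<Rightarrow> real"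
  assumes loc: "\<And>t. t \<in> {0..1} \<Longrightarrow> \<exists>d>0. \<forall>s\<in>{0..1}. \<bar>s - t\<bar> < d \<longrightarrow> \<bar>\<phi> s - \<phi> t\<bar> \<le> dist (g s) (g t)"
  shows "ereal \<bar>\<phi> 1 - \<phi> 0\<bar> \<le> curve_length g"
proof -
  \<comment> \<open>The bounds 0 and 1 are premises because bisection quantifies over arbitrary
    intervals. As in \<open>curve_length\<close>, a partition is an infinite monotone sequence of
    which the first \<open>n + 1\<close> entries count.\<close>
  define P where "P s t \<longleftrightarrow> (0 \<le> s \<longrightarrow> t \<le> 1 \<longrightarrow> (\<exists>n x. mono x \<and> range x \<subseteq> {s..t} \<and> x 0 = s \<and> x n = t \<and>
      \<bar>\<phi> t - \<phi> s\<bar> \<le> (\<Sum>i<n. dist (g (x i)) (g (x (Suc i))))))" for s t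
  have "P 0 1"
  proof (rule Bolzano)
    fix a b c assume 1: "P a b" and 2: "P b c" and le: "a \<le> b" "b \<le> c"
    show "P a c"
      unfolding P_def
    proof (intro impI)
      assume bd: "0 \<le> a" "c \<le> 1"
      from 1 le bd obtain n x where x: "mono x" "range x \<subseteq> {a..b}" "x 0 = a" "x n = b"
        "\<bar>\<phi> b - \<phi> a\<bar> \<le> (\<Sum>i<n. dist (g (x i)) (g (x (Suc i))))" unfolding P_def by force
      from 2 le bd obtain m y where y: "mono y" "range y \<subseteq> {b..c}" "y 0 = b" "y m = c"
        "\<bar>\<phi> c - \<phi> b\<bar> \<le> (\<Sum>i<m. dist (g (y i)) (g (y (Suc i))))" unfolding P_def by force
      \<comment> \<open>At index \<open>n\<close> both sequences have the value \<open>b\<close>, so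
        they fit together without an extra point.\<close>
      define z where "z i = (if i \<le> n then x i else y (i - n))" for i
      have z1: "z (n + i) = y i" for i using x y by (cases i) (auto simp: z_def)
      have z2: "z i = x i" if "i \<le> n" for i using that by (simp add: z_def)
      have "mono z"
        unfolding mono_iff_le_Suc
      proof
        fix i
        show "z i \<le> z (Suc i)"
        proof (cases "i < n")
          case True then show ?thesis using z2 monoD[OF x(1)] by simp
        next
          case False
          then obtain k where k: "i = n + k" using le_Suc_ex not_less by metis
          have "z (Suc i) = y (Suc k)" using z1[of "Suc k"] k by simp
          then show ?thesis using z1[of k] k monoD[OF y(1), of k "Suc k"] by simp
        qed
      qed
      moreover have "range z \<subseteq> {a..c}"
      proof
        fix u assume "u \<in> range z"
        then obtain i where "u = z i" by blast
        then show "u \<in> {a..c}"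
          using x(2) y(2) le by (cases "i \<le> n") (force simp: z_def)+
      qed
      moreover have "z 0 = a" "z (n + m) = c" using z1 z2 x y by auto
      moreover have "\<bar>\<phi> c - \<phi> a\<bar> \<le> (\<Sum>i<n + m. dist (g (z i)) (g (z (Suc i))))"
      proof -
        have "(\<Sum>i<n + m. dist (g (z i)) (g (z (Suc i))))
            = (\<Sum>i<n. dist (g (z i)) (g (z (Suc i)))) + (\<Sum>i<m. dist (g (z (n + i))) (g (z (n + Suc i))))"
          by (subst sum_lessThan_add) simp
        also have "\<dots> = (\<Sum>i<n. dist (g (x i)) (g (x (Suc i)))) + (\<Sum>i<m. dist (g (y i)) (g (y (Suc i))))"
          by (simp only: z1) (simp add: z2)
        finally show ?thesis using x(5) y(5) by linarith
      qed
      ultimately show "\<exists>n x. mono x \<and> range x \<subseteq> {a..c} \<and> x 0 = a \<and> x n = c \<and>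
          \<bar>\<phi> c - \<phi> a\<bar> \<le> (\<Sum>i<n. dist (g (x i)) (g (x (Suc i))))" by blast
    qed
  next
    fix t :: real assume "0 \<le> t" "t \<le> 1"
    then obtain d where d: "d > 0" "\<And>s. s \<in> {0..1} \<Longrightarrow> \<bar>s - t\<bar> < d \<Longrightarrow> \<bar>\<phi> s - \<phi> t\<bar> \<le> dist (g s) (g t)"
      using loc[of t] by auto
    have "P a b" if "a \<le> t" "t \<le> b" "b - a < d" for a b
      unfolding P_def
    proof (intro impI)
      assume bd: "0 \<le> a" "b \<le> 1"
      \<comment> \<open>Entry 1 is \<open>t\<close> itself, since the local bound holds only for
        increments based at \<open>t\<close>.\<close>
      define x where "x i = (if i = 0 then a else if i = (1::nat) then t else b)" for i
      have "mono x" unfolding mono_iff_le_Suc using that by (auto simp: x_def)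
      moreover have "range x \<subseteq> {a..b}" "x 0 = a" "x 2 = b" using that by (auto simp: x_def)
      moreover have "\<bar>\<phi> b - \<phi> a\<bar> \<le> (\<Sum>i<2. dist (g (x i)) (g (x (Suc i))))"
      proof -
        have "\<bar>\<phi> a - \<phi> t\<bar> \<le> dist (g a) (g t)" "\<bar>\<phi> b - \<phi> t\<bar> \<le> dist (g b) (g t)"
          using that bd by (intro d; simp)+
        moreover have "(\<Sum>i<2. dist (g (x i)) (g (x (Suc i)))) = dist (g a) (g t) + dist (g b) (g t)"
          by (simp add: x_def numeral_2_eq_2 dist_commute)
        ultimately show ?thesis by linarith
      qed
      ultimately show "\<exists>n x. mono x \<and> range x \<subseteq> {a..b} \<and> x 0 = a \<and> x n = b \<and>
          \<bar>\<phi> b - \<phi> a\<bar> \<le> (\<Sum>i<n. dist (g (x i)) (g (x (Suc i))))" by blast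
    qed
    then show "\<exists>d>0. \<forall>a b. a \<le> t \<and> t \<le> b \<and> b - a < d \<longrightarrow> P a b" using d(1) by blast
  qed simp
  then obtain n x where x: "mono x" "range x \<subseteq> {0..1}"
    "\<bar>\<phi> 1 - \<phi> 0\<bar> \<le> (\<Sum>i<n. dist (g (x i)) (g (x (Suc i))))" unfolding P_def by auto
  have "ereal \<bar>\<phi> 1 - \<phi> 0\<bar> \<le> ereal (\<Sum>i<n. dist (g (x i)) (g (x (Suc i))))" using x(3) by simp
  also have "\<dots> \<le> curve_length g" by (rule curve_length_upper[OF x(1,2)])
  finally show ?thesis .
qed

abbreviation cell_vertex :: "complex \<Rightarrow> corner list \<Rightarrow> corner \<Rightarrow> complex" where
  "cell_vertex a w j \<equiv> cell_map a w (vertex a j)"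

text \<open>The McShane extension of the corner values of a cell. On a single cell it is Lipschitz for the
  Euclidean metric, and adjacent cells share only corners, so the extensions fit together.\<close>

definition corner_fun :: "(complex \<Rightarrow> real) \<Rightarrow> complex \<Rightarrow> corner list \<Rightarrow> complex \<Rightarrow> real" where
  "corner_fun f a w x = (MIN j. f (cell_vertex a w j) + dist x (cell_vertex a w j))"

lemma finite_range_corner [simp]: "finite (range (h :: corner \<Rightarrow> 'b))"
  by (simp add: corner_UNIV)

lemma corner_fun_le: "corner_fun f a w x \<le> f (cell_vertex a w j) + dist x (cell_vertex a w j)"
  unfolding corner_fun_def by (rule Min_le) auto

lemma corner_fun_attained: "\<exists>j. corner_fun f a w x = f (cell_vertex a w j) + dist x (cell_vertex a w j)"
proof -
  have "corner_fun f a w x \<in> range (\<lambda>j. f (cell_vertex a w j) + dist x (cell_vertex a w j))"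
    unfolding corner_fun_def by (rule Min_in) auto
  then show ?thesis by blast
qed

lemma corner_fun_lipschitz: "\<bar>corner_fun f a w x - corner_fun f a w y\<bar> \<le> dist x y"
proof -
  have "corner_fun f a w x - corner_fun f a w y \<le> dist x y" for x y
  proof -
    obtain j where "corner_fun f a w y = f (cell_vertex a w j) + dist y (cell_vertex a w j)"
      using corner_fun_attained by blast
    then show ?thesis
      using corner_fun_le[of f a w x j] dist_triangle[of x "cell_vertex a w j" y] by linarith
  qed
  from this[of x y] this[of y x] show ?thesis by (simp add: dist_commute abs_le_iff)
qed

text \<open>Another corner cannot give a smaller value, because the data are already 1-Lipschitz on
  the three corners.\<close>

lemma corner_fun_vertex:
  assumes "\<And>i j. \<bar>f (cell_vertex a w i) - f (cell_vertex a w j)\<bar> \<le> dist (cell_vertex a w i) (cell_vertex a w j)"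
  shows "corner_fun f a w (cell_vertex a w i) = f (cell_vertex a w i)"
proof -
  obtain j where "corner_fun f a w (cell_vertex a w i) = f (cell_vertex a w j) + dist (cell_vertex a w i) (cell_vertex a w j)"
    using corner_fun_attained by blast
  then show ?thesis
    using corner_fun_le[of f a w "cell_vertex a w i" i] assms[of i j] by simp
qed

text \<open>The cell is chosen arbitrarily; for data that are 1-Lipschitz on corners,
  \<open>level_fun_eq\<close> shows that the value does not depend on the choice.\<close>

definition level_fun :: "(complex \<Rightarrow> real) \<Rightarrow> complex \<Rightarrow> nat \<Rightarrow> complex \<Rightarrow> real" where
  "level_fun f a n x = corner_fun f a (SOME w. length w = n \<and> x \<in> cell_map a w ` gasket a) x"

text \<open>A point of two different cells of the same generation is a corner of both, and there
  both extensions have the value of \<open>f\<close>.\<close>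

lemma level_fun_eq:
  assumes edge: "\<And>w i j. \<bar>f (cell_vertex a w i) - f (cell_vertex a w j)\<bar> \<le> dist (cell_vertex a w i) (cell_vertex a w j)"
    and w: "length w = n" "x \<in> cell_map a w ` gasket a"
  shows "level_fun f a n x = corner_fun f a w x"
proof -
  define v where "v = (SOME w. length w = n \<and> x \<in> cell_map a w ` gasket a)"
  have v: "length v = n \<and> x \<in> cell_map a v ` gasket a"
    unfolding v_def by (rule someI[of _ w]) (use w in blast)
  have l: "length w = length v" "length v = length w" using v w by auto
  obtain y z where y: "y \<in> gasket a" "x = cell_map a w y" and z: "z \<in> gasket a" "x = cell_map a v z"
    using v w by blast
  have e: "cell_map a w y = cell_map a v z" "cell_map a v z = cell_map a w y" using y z by auto
  show ?thesis
  proof (cases "v = w")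
    case False
    obtain i where i: "x = cell_vertex a w i"
      using cells_meet_at_vertices[OF l(1) False[symmetric] y(1) z(1) e(1)] y by auto
    obtain j where j: "x = cell_vertex a v j"
      using cells_meet_at_vertices[OF l(2) False z(1) y(1) e(2)] z by auto
    have "corner_fun f a w x = f x" unfolding i by (rule corner_fun_vertex[OF edge])
    moreover have "corner_fun f a v x = f x" unfolding j by (rule corner_fun_vertex[OF edge])
    ultimately show ?thesis unfolding level_fun_def v_def[symmetric] by simp
  qed (simp add: level_fun_def v_def[symmetric])
qed

text \<open>The value at \<open>x\<close> is \<open>f\<close> at a corner of a cell containing
  \<open>x\<close>, plus the distance to that corner; both errors vanish with the diameter of the
  cell.\<close>

lemma level_fun_approx:
  assumes edge: "\<And>w i j. \<bar>f (cell_vertex a w i) - f (cell_vertex a w j)\<bar> \<le> dist (cell_vertex a w i) (cell_vertex a w j)"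
    and f: "continuous_on (gasket a) f" and x: "x \<in> gasket a"
  shows "(\<lambda>n. level_fun f a n x) \<longlonglongrightarrow> f x"
proof (rule LIMSEQ_I)
  fix r :: real assume r: "r > 0"
  then obtain d where d: "d > 0" "\<And>y. y \<in> gasket a \<Longrightarrow> dist y x < d \<Longrightarrow> dist (f y) (f x) < r / 2"
    using f x unfolding continuous_on_iff by (meson half_gt_zero)
  have "(\<lambda>n. 4 * pi / 3 / 2 ^ n) \<longlonglongrightarrow> 0" by (intro LIMSEQ_divide_realpow_zero) auto
  then have "\<forall>\<^sub>F n in sequentially. 4 * pi / 3 / 2 ^ n < min d (r / 2)"
    by (rule order_tendstoD) (use d r in auto)
  then obtain N where N: "\<And>n. n \<ge> N \<Longrightarrow> 4 * pi / 3 / 2 ^ n < min d (r / 2)"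
    unfolding eventually_sequentially by blast
  show "\<exists>no. \<forall>n\<ge>no. norm (level_fun f a n x - f x) < r"
  proof (intro exI[of _ N] allI impI)
    fix n assume n: "n \<ge> N"
    obtain w where w: "length w = n" "x \<in> cell_map a w ` gasket a" using gasket_cells[OF x] by blast
    then obtain y where y: "y \<in> gasket a" "x = cell_map a w y" by blast
    obtain j where j: "corner_fun f a w x = f (cell_vertex a w j) + dist x (cell_vertex a w j)"
      using corner_fun_attained by blast
    have "dist x (cell_vertex a w j) \<le> 4 * pi / 3 / 2 ^ n"
      unfolding y(2) dist_cell_map w(1)
      by (intro divide_right_mono gasket_diameter[of _ a] y vertex_in_gasket) auto
    with N[OF n] have *: "dist x (cell_vertex a w j) < d" "dist x (cell_vertex a w j) < r / 2" by auto
    have "\<bar>f (cell_vertex a w j) - f x\<bar> < r / 2"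
      unfolding dist_real_def[symmetric]
      using * by (intro d cell_map_in_gasket vertex_in_gasket) (simp add: dist_commute)
    then show "norm (level_fun f a n x - f x) < r"
      unfolding level_fun_eq[OF edge w] j real_norm_def
      using * zero_le_dist[of x "cell_vertex a w j"] by linarith
  qed
qed

text \<open>Increments of \<open>f\<close> inside a cell are not controlled, those of
  \<open>level_fun\<close> are: for \<open>s\<close> near \<open>t\<close> the points
  \<open>g s\<close> and \<open>g t\<close> share a cell. The limit over the generations returns to
  \<open>f\<close>.\<close>

lemma real_increment_le_curve_length:
  assumes edge: "\<And>w i j. \<bar>f (cell_vertex a w i) - f (cell_vertex a w j)\<bar> \<le> dist (cell_vertex a w i) (cell_vertex a w j)"
    and f: "continuous_on (gasket a) f"
    and g: "path g" "path_image g \<subseteq> gasket a"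
  shows "ereal \<bar>f (g 1) - f (g 0)\<bar> \<le> curve_length g"
proof (rule LIMSEQ_le_const2)
  have gin: "g t \<in> gasket a" if "t \<in> {0..1}" for t using g(2) that by (auto simp: path_image_def)
  have "(\<lambda>n. \<bar>level_fun f a n (g 1) - level_fun f a n (g 0)\<bar>) \<longlonglongrightarrow> \<bar>f (g 1) - f (g 0)\<bar>"
    by (intro tendsto_intros level_fun_approx[OF edge f] gin) auto
  then show "(\<lambda>n. ereal \<bar>level_fun f a n (g 1) - level_fun f a n (g 0)\<bar>) \<longlonglongrightarrow> ereal \<bar>f (g 1) - f (g 0)\<bar>"
    by simp
  have "ereal \<bar>level_fun f a n (g 1) - level_fun f a n (g 0)\<bar> \<le> curve_length g" for n
  proof (rule variation_le_curve_length[of "\<lambda>t. level_fun f a n (g t)"])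
    fix t :: real assume t: "t \<in> {0..1}"
    obtain e where e: "e > 0" "\<And>y. y \<in> gasket a \<Longrightarrow> dist (g t) y < e \<Longrightarrow>
       \<exists>w. length w = n \<and> g t \<in> cell_map a w ` gasket a \<and> y \<in> cell_map a w ` gasket a"
      using common_cell_nearby[OF gin[OF t], of n] by blast
    obtain d where d: "d > 0" "\<And>s. s \<in> {0..1} \<Longrightarrow> dist s t < d \<Longrightarrow> dist (g s) (g t) < e"
      using g(1) t e(1) unfolding path_def continuous_on_iff by blast
    show "\<exists>d>0. \<forall>s\<in>{0..1}. \<bar>s - t\<bar> < d \<longrightarrow> \<bar>level_fun f a n (g s) - level_fun f a n (g t)\<bar> \<le> dist (g s) (g t)"
    proof (intro exI[of _ d] conjI ballI impI d(1))
      fix s :: real assume s: "s \<in> {0..1}" "\<bar>s - t\<bar> < d"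
      then have "dist (g t) (g s) < e" using d(2)[of s] by (simp add: dist_commute dist_real_def)
      then obtain w where w: "length w = n" "g t \<in> cell_map a w ` gasket a" "g s \<in> cell_map a w ` gasket a"
        using e(2)[OF gin[OF s(1)]] by blast
      show "\<bar>level_fun f a n (g s) - level_fun f a n (g t)\<bar> \<le> dist (g s) (g t)"
        unfolding level_fun_eq[OF edge w(1,2)] level_fun_eq[OF edge w(1,3)] by (rule corner_fun_lipschitz)
    qed
  qed
  then show "\<exists>N. \<forall>n\<ge>N. ereal \<bar>level_fun f a n (g 1) - level_fun f a n (g 0)\<bar> \<le> curve_length g" by blast
qed

section \<open>From Lipschitz bounds along the sides to increments along curves\<close>

lemma cell_param_corners:
  "cell_param a w 0 = cell_vertex a w Lower_Right"
  "cell_param a w (2 * pi / 3 / 2 ^ length w) = cell_vertex a w Apex"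
  "cell_param a w (- (2 * pi / 3 / 2 ^ length w)) = cell_vertex a w Lower_Left"
  by (auto simp: cell_param_def Let_def linepath_def simp del: vertex.simps)

lemma cell_param_ends: "cell_param a w (pi / 2 ^ length w) = cell_param a w (- (pi / 2 ^ length w))"
proof -
  have "pi / 2 ^ length w / (2 * pi / 3 / 2 ^ length w) = 3 / 2" by (simp add: field_simps)
  moreover from this have "- (pi / 2 ^ length w) / (2 * pi / 3 / 2 ^ length w) = - 3 / 2"
    by (metis minus_divide_left)
  ultimately show ?thesis
    unfolding cell_param_def Let_def by simp
qed

lemma cnj_sgn_mult: "cnj (sgn z) * z = cmod z"
proof (cases "z = 0")
  case False
  have "cnj (sgn z) * z = (z * cnj z) / of_real (cmod z)" by (simp add: sgn_eq)
  also have "\<dots> = of_real (cmod z)" using False by (simp add: complex_norm_square[symmetric] power2_eq_square)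
  finally show ?thesis .
qed simp

text \<open>The bounds along the sides enter only through the corners of cells. Multiplication by
  the conjugate phase of the total increment makes this increment real, so the real case applies to
  the real part.\<close>

lemma increment_le_curve_length:
  fixes f :: "complex \<Rightarrow> complex"
  assumes lip: "\<And>w s t. s \<in> {- (pi / 2 ^ length w)..pi / 2 ^ length w} \<Longrightarrow> t \<in> {- (pi / 2 ^ length w)..pi / 2 ^ length w}
      \<Longrightarrow> cmod (f (cell_param a w s) - f (cell_param a w t)) \<le> \<bar>s - t\<bar>"
    and f: "continuous_on (gasket a) f"
    and g: "path g" "path_image g \<subseteq> gasket a"
  shows "ereal (cmod (f (g 1) - f (g 0))) \<le> curve_length g"
proof -
  have edge: "cmod (f (cell_vertex a w i) - f (cell_vertex a w j)) \<le> dist (cell_vertex a w i) (cell_vertex a w j)" for w i j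
  proof -
    define S where "S = 2 * pi / 3 / 2 ^ length w"
    define h where "h t = f (cell_param a w t)" for t
    have S0: "S > 0" by (simp add: S_def)
    have L: "pi / 2 ^ length w = 3 * S / 2" by (simp add: S_def)
    have lip': "cmod (h s - h t) \<le> \<bar>s - t\<bar>" if "\<bar>s\<bar> \<le> 3 * S / 2" "\<bar>t\<bar> \<le> 3 * S / 2" for s t
      unfolding h_def using that by (intro lip) (auto simp: L)
    \<comment> \<open>The left side joins the parameters \<open>S\<close> and \<open>- S\<close>
      across the seam at plus and minus \<open>3 * S / 2\<close>, its midpoint, with
      \<open>S / 2\<close> on either hand. The direct way in the parameter interval would only give
      \<open>2 * S\<close>.\<close>
    have "cmod (h S - h (- S)) \<le> S"
    proof -
      have "h (3 * S / 2) = h (- (3 * S / 2))" using cell_param_ends[of a w] by (simp add: h_def L)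
      then have "h S - h (- S) = (h S - h (3 * S / 2)) + (h (- (3 * S / 2)) - h (- S))" by simp
      also have "cmod \<dots> \<le> cmod (h S - h (3 * S / 2)) + cmod (h (- (3 * S / 2)) - h (- S))"
        by (rule norm_triangle_ineq)
      also have "\<dots> \<le> \<bar>S - 3 * S / 2\<bar> + \<bar>- (3 * S / 2) - (- S)\<bar>"
        using S0 by (intro add_mono lip') auto
      also have "\<dots> = S" using S0 by simp
      finally show ?thesis .
    qed
    moreover have "cmod (h 0 - h S) \<le> S" "cmod (h 0 - h (- S)) \<le> S"
      using lip'[of 0 S] lip'[of 0 "- S"] S0 by auto
    moreover have "h 0 = f (cell_vertex a w Lower_Right)" "h S = f (cell_vertex a w Apex)"
        "h (- S) = f (cell_vertex a w Lower_Left)"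
      by (simp_all only: h_def S_def cell_param_corners)
    moreover have "dist (cell_vertex a w i) (cell_vertex a w j) = (if i = j then 0 else S)"
      by (simp add: dist_cell_map dist_vertex S_def del: vertex.simps)
    ultimately show ?thesis
      by (cases i; cases j) (simp_all add: norm_minus_commute del: vertex.simps)
  qed
  define u where "u = cnj (sgn (f (g 1) - f (g 0)))"
  have u: "cmod u \<le> 1" by (simp add: u_def norm_sgn)
  define F where "F x = Re (u * f x)" for x
  have "\<bar>F (cell_vertex a w i) - F (cell_vertex a w j)\<bar> \<le> dist (cell_vertex a w i) (cell_vertex a w j)" for w i j
  proof -
    have "\<bar>F (cell_vertex a w i) - F (cell_vertex a w j)\<bar> = \<bar>Re (u * (f (cell_vertex a w i) - f (cell_vertex a w j)))\<bar>"
      by (simp add: F_def algebra_simps)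
    also have "\<dots> \<le> cmod u * cmod (f (cell_vertex a w i) - f (cell_vertex a w j))"
      unfolding norm_mult[symmetric] by (rule abs_Re_le_cmod)
    also have "\<dots> \<le> 1 * dist (cell_vertex a w i) (cell_vertex a w j)"
      by (intro mult_mono u edge) auto
    finally show ?thesis by simp
  qed
  moreover have "continuous_on (gasket a) F" unfolding F_def by (intro continuous_intros f)
  ultimately have "ereal \<bar>F (g 1) - F (g 0)\<bar> \<le> curve_length g"
    using g by (rule real_increment_le_curve_length)
  moreover have "F (g 1) - F (g 0) = cmod (f (g 1) - f (g 0))"
  proof -
    have "F (g 1) - F (g 0) = Re (u * (f (g 1) - f (g 0)))" by (simp add: F_def algebra_simps)
    also have "u * (f (g 1) - f (g 0)) = cmod (f (g 1) - f (g 0))"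
      unfolding u_def by (rule cnj_sgn_mult)
    finally show ?thesis by simp
  qed
  ultimately show ?thesis by simp
qed

subsection \<open>The geodesic distance\<close>

lemma curve_length_lipschitz:
  assumes "C-lipschitz_on {0..1} g"
  shows "curve_length g \<le> ereal C"
  unfolding curve_length_def
proof (rule SUP_least, clarify)
  fix n and x :: "nat \<Rightarrow> real"
  assume x: "mono x" "range x \<subseteq> {0..1}"
  have x01: "x i \<in> {0..1}" for i using x(2) by blast
  have "(\<Sum>i<n. dist (g (x i)) (g (x (Suc i)))) \<le> (\<Sum>i<n. C * (x (Suc i) - x i))"
  proof (rule sum_mono)
    fix i
    have "dist (g (x i)) (g (x (Suc i))) \<le> C * dist (x i) (x (Suc i))"
      by (intro lipschitz_onD[OF assms] x01)
    moreover have "x i \<le> x (Suc i)" using x(1) by (simp add: monoD)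
    ultimately show "dist (g (x i)) (g (x (Suc i))) \<le> C * (x (Suc i) - x i)"
      by (simp add: dist_real_def)
  qed
  also have "\<dots> = C * (x n - x 0)"
    by (simp only: sum_distrib_left[symmetric] sum_lessThan_telescope)
  also have "\<dots> \<le> C * 1"
  proof (rule mult_left_mono[OF _ lipschitz_on_nonneg[OF assms]])
    have "x n \<in> {0..1}" "x 0 \<in> {0..1}" using x(2) by blast+
    then show "x n - x 0 \<le> 1" by simp
  qed
  finally show "ereal (\<Sum>i<n. dist (g (x i)) (g (x (Suc i)))) \<le> ereal C" by simp
qed

text \<open>Clamping a partition to each half by \<open>min\<close> and \<open>max\<close> gives
  partitions for both curves without inserting \<open>1/2\<close>. On the interval that straddles
  the junction, the triangle inequality goes through the common point.\<close>

lemma curve_length_join: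
  assumes "pathfinish g1 = pathstart g2"
  shows "curve_length (g1 +++ g2) \<le> curve_length g1 + curve_length g2"
  unfolding curve_length_def[of "g1 +++ g2"]
proof (rule SUP_least, clarify)
  fix n and x :: "nat \<Rightarrow> real"
  assume x: "mono x" "range x \<subseteq> {0..1}"
  define y where "y i = min 1 (2 * x i)" for i
  define z where "z i = max 0 (2 * x i - 1)" for i
  have x01: "x i \<in> {0..1}" for i using x(2) by blast
  have le: "x i \<le> x j" if "i \<le> j" for i j using x(1) that by (rule monoD)
  have y: "mono y" "range y \<subseteq> {0..1}" using x01 le by (force simp: y_def mono_def)+
  have z: "mono z" "range z \<subseteq> {0..1}" using x01 le by (force simp: z_def mono_def)+
  have st: "dist ((g1 +++ g2) (x i)) ((g1 +++ g2) (x (Suc i)))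
      \<le> dist (g1 (y i)) (g1 (y (Suc i))) + dist (g2 (z i)) (g2 (z (Suc i)))" for i
  proof -
    consider "x (Suc i) \<le> 1/2" | "x i \<le> 1/2" "x (Suc i) > 1/2" | "x i > 1/2" by linarith
    then show ?thesis
    proof cases
      case 1
      then have "y i = 2 * x i" "y (Suc i) = 2 * x (Suc i)" "z i = 0" "z (Suc i) = 0" "x i \<le> 1/2"
        using le[of i "Suc i"] by (auto simp: y_def z_def)
      then show ?thesis using 1 by (simp add: joinpaths_def)
    next
      case 2
      then have "y i = 2 * x i" "y (Suc i) = 1" "z i = 0" "z (Suc i) = 2 * x (Suc i) - 1"
        by (auto simp: y_def z_def)
      then show ?thesis using 2 assms dist_triangle[of "g1 (2 * x i)" "g2 (2 * x (Suc i) - 1)" "g1 1"]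
        by (simp add: joinpaths_def pathfinish_def pathstart_def)
    next
      case 3
      then have "y i = 1" "y (Suc i) = 1" "z i = 2 * x i - 1" "z (Suc i) = 2 * x (Suc i) - 1" "x (Suc i) > 1/2"
        using le[of i "Suc i"] by (auto simp: y_def z_def)
      then show ?thesis using 3 by (simp add: joinpaths_def)
    qed
  qed
  have "ereal (\<Sum>i<n. dist ((g1 +++ g2) (x i)) ((g1 +++ g2) (x (Suc i))))
      \<le> ereal ((\<Sum>i<n. dist (g1 (y i)) (g1 (y (Suc i)))) + (\<Sum>i<n. dist (g2 (z i)) (g2 (z (Suc i)))))"
    using st by (simp add: sum.distrib[symmetric] sum_mono)
  also have "\<dots> = ereal (\<Sum>i<n. dist (g1 (y i)) (g1 (y (Suc i)))) + ereal (\<Sum>i<n. dist (g2 (z i)) (g2 (z (Suc i))))"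
    by simp
  also have "\<dots> \<le> curve_length g1 + curve_length g2"
    by (intro add_mono curve_length_upper y z)
  finally show "ereal (\<Sum>i<n. dist ((g1 +++ g2) (x i)) ((g1 +++ g2) (x (Suc i)))) \<le> curve_length g1 + curve_length g2" .
qed

text \<open>A workable form of being joined by a curve of length at most \<open>C\<close>: a
  Lipschitz constant on the unit interval bounds the length, scales under cell maps and survives
  uniform limits.\<close>

definition lipschitz_joined :: "'a::metric_space set \<Rightarrow> real \<Rightarrow> 'a \<Rightarrow> 'a \<Rightarrow> bool" where
  "lipschitz_joined S C x y \<longleftrightarrow> (\<exists>g. C-lipschitz_on {0..1} g \<and> g ` {0..1} \<subseteq> S \<and> g (0::real) = x \<and> g 1 = y)"

lemma lipschitz_joined_commute:
  assumes "lipschitz_joined S C x y"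
  shows "lipschitz_joined S C y x"
proof -
  obtain g where g: "C-lipschitz_on {0..1} g" "g ` {0..1} \<subseteq> S" "g (0::real) = x" "g 1 = y"
    using assms unfolding lipschitz_joined_def by blast
  have "C-lipschitz_on {0..1} (\<lambda>t. g (1 - t))"
  proof (rule lipschitz_onI)
    fix s t :: real assume "s \<in> {0..1}" "t \<in> {0..1}"
    then have "dist (g (1 - s)) (g (1 - t)) \<le> C * dist (1 - s) (1 - t)"
      by (intro lipschitz_onD[OF g(1)]) auto
    then show "dist (g (1 - s)) (g (1 - t)) \<le> C * dist s t" by (simp add: dist_real_def abs_minus_commute)
  qed (rule lipschitz_on_nonneg[OF g(1)])
  moreover have "(\<lambda>t. g (1 - t)) ` {0..1} \<subseteq> S" using g(2) by force
  ultimately show ?thesis unfolding lipschitz_joined_def using g(3,4) by (intro exI[of _ "\<lambda>t. g (1 - t)"]) simp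
qed

text \<open>Each curve is run at double speed, whence the factor 2.\<close>

lemma lipschitz_joined_trans:
  assumes "lipschitz_joined S C x y" "lipschitz_joined S C y z"
  shows "lipschitz_joined S (2 * C) x z"
proof -
  obtain g where g: "C-lipschitz_on {0..1} g" "g ` {0..1} \<subseteq> S" "g (0::real) = x" "g 1 = y"
    using assms unfolding lipschitz_joined_def by blast
  obtain h where h: "C-lipschitz_on {0..1} h" "h ` {0..1} \<subseteq> S" "h (0::real) = y" "h 1 = z"
    using assms unfolding lipschitz_joined_def by blast
  have C0: "0 \<le> 2 * C" using lipschitz_on_nonneg[OF g(1)] by simp
  have 1: "(2 * C)-lipschitz_on {0..1/2} (\<lambda>t. g (2 * t))"
  proof (rule lipschitz_onI[OF _ C0])
    fix s t :: real assume "s \<in> {0..1/2}" "t \<in> {0..1/2}"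
    then have "dist (g (2 * s)) (g (2 * t)) \<le> C * dist (2 * s) (2 * t)"
      by (intro lipschitz_onD[OF g(1)]) auto
    also have "dist (2 * s) (2 * t) = 2 * dist s t" unfolding dist_real_def by (auto simp: abs_if)
    finally show "dist (g (2 * s)) (g (2 * t)) \<le> 2 * C * dist s t" by simp
  qed
  have 2: "(2 * C)-lipschitz_on {1/2..1} (\<lambda>t. h (2 * t - 1))"
  proof (rule lipschitz_onI[OF _ C0])
    fix s t :: real assume "s \<in> {1/2..1}" "t \<in> {1/2..1}"
    then have "dist (h (2 * s - 1)) (h (2 * t - 1)) \<le> C * dist (2 * s - 1) (2 * t - 1)"
      by (intro lipschitz_onD[OF h(1)]) auto
    also have "dist (2 * s - 1) (2 * t - 1) = 2 * dist s t" unfolding dist_real_def by (auto simp: abs_if)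
    finally show "dist (h (2 * s - 1)) (h (2 * t - 1)) \<le> 2 * C * dist s t" by simp
  qed
  have "(2 * C)-lipschitz_on {0..1} (g +++ h)"
    unfolding joinpaths_def using g(4) h(3) by (intro lipschitz_on_concat[OF 1 2]) simp
  moreover have "(g +++ h) ` {0..1} \<subseteq> S"
  proof
    fix u assume "u \<in> (g +++ h) ` {0..1}"
    then obtain t where t: "t \<in> {0..1}" "u = (g +++ h) t" by blast
    then have "u \<in> g ` {0..1} \<or> u \<in> h ` {0..1}" by (auto simp: joinpaths_def)
    then show "u \<in> S" using g(2) h(2) by blast
  qed
  ultimately show ?thesis
    unfolding lipschitz_joined_def using g(3) h(4) by (intro exI[of _ "g +++ h"]) (simp add: joinpaths_def)
qed

lemma lipschitz_joined_segment:
  fixes x y :: "'a::real_normed_vector"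
  assumes "closed_segment x y \<subseteq> S" "dist x y \<le> C"
  shows "lipschitz_joined S C x y"
proof -
  have "C-lipschitz_on {0..1} (linepath x y)"
  proof (rule lipschitz_onI)
    show "0 \<le> C" using assms(2) zero_le_dist order_trans by blast
    fix s t :: real
    have "linepath x y s - linepath x y t = (s - t) *\<^sub>R (y - x)"
      by (simp add: linepath_def algebra_simps)
    then have "dist (linepath x y s) (linepath x y t) = dist x y * dist s t"
      by (simp add: dist_norm norm_minus_commute)
    then show "dist (linepath x y s) (linepath x y t) \<le> C * dist s t"
      using assms(2) by (simp add: mult_right_mono)
  qed
  moreover have "linepath x y ` {0..1} \<subseteq> S" using assms(1) by (simp add: linepath_image_01)
  ultimately show ?thesis
    unfolding lipschitz_joined_def by (intro exI[of _ "linepath x y"]) (simp add: linepath_def)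
qed

text \<open>Arzela-Ascoli: curves with a common Lipschitz constant in a compact set have a uniformly
  convergent subsequence. The limit keeps the constant and the starting point, stays in the closed
  set and ends in \<open>y\<close>.\<close>

lemma lipschitz_joined_closure:
  fixes S :: "'a::euclidean_space set"
  assumes S: "compact S" and V: "\<And>v. v \<in> V \<Longrightarrow> lipschitz_joined S C x v" and y: "y \<in> closure V"
  shows "lipschitz_joined S C x y"
proof -
  obtain v where v: "\<And>n. v n \<in> V" "v \<longlonglongrightarrow> y" using y by (auto simp: closure_sequential)
  have "\<exists>g. C-lipschitz_on {0..1} g \<and> g ` {0..1} \<subseteq> S \<and> g (0::real) = x \<and> g 1 = v n" for n
    using V[OF v(1)] unfolding lipschitz_joined_def .
  then obtain g where g: "\<And>n. C-lipschitz_on {0..1} (g n)" "\<And>n. g n ` {0..1} \<subseteq> S"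
    "\<And>n. g n (0::real) = x" "\<And>n. g n 1 = v n" by metis
  obtain M where M: "\<And>z. z \<in> S \<Longrightarrow> norm z \<le> M" using compact_imp_bounded[OF S] by (auto simp: bounded_iff)
  have C0: "C \<ge> 0" using lipschitz_on_nonneg[OF g(1)] .
  obtain h k where h: "continuous_on {0..1} h" "strict_mono (k :: nat \<Rightarrow> nat)"
    "\<And>e. 0 < e \<Longrightarrow> \<exists>N. \<forall>n x. n \<ge> N \<and> x \<in> {0..1} \<longrightarrow> norm (g (k n) x - h x) < e"
  proof (rule Arzela_Ascoli[of "{0..1::real}" g M])
    show "norm (g n t) \<le> M" if "t \<in> {0..1}" for n t using M g(2) that by blast
    show "\<exists>d>0. \<forall>n t. t \<in> {0..1} \<and> norm (s - t) < d \<longrightarrow> norm (g n s - g n t) < e"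
      if s: "s \<in> {0..1}" and e: "e > 0" for s e :: real
    \<comment> \<open>The summand 1 covers \<open>C = 0\<close>.\<close>
    proof (intro exI[of _ "e / (C + 1)"] conjI allI impI)
      show "e / (C + 1) > 0" using e C0 by simp
      fix n t assume t: "t \<in> {0..1} \<and> norm (s - t) < e / (C + 1)"
      then have "norm (g n s - g n t) \<le> C * norm (s - t)"
        using lipschitz_onD[OF g(1)] s by (simp add: dist_norm)
      also have "\<dots> \<le> (C + 1) * norm (s - t)" using C0 by (intro mult_right_mono) auto
      also have "\<dots> < (C + 1) * (e / (C + 1))" using t C0 by (intro mult_strict_left_mono) auto
      also have "\<dots> = e" using C0 by simp
      finally show "norm (g n s - g n t) < e" .
    qed
  qed auto
  have lim: "(\<lambda>n. g (k n) t) \<longlonglongrightarrow> h t" if "t \<in> {0..1}" for t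
    using h(3) that unfolding lim_sequentially dist_norm by blast
  have "C-lipschitz_on {0..1} h"
  proof (rule lipschitz_onI[OF _ C0])
    fix s t :: real assume st: "s \<in> {0..1}" "t \<in> {0..1}"
    have "(\<lambda>n. dist (g (k n) s) (g (k n) t)) \<longlonglongrightarrow> dist (h s) (h t)"
      using lim st by (intro tendsto_dist) auto
    then show "dist (h s) (h t) \<le> C * dist s t"
      by (rule LIMSEQ_le_const2) (use lipschitz_onD[OF g(1)] st in blast)
  qed
  moreover have "h ` {0..1} \<subseteq> S"
  proof clarify
    fix t :: real assume t: "t \<in> {0..1}"
    then have "\<And>n. g (k n) t \<in> S" using g(2) by blast
    then show "h t \<in> S" using lim[OF t] compact_imp_closed[OF S] by (rule closed_sequentially[rotated])
  qed
  moreover have "h 0 = x" using lim[of 0] by (simp add: g(3) LIMSEQ_const_iff)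
  moreover have "h 1 = y"
  proof -
    have "(\<lambda>n. v (k n)) \<longlonglongrightarrow> h 1" using lim[of 1] by (simp add: g(4))
    moreover have "(\<lambda>n. v (k n)) \<longlonglongrightarrow> y" using LIMSEQ_subseq_LIMSEQ[OF v(2) h(2)] by (simp add: o_def)
    ultimately show ?thesis by (rule LIMSEQ_unique)
  qed
  ultimately show ?thesis unfolding lipschitz_joined_def by blast
qed

lemma lipschitz_joined_cell_map:
  assumes "lipschitz_joined (gasket a) C x y"
  shows "lipschitz_joined (gasket a) (C / 2 ^ length w) (cell_map a w x) (cell_map a w y)"
proof -
  obtain g where g: "C-lipschitz_on {0..1} g" "g ` {0..1} \<subseteq> gasket a" "g (0::real) = x" "g 1 = y"
    using assms unfolding lipschitz_joined_def by blast
  have "(C / 2 ^ length w)-lipschitz_on {0..1} (cell_map a w \<circ> g)"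
  proof (rule lipschitz_onI)
    show "0 \<le> C / 2 ^ length w" using lipschitz_on_nonneg[OF g(1)] by simp
    fix s t :: real assume "s \<in> {0..1}" "t \<in> {0..1}"
    then have "dist (g s) (g t) \<le> C * dist s t" by (rule lipschitz_onD[OF g(1)])
    then show "dist ((cell_map a w \<circ> g) s) ((cell_map a w \<circ> g) t) \<le> C / 2 ^ length w * dist s t"
      by (simp add: dist_cell_map divide_right_mono)
  qed
  moreover have "(cell_map a w \<circ> g) ` {0..1} \<subseteq> gasket a" using g(2) by (auto intro!: cell_map_in_gasket)
  ultimately show ?thesis
    unfolding lipschitz_joined_def using g(3,4) by (intro exI[of _ "cell_map a w \<circ> g"]) simp
qed

text \<open>The constant does not grow with the word: at most half a side, of length
  \<open>pi / 3\<close>, leads to the lower left corner of the first subcell, and the curve for the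
  shorter word is scaled by one half. The factor 2 of the concatenation restores
  \<open>2 * pi / 3\<close>.\<close>

lemma lipschitz_joined_cell_vertex:
  "lipschitz_joined (gasket a) (2 * pi / 3) (vertex a Lower_Left) (cell_vertex a w j)"
proof (induction w)
  case Nil
  show ?case
    by (rule lipschitz_joined_segment) (simp_all add: segment_subset_gasket dist_vertex del: vertex.simps)
next
  case (Cons k w)
  let ?o = "vertex a Lower_Left"
  have "contraction a k ?o = (?o + vertex a k) / 2" by (simp add: contraction_def)
  then have m: "contraction a k ?o = midpoint ?o (vertex a k)" by (simp add: midpoint_def scaleR_conv_of_real)
  have "closed_segment ?o (contraction a k ?o) \<subseteq> closed_segment ?o (vertex a k)"
    unfolding m by (simp add: subset_closed_segment)
  then have "closed_segment ?o (contraction a k ?o) \<subseteq> gasket a" using segment_subset_gasket by blast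
  then have 1: "lipschitz_joined (gasket a) (pi / 3) ?o (contraction a k ?o)"
    by (rule lipschitz_joined_segment) (simp add: m dist_midpoint dist_vertex del: vertex.simps)
  have 2: "lipschitz_joined (gasket a) (pi / 3) (contraction a k ?o) (contraction a k (cell_vertex a w j))"
    using lipschitz_joined_cell_map[OF Cons, of "[k]"] by simp
  show ?case using lipschitz_joined_trans[OF 1 2] by simp
qed

lemma cell_vertices_dense: "gasket a \<subseteq> closure {cell_vertex a w j | w j. True}"
proof
  fix x assume x: "x \<in> gasket a"
  show "x \<in> closure {cell_vertex a w j | w j. True}"
    unfolding closure_approachable
  proof (intro allI impI)
    fix e :: real assume "e > 0"
    have "(\<lambda>n. 4 * pi / 3 / 2 ^ n) \<longlonglongrightarrow> 0" by (intro LIMSEQ_divide_realpow_zero) auto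
    then have "\<forall>\<^sub>F n in sequentially. 4 * pi / 3 / 2 ^ n < e"
      by (rule order_tendstoD) fact
    then obtain n where n: "4 * pi / 3 / 2 ^ n < e" by (auto simp: eventually_sequentially)
    obtain w y where w: "length w = n" "y \<in> gasket a" "x = cell_map a w y" using gasket_cells[OF x] by blast
    have "dist (cell_vertex a w Apex) x \<le> 4 * pi / 3 / 2 ^ n"
      unfolding w(3) dist_cell_map w(1)
      by (intro divide_right_mono gasket_diameter[of _ a] w vertex_in_gasket) auto
    then show "\<exists>y\<in>{cell_vertex a w j |w j. True}. dist y x < e" using n
      by (intro bexI[of _ "cell_vertex a w Apex"]) (auto simp del: vertex.simps)
  qed
qed

text \<open>The curves to corners of cells are dense in their end points, so the closure lemma joins
  the lower left corner to every point; two such curves are concatenated.\<close>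

lemma lipschitz_joined_gasket:
  assumes "x \<in> gasket a" "y \<in> gasket a"
  shows "lipschitz_joined (gasket a) (4 * pi / 3) x y"
proof -
  have "lipschitz_joined (gasket a) (2 * pi / 3) (vertex a Lower_Left) x" if "x \<in> gasket a" for x
  proof (rule lipschitz_joined_closure[OF compact_gasket])
    show "x \<in> closure {cell_vertex a w j | w j. True}" using cell_vertices_dense that by blast
    show "lipschitz_joined (gasket a) (2 * pi / 3) (vertex a Lower_Left) v"
      if "v \<in> {cell_vertex a w j | w j. True}" for v
      using that lipschitz_joined_cell_vertex by blast
  qed
  from lipschitz_joined_trans[OF lipschitz_joined_commute[OF this[OF assms(1)]] this[OF assms(2)]]
  show ?thesis by simp
qed

lemma lipschitz_joined_cell:
  assumes "length w = n" "x \<in> cell_map a w ` gasket a" "y \<in> cell_map a w ` gasket a"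
  shows "lipschitz_joined (gasket a) (4 * pi / 3 / 2 ^ n) x y"
  using assms lipschitz_joined_cell_map[OF lipschitz_joined_gasket] by blast

lemma geodesic_dist_le_curve_length:
  assumes "path g" "path_image g \<subseteq> S" "pathstart g = p" "pathfinish g = q"
  shows "geodesic_dist S p q \<le> curve_length g"
proof (cases "rectifiable g")
  case True
  then show ?thesis unfolding geodesic_dist_def by (intro INF_lower) (use assms in auto)
next
  case False
  \<comment> \<open>A curve excluded from the infimum has infinite length, so the bound is
    trivial.\<close>
  then show ?thesis by (simp add: rectifiable_def not_less)
qed

lemma geodesic_dist_nonneg: "0 \<le> geodesic_dist S p q"
  unfolding geodesic_dist_def
proof (rule INF_greatest)
  show "0 \<le> curve_length g" for g :: "real \<Rightarrow> 'a"
    using curve_length_upper[where x="\<lambda>_. 0" and n=0 and g=g] by (simp add: mono_def zero_ereal_def)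
qed

text \<open>Every curve to \<open>x\<close> is prolonged to \<open>y\<close>. The finite constant is
  subtracted first, so that the bound can be checked curve by curve before the infimum is
  taken.\<close>

lemma geodesic_dist_extend:
  assumes "lipschitz_joined S C x y"
  shows "geodesic_dist S p y \<le> geodesic_dist S p x + ereal C"
proof -
  obtain h where h: "C-lipschitz_on {0..1} h" "h ` {0..1} \<subseteq> S" "h (0::real) = x" "h 1 = y"
    using assms unfolding lipschitz_joined_def by blast
  have "geodesic_dist S p y - ereal C \<le> geodesic_dist S p x"
    unfolding geodesic_dist_def[of S p x]
  proof (rule INF_greatest)
    fix g assume "g \<in> {g. path g \<and> rectifiable g \<and> path_image g \<subseteq> S \<and> pathstart g = p \<and> pathfinish g = x}"
    then have g: "path g" "path_image g \<subseteq> S" "pathstart g = p" "pathfinish g = x" by auto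
    have j: "pathfinish g = pathstart h" using h g by (simp add: pathstart_def)
    have "path h" using h(1) by (simp add: path_def lipschitz_on_continuous_on)
    then have "geodesic_dist S p y \<le> curve_length (g +++ h)"
      using g h j path_image_join[OF j]
      by (intro geodesic_dist_le_curve_length) (simp_all add: path_image_def, simp add: pathfinish_def)
    also have "\<dots> \<le> curve_length g + curve_length h" by (rule curve_length_join[OF j])
    also have "\<dots> \<le> curve_length g + ereal C" by (intro add_left_mono curve_length_lipschitz h)
    finally show "geodesic_dist S p y - ereal C \<le> curve_length g" by (simp add: ereal_minus_le)
  qed
  then show ?thesis by (simp add: ereal_minus_le)
qed

lemma geodesic_dist_self:
  assumes "p \<in> S"
  shows "geodesic_dist S p p = 0"
proof -
  have "geodesic_dist S p p \<le> curve_length (\<lambda>_::real. p)"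
    using assms by (intro geodesic_dist_le_curve_length) (auto simp: path_def path_image_def pathstart_def pathfinish_def)
  also have "\<dots> \<le> ereal 0" by (rule curve_length_lipschitz) (simp add: lipschitz_on_def)
  finally show ?thesis using geodesic_dist_nonneg[of S p p] by (simp add: zero_ereal_def antisym)
qed

text \<open>In units of the side length \<open>S\<close> each linear piece has speed
  \<open>S\<close>, and the pieces agree at the breakpoints; rescaling the parameter by
  \<open>S\<close> gives speed 1.\<close>

lemma cell_param_lipschitz:
  assumes "s \<in> {- (pi / 2 ^ length w)..pi / 2 ^ length w}" "t \<in> {- (pi / 2 ^ length w)..pi / 2 ^ length w}"
  shows "dist (cell_param a w s) (cell_param a w t) \<le> \<bar>s - t\<bar>"
proof -
  define S where "S = 2 * pi / 3 / 2 ^ length w"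
  have S: "S > 0" "pi / 2 ^ length w = 3 / 2 * S" by (auto simp: S_def)
  define A where "A = cell_map a w (vertex a Lower_Left)"
  define B where "B = cell_map a w (vertex a Lower_Right)"
  define C where "C = cell_map a w (vertex a Apex)"
  have d: "dist A B = S" "dist B C = S" "dist C A = S"
    by (simp_all add: A_def B_def C_def S_def dist_cell_map dist_vertex del: vertex.simps)
  have lp: "S-lipschitz_on X (\<lambda>u. linepath x y (u + c))" if "dist x y = S" for x y :: complex and c X
  proof (rule lipschitz_onI)
    fix s t
    have "linepath x y (s + c) - linepath x y (t + c) = (s - t) *\<^sub>R (y - x)"
      by (simp add: linepath_def algebra_simps)
    then show "dist (linepath x y (s + c)) (linepath x y (t + c)) \<le> S * dist s t"
      using that by (simp add: dist_norm norm_minus_commute)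
  qed (use S in simp)
  define g where "g = (\<lambda>u::real. if u \<le> -1 then linepath C A (u + 2) else if u \<le> 0 then linepath A B (u + 1)
         else if u \<le> 1 then linepath B C (u + 0) else linepath C A (u + -1))"
  have eq: "cell_param a w t = g (t / S)" for t
    unfolding cell_param_def Let_def A_def[symmetric] B_def[symmetric] C_def[symmetric] g_def S_def[symmetric]
    by (auto simp: linepath_def)
  have g: "S-lipschitz_on {-3/2..3/2} g"
    unfolding g_def
    by (intro lipschitz_on_concat lp d) (auto simp: linepath_def)
  have "S * (s / S) = s" "S * (t / S) = t" using S by auto
  have "s / S \<in> {-3/2..3/2}" "t / S \<in> {-3/2..3/2}"
    using assms S by (auto simp: field_simps)
  then have "dist (g (s / S)) (g (t / S)) \<le> S * dist (s / S) (t / S)"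
    by (rule lipschitz_onD[OF g])
  also have "dist (s / S) (t / S) = \<bar>s - t\<bar> / S"
    using S by (simp add: dist_real_def flip: diff_divide_distrib)
  finally show ?thesis using S by (simp add: eq)
qed

text \<open>The arc of the triangle between the two parameters is itself a curve in the
  gasket.\<close>

lemma lipschitz_joined_cell_param:
  assumes "s \<in> {- (pi / 2 ^ length w)..pi / 2 ^ length w}" "t \<in> {- (pi / 2 ^ length w)..pi / 2 ^ length w}"
  shows "lipschitz_joined (gasket a) \<bar>s - t\<bar> (cell_param a w s) (cell_param a w t)"
proof -
  let ?g = "\<lambda>u. cell_param a w (linepath s t u)"
  have in': "linepath s t u \<in> {- (pi / 2 ^ length w)..pi / 2 ^ length w}" if "u \<in> {0..1}" for u
  proof -
    have "closed_segment s t \<subseteq> {- (pi / 2 ^ length w)..pi / 2 ^ length w}"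
      using assms by (intro closed_segment_subset) auto
    then show ?thesis using linepath_in_path[OF that] by blast
  qed
  have "\<bar>s - t\<bar>-lipschitz_on {0..1} ?g"
  proof (rule lipschitz_onI)
    fix u v :: real assume "u \<in> {0..1}" "v \<in> {0..1}"
    then have "dist (?g u) (?g v) \<le> \<bar>linepath s t u - linepath s t v\<bar>" by (intro cell_param_lipschitz in')
    also have "linepath s t u - linepath s t v = (s - t) * (v - u)" by (simp add: linepath_def algebra_simps)
    finally show "dist (?g u) (?g v) \<le> \<bar>s - t\<bar> * dist u v" by (simp add: abs_mult dist_real_def abs_minus_commute)
  qed simp
  moreover have "?g ` {0..1} \<subseteq> gasket a" using in' cell_param_in_gasket by blast
  ultimately show ?thesis
    unfolding lipschitz_joined_def by (intro exI[of _ ?g]) (simp add: linepath_def)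
qed

definition geodesic_fun :: "complex \<Rightarrow> complex \<Rightarrow> complex \<Rightarrow> real" where
  "geodesic_fun a p x = real_of_ereal (geodesic_dist (gasket a) p x)"

lemma geodesic_dist_finite:
  assumes "p \<in> gasket a" "x \<in> gasket a"
  shows "geodesic_dist (gasket a) p x = ereal (geodesic_fun a p x)"
proof -
  have "geodesic_dist (gasket a) p x \<le> 0 + ereal (4 * pi / 3)"
    using geodesic_dist_extend[OF lipschitz_joined_gasket[OF assms], of p] geodesic_dist_self[OF assms(1)] by simp
  then show ?thesis
    unfolding geodesic_fun_def using geodesic_dist_nonneg[of "gasket a" p x]
    by (cases "geodesic_dist (gasket a) p x") auto
qed

lemma geodesic_fun_diff:
  assumes "p \<in> gasket a" "x \<in> gasket a" "y \<in> gasket a" "lipschitz_joined (gasket a) C x y"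
  shows "\<bar>geodesic_fun a p x - geodesic_fun a p y\<bar> \<le> C"
  using geodesic_dist_extend[OF assms(4), of p] geodesic_dist_extend[OF lipschitz_joined_commute[OF assms(4)], of p]
  by (simp add: geodesic_dist_finite assms)

text \<open>No comparison with the Euclidean distance is made: nearby points share a cell of high
  generation, and any two points of such a cell are joined by a short curve.\<close>

lemma continuous_on_geodesic_fun:
  assumes p: "p \<in> gasket a"
  shows "continuous_on (gasket a) (geodesic_fun a p)"
  unfolding continuous_on_iff
proof (intro ballI allI impI)
  fix x and e :: real assume x: "x \<in> gasket a" and "e > 0"
  have "(\<lambda>n. 4 * pi / 3 / 2 ^ n) \<longlonglongrightarrow> 0" by (intro LIMSEQ_divide_realpow_zero) auto
  then have "\<forall>\<^sub>F n in sequentially. 4 * pi / 3 / 2 ^ n < e" by (rule order_tendstoD) fact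
  then obtain n where n: "4 * pi / 3 / 2 ^ n < e" by (auto simp: eventually_sequentially)
  obtain d where d: "d > 0" "\<And>y. y \<in> gasket a \<Longrightarrow> dist x y < d \<Longrightarrow>
       \<exists>w. length w = n \<and> x \<in> cell_map a w ` gasket a \<and> y \<in> cell_map a w ` gasket a"
    using common_cell_nearby[OF x, of n] by blast
  show "\<exists>d>0. \<forall>y\<in>gasket a. dist y x < d \<longrightarrow> dist (geodesic_fun a p y) (geodesic_fun a p x) < e"
  proof (intro exI[of _ d] conjI ballI impI d(1))
    fix y assume y: "y \<in> gasket a" "dist y x < d"
    then obtain w where "length w = n" "x \<in> cell_map a w ` gasket a" "y \<in> cell_map a w ` gasket a"
      using d(2)[OF y(1)] by (auto simp: dist_commute)
    then have "\<bar>geodesic_fun a p y - geodesic_fun a p x\<bar> \<le> 4 * pi / 3 / 2 ^ n"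
      by (intro geodesic_fun_diff p x y lipschitz_joined_cell)
    then show "dist (geodesic_fun a p y) (geodesic_fun a p x) < e" using n by (simp add: dist_real_def)
  qed
qed

lemma geodesic_fun_cell_param:
  assumes "p \<in> gasket a"
    "s \<in> {- (pi / 2 ^ length w)..pi / 2 ^ length w}" "t \<in> {- (pi / 2 ^ length w)..pi / 2 ^ length w}"
  shows "\<bar>geodesic_fun a p (cell_param a w s) - geodesic_fun a p (cell_param a w t)\<bar> \<le> \<bar>s - t\<bar>"
  by (intro geodesic_fun_diff cell_param_in_gasket lipschitz_joined_cell_param assms)

subsection \<open>Fourier analysis on an arc\<close>

definition half_arc :: "nat \<Rightarrow> real" where
  "half_arc n = pi / 2 ^ n"

lemma half_arc_pos [simp]: "0 < half_arc n"
  by (simp add: half_arc_def)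

lemma half_arc_scale: "2 ^ n * half_arc n = pi"
  by (simp add: half_arc_def)

lemma space_arc_measure: "space (arc_measure n) = {- half_arc n..half_arc n}"
  by (simp add: half_arc_def)

text \<open>The normalization as a constant density reduces integrals and null sets to those of
  Lebesgue measure on the interval.\<close>

lemma arc_measure_eq:
  "arc_measure n = density (lebesgue_on {- half_arc n..half_arc n}) (\<lambda>_. ennreal (1 / (2 * half_arc n)))"
proof -
  let ?I = "{- half_arc n..half_arc n}"
  have "- half_arc n \<le> half_arc n" using half_arc_pos[of n] by linarith
  then have "emeasure (lebesgue_on ?I) ?I = ennreal (half_arc n - (- half_arc n))"
    by (subst emeasure_restrict_space) (auto simp: emeasure_lborel_Icc)
  then have e: "emeasure (lebesgue_on ?I) ?I = ennreal (2 * half_arc n)" by simp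
  have "indicator ?I x / ennreal (2 * half_arc n) = ennreal (1 / (2 * half_arc n))" if "x \<in> ?I" for x
    using that half_arc_pos[of n] by (simp add: divide_ennreal flip: ennreal_1)
  moreover have "?I \<in> sets (lebesgue_on ?I)"
    using sets.top[of "lebesgue_on ?I"] by simp
  then have "(\<lambda>x. indicator ?I x / ennreal (2 * half_arc n)) \<in> borel_measurable (lebesgue_on ?I)"
    by measurable
  ultimately show ?thesis
    unfolding arc_measure_def half_arc_def[symmetric] uniform_measure_def e
    by (intro density_cong AE_I2) auto
qed

lemma borel_measurable_arc: "borel_measurable (arc_measure n) = borel_measurable (lebesgue_on {- half_arc n..half_arc n})"
  unfolding arc_measure_eq by (rule measurable_cong_sets) auto

lemma arc_integral_lebesgue:
  fixes f :: "real \<Rightarrow> 'b::{banach, second_countable_topology}"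
  assumes "f \<in> borel_measurable (arc_measure n)"
  shows "integral\<^sup>L (arc_measure n) f = (1 / (2 * half_arc n)) *\<^sub>R integral\<^sup>L (lebesgue_on {- half_arc n..half_arc n}) f"
  using assms half_arc_pos[of n] unfolding borel_measurable_arc unfolding arc_measure_eq
  by (subst integral_density) auto

lemma AE_arc_measure: "(AE t in arc_measure n. P t) \<longleftrightarrow> (AE t in lebesgue_on {- half_arc n..half_arc n}. P t)"
  unfolding arc_measure_eq by (subst AE_density) auto

text \<open>Used to discard the end points, where means of a function with different end values need
  not converge, and the exceptional set of an approximation by continuous functions.\<close>

lemma AE_arc_negligible:
  assumes "negligible N" "\<And>t. t \<in> {- half_arc n..half_arc n} \<Longrightarrow> t \<notin> N \<Longrightarrow> P t"
  shows "AE t in arc_measure n. P t"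
proof -
  have "AE t in lebesgue. t \<notin> N"
    using assms(1) by (simp add: AE_not_in negligible_iff_null_sets)
  then show ?thesis
    unfolding AE_arc_measure by (subst AE_restrict_space_iff) (use assms(2) in auto)
qed

lemma integral_arc_const: "(\<integral>t. c \<partial>arc_measure n) = (c::'b::{banach, second_countable_topology})"
  using emeasure_arc_measure_space[of n] by (simp add: measure_def del: arc_measure_space)

lemma integrable_arc_bounded:
  fixes f :: "real \<Rightarrow> 'b::{banach, second_countable_topology}"
  assumes "f \<in> borel_measurable (arc_measure n)" "\<And>t. t \<in> {- half_arc n..half_arc n} \<Longrightarrow> norm (f t) \<le> B"
  shows "integrable (arc_measure n) f"
proof -
  interpret finite_measure "arc_measure n" by (rule finite_measure_arc_measure)
  show ?thesis
    by (rule integrable_const_bound[of _ B]) (use assms in \<open>auto simp del: arc_measure_space simp: space_arc_measure\<close>)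
qed

lemma arc_measurable_continuous:
  assumes "continuous_on {- half_arc n..half_arc n} (f :: real \<Rightarrow> complex)"
  shows "f \<in> borel_measurable (arc_measure n)"
  using assms unfolding half_arc_def by (rule continuous_measurable_arc_measure)

lemma arc_continuous:
  assumes "continuous_on {- half_arc n..half_arc n} (f :: real \<Rightarrow> complex)"
  shows "integrable (arc_measure n) f"
    "integral\<^sup>L (arc_measure n) f = (1 / (2 * half_arc n)) *\<^sub>R integral {- half_arc n..half_arc n} f"
proof -
  have m: "f \<in> borel_measurable (arc_measure n)" using assms by (rule arc_measurable_continuous)
  obtain B where B: "\<And>t. t \<in> {- half_arc n..half_arc n} \<Longrightarrow> cmod (f t) \<le> B"
    using compact_imp_bounded[OF compact_continuous_image[OF assms compact_Icc]]
    unfolding bounded_iff by blast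
  show "integrable (arc_measure n) f" by (rule integrable_arc_bounded[OF m B])
  have "integrable (lebesgue_on {- half_arc n..half_arc n}) f"
    using continuous_imp_integrable_real[OF assms] .
  then show "integral\<^sup>L (arc_measure n) f = (1 / (2 * half_arc n)) *\<^sub>R integral {- half_arc n..half_arc n} f"
    by (simp add: arc_integral_lebesgue[OF m] lebesgue_integral_eq_integral)
qed

section \<open>Characters and Fourier coefficients\<close>

definition character :: "nat \<Rightarrow> int \<Rightarrow> real \<Rightarrow> complex" where
  "character n k t = cis (2 ^ n * of_int k * t)"

lemma character_exp: "exp (\<i> * 2 ^ n * of_int k * of_real t) = character n k t"
  by (simp add: character_def cis_conv_exp algebra_simps)

lemma norm_character [simp]: "cmod (character n k t) = 1"
  by (simp add: character_def)

lemma character_0 [simp]: "character n 0 t = 1" "character n k 0 = 1"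
  by (simp_all add: character_def)

lemma character_add: "character n (j + k) t = character n j t * character n k t"
  by (simp add: character_def cis_mult algebra_simps)

lemma character_add_arg: "character n k (s + t) = character n k s * character n k t"
  by (simp add: character_def cis_mult algebra_simps)

lemma cnj_character: "cnj (character n k t) = character n (- k) t"
  by (simp add: character_def cis_cnj)

lemma character_minus: "character n k (- t) = character n (- k) t"
  by (simp add: character_def)

lemma continuous_character [continuous_intros]:
  "continuous_on S f \<Longrightarrow> continuous_on S (\<lambda>t. character n k (f t))"
  unfolding character_def by (intro continuous_intros)

lemma character_period: "character n k (t + 2 * half_arc n) = character n k t"
proof -
  have "2 ^ n * of_int k * (t + 2 * half_arc n) = 2 ^ n * of_int k * t + 2 * pi * of_int k"
    by (simp add: half_arc_def field_simps)
  then show ?thesis by (simp add: character_def flip: cis_mult)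
qed

lemma character_measurable [measurable]: "character n k \<in> borel_measurable (arc_measure m)"
  by (intro arc_measurable_continuous continuous_intros)

lemma character_has_derivative:
  "(character n k has_vector_derivative (\<i> * 2 ^ n * of_int k * character n k t)) (at t within S)"
proof -
  have "((\<lambda>t. exp (\<i> * 2 ^ n * of_int k * of_real t)) has_vector_derivative
      (\<i> * 2 ^ n * of_int k * exp (\<i> * 2 ^ n * of_int k * of_real t))) (at t within S)"
    by (rule has_vector_derivative_real_field) (auto intro!: derivative_eq_intros)
  then show ?thesis by (simp add: character_exp)
qed

text \<open>The primitive of a nonconstant character has the length of the interval as a period, so
  its increment vanishes.\<close>

lemma integral_character: "integral\<^sup>L (arc_measure n) (character n k) = (if k = 0 then 1 else 0)"
proof (cases "k = 0")
  case True
  have "character n 0 = (\<lambda>_. 1)" by auto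
  then show ?thesis using True integral_arc_const by simp
next
  case False
  let ?c = "\<i> * 2 ^ n * of_int k :: complex"
  have c: "?c \<noteq> 0" using False by simp
  have "((\<lambda>t. character n k t / ?c) has_vector_derivative (?c * character n k t) / ?c) (at t within S)" for t S
    by (intro has_vector_derivative_divide character_has_derivative)
  then have "((\<lambda>t. character n k t / ?c) has_vector_derivative (character n k t)) (at t within S)" for t S
    using c by simp
  then have "(character n k has_integral (character n k (half_arc n) / ?c - character n k (- half_arc n) / ?c))
      {- half_arc n..half_arc n}"
    using half_arc_pos[of n] by (intro fundamental_theorem_of_calculus) linarith
  moreover have "character n k (half_arc n) = character n k (- half_arc n)"
    using character_period[of n k "- half_arc n"] by simp
  ultimately have "integral {- half_arc n..half_arc n} (character n k) = 0"
    by (simp add: integral_unique)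
  then show ?thesis
    using False arc_continuous(2)[of n "character n k"] by (simp add: continuous_character continuous_on_id)
qed

definition fcoeff :: "nat \<Rightarrow> int \<Rightarrow> (real \<Rightarrow> complex) \<Rightarrow> complex" where
  "fcoeff n k u = (\<integral>t. cnj (character n k t) * u t \<partial>arc_measure n)"

lemma integrable_character_mult:
  assumes "integrable (arc_measure n) u"
  shows "integrable (arc_measure n) (\<lambda>t. character n k t * u t)"
  using assms
  by (rule Bochner_Integration.integrable_bound) (use assms in \<open>auto simp: norm_mult\<close>)

subsection \<open>The de la Vallee-Poussin kernel\<close>

text \<open>By \<open>choose_square_sum\<close> the binomial coefficients have square sum
  \<open>(2 * N) choose N\<close>, so this is a unit vector. It makes \<open>vp_poly\<close> a
  constant multiple of the \<open>N\<close>-th power of \<open>1 + e\<close>, with \<open>e\<close>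
  the first character.\<close>

definition vp_coeff :: "nat \<Rightarrow> nat \<Rightarrow> real" where
  "vp_coeff N j = real (N choose j) / sqrt (real ((2 * N) choose N))"

definition vp_poly :: "nat \<Rightarrow> nat \<Rightarrow> real \<Rightarrow> complex" where
  "vp_poly n N t = (\<Sum>j\<le>N. of_real (vp_coeff N j) * character n (int j) t)"

definition vp_kernel :: "nat \<Rightarrow> nat \<Rightarrow> real \<Rightarrow> real" where
  "vp_kernel n N t = (cmod (vp_poly n N t))\<^sup>2"

definition vp_mean :: "nat \<Rightarrow> nat \<Rightarrow> (real \<Rightarrow> complex) \<Rightarrow> real \<Rightarrow> complex" where
  "vp_mean n N u s = (\<integral>t. u t * of_real (vp_kernel n N (t - s)) \<partial>arc_measure n)"

text \<open>The double sum is not collected by the value of \<open>int j - int k\<close>, so that it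
  can be compared term by term with a matrix element in
  \<open>commutator_imp_deriv_bound\<close>.\<close>

definition vp_mean_deriv :: "nat \<Rightarrow> nat \<Rightarrow> (real \<Rightarrow> complex) \<Rightarrow> real \<Rightarrow> complex" where
  "vp_mean_deriv n N u s = (\<Sum>j\<le>N. \<Sum>k\<le>N. of_real (vp_coeff N j * vp_coeff N k) *
     fcoeff n (int j - int k) u * (\<i> * 2 ^ n * of_int (int j - int k)) * character n (int j - int k) s)"

lemma vp_kernel_nonneg [simp]: "0 \<le> vp_kernel n N t"
  by (simp add: vp_kernel_def)

lemma vp_coeff_norm: "(\<Sum>j\<le>N. (vp_coeff N j)\<^sup>2) = 1"
proof -
  have "(\<Sum>j\<le>N. (vp_coeff N j)\<^sup>2) = (\<Sum>j\<le>N. real ((N choose j)\<^sup>2) / real ((2 * N) choose N))"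
    by (simp add: vp_coeff_def power_divide)
  also have "\<dots> = real (\<Sum>j\<le>N. (N choose j)\<^sup>2) / real ((2 * N) choose N)"
    by (simp add: sum_divide_distrib)
  also have "\<dots> = 1"
    unfolding choose_square_sum by simp
  finally show ?thesis .
qed

lemma continuous_vp_kernel [continuous_intros]:
  "continuous_on S f \<Longrightarrow> continuous_on S (\<lambda>t. vp_kernel n N (f t))"
  unfolding vp_kernel_def vp_poly_def by (intro continuous_intros)

lemma vp_kernel_period: "vp_kernel n N (t + 2 * half_arc n) = vp_kernel n N t"
  by (simp add: vp_kernel_def vp_poly_def character_period)

text \<open>In the product of the polynomial with its conjugate only differences of frequencies
  occur; the expansion separates \<open>t\<close> from \<open>s\<close>.\<close>

lemma vp_kernel_expand:
  "of_real (vp_kernel n N (t - s)) = (\<Sum>j\<le>N. \<Sum>k\<le>N. of_real (vp_coeff N j * vp_coeff N k) *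
     (cnj (character n (int j - int k) t) * character n (int j - int k) s))"
proof -
  have "of_real (vp_kernel n N (t - s)) = cnj (vp_poly n N (t - s)) * vp_poly n N (t - s)"
    unfolding vp_kernel_def complex_norm_square by (rule mult.commute)
  also have "\<dots> = (\<Sum>j\<le>N. \<Sum>k\<le>N. cnj (of_real (vp_coeff N j) * character n (int j) (t - s)) *
      (of_real (vp_coeff N k) * character n (int k) (t - s)))"
    unfolding vp_poly_def cnj_sum by (rule sum_product)
  also have "\<dots> = (\<Sum>j\<le>N. \<Sum>k\<le>N. of_real (vp_coeff N j * vp_coeff N k) *
     (cnj (character n (int j - int k) t) * character n (int j - int k) s))"
  proof (intro sum.cong refl)
    fix j k
    have "cnj (character n (int j) (t - s)) * character n (int k) (t - s)
        = cnj (character n (int j - int k) t) * character n (int j - int k) s"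
      unfolding cnj_character character_add[symmetric]
      using character_add_arg[of n "- int j + int k" t "- s"] by (simp add: character_minus)
    then show "cnj (of_real (vp_coeff N j) * character n (int j) (t - s)) *
      (of_real (vp_coeff N k) * character n (int k) (t - s)) = of_real (vp_coeff N j * vp_coeff N k) *
     (cnj (character n (int j - int k) t) * character n (int j - int k) s)"
      by (simp add: mult_ac)
  qed
  finally show ?thesis .
qed

lemma vp_mean_eq:
  assumes u: "integrable (arc_measure n) u"
  shows "vp_mean n N u s = (\<Sum>j\<le>N. \<Sum>k\<le>N. of_real (vp_coeff N j * vp_coeff N k) *
     fcoeff n (int j - int k) u * character n (int j - int k) s)"
proof -
  have i: "integrable (arc_measure n) (\<lambda>t. cnj (character n m t) * u t)" for m
    unfolding cnj_character by (rule integrable_character_mult[OF u])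
  have "vp_mean n N u s = (\<integral>t. (\<Sum>j\<le>N. \<Sum>k\<le>N. (of_real (vp_coeff N j * vp_coeff N k) * character n (int j - int k) s) *
     (cnj (character n (int j - int k) t) * u t)) \<partial>arc_measure n)"
    unfolding vp_mean_def vp_kernel_expand by (simp add: sum_distrib_left mult_ac)
  also have "\<dots> = (\<Sum>j\<le>N. \<Sum>k\<le>N. (of_real (vp_coeff N j * vp_coeff N k) * character n (int j - int k) s) *
     fcoeff n (int j - int k) u)"
    unfolding fcoeff_def
    by (subst Bochner_Integration.integral_sum, intro Bochner_Integration.integrable_sum integrable_mult_right i)
      (intro sum.cong refl, subst Bochner_Integration.integral_sum, intro integrable_mult_right i,
        simp)
  finally show ?thesis by (simp add: mult_ac)
qed

lemma vp_mean_has_derivative: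
  assumes u: "integrable (arc_measure n) u"
  shows "(vp_mean n N u has_vector_derivative vp_mean_deriv n N u s) (at s within S)"
proof -
  have eq: "vp_mean n N u = (\<lambda>s. \<Sum>j\<le>N. \<Sum>k\<le>N. of_real (vp_coeff N j * vp_coeff N k) *
     fcoeff n (int j - int k) u * character n (int j - int k) s)"
    using vp_mean_eq[OF u] by blast
  show ?thesis
    unfolding eq vp_mean_deriv_def mult.assoc
    by (intro has_vector_derivative_sum has_vector_derivative_mult_right)
      (rule character_has_derivative[unfolded mult.assoc])
qed

lemma continuous_vp_mean:
  assumes "integrable (arc_measure n) u"
  shows "continuous_on S (vp_mean n N u)"
  using vp_mean_has_derivative[OF assms] has_vector_derivative_continuous
  by (metis continuous_on_eq_continuous_within)

text \<open>The integral is the mean of the constant 1, for which only the diagonal of the double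
  sum remains, and this is the squared norm of the coefficient vector.\<close>

lemma integral_vp_kernel: "(\<integral>t. vp_kernel n N (t - s) \<partial>arc_measure n) = 1"
proof -
  have one: "integrable (arc_measure n) (\<lambda>_. 1 :: complex)" by (rule integrable_arc_bounded[of _ _ 1]) auto
  have fc: "fcoeff n k (\<lambda>_. 1) = (if k = 0 then 1 else 0)" for k
    using integral_character[of n "- k"] by (simp add: fcoeff_def cnj_character)
  have "of_real (\<integral>t. vp_kernel n N (t - s) \<partial>arc_measure n) = vp_mean n N (\<lambda>_. 1) s"
    by (simp add: vp_mean_def)
  also have "\<dots> = (\<Sum>j\<le>N. \<Sum>k\<le>N. if j = k then of_real (vp_coeff N j * vp_coeff N k) else 0)"
    unfolding vp_mean_eq[OF one] fc by (intro sum.cong refl) auto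
  also have "\<dots> = of_real (\<Sum>j\<le>N. (vp_coeff N j)\<^sup>2)"
    by (simp add: power2_eq_square)
  finally show ?thesis by (simp only: vp_coeff_norm of_real_eq_iff)
qed

text \<open>By the binomial theorem the polynomial is a power of \<open>1 + cis x\<close>, whose
  squared modulus is \<open>2 + 2 * cos x\<close>.\<close>

lemma vp_kernel_eq: "vp_kernel n N t = (2 + 2 * cos (2 ^ n * t)) ^ N / real ((2 * N) choose N)"
proof -
  have c: "character n (int j) t = cis (2 ^ n * t) ^ j" for j
    unfolding character_def Complex.DeMoivre by (rule arg_cong[where f=cis]) simp
  have "vp_poly n N t = (\<Sum>j\<le>N. of_nat (N choose j) * cis (2 ^ n * t) ^ j * 1 ^ (N - j)) / of_real (sqrt (real ((2 * N) choose N)))"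
    unfolding vp_poly_def c vp_coeff_def sum_divide_distrib by (intro sum.cong) auto
  also have "\<dots> = (cis (2 ^ n * t) + 1) ^ N / of_real (sqrt (real ((2 * N) choose N)))"
    by (simp only: binomial_ring)
  finally have "vp_kernel n N t = ((cmod (cis (2 ^ n * t) + 1))\<^sup>2) ^ N / real ((2 * N) choose N)"
    unfolding vp_kernel_def by (simp add: norm_divide norm_power power_divide power_mult[symmetric] mult.commute)
  also have "(cmod (cis (2 ^ n * t) + 1))\<^sup>2 = 2 + 2 * cos (2 ^ n * t)"
    unfolding cmod_power2 using sin_cos_squared_add[of "2 ^ n * t"] by (simp add: power2_eq_square algebra_simps)
  finally show ?thesis .
qed

text \<open>\<open>central_binomial_lower_bound\<close> bounds the denominator below by
  \<open>4 ^ N / (2 * N)\<close>. Away from the peak, geometric decay therefore beats the linear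
  factor.\<close>

lemma vp_kernel_le:
  assumes N: "N > 0" and c: "cos (2 ^ n * t) \<le> c"
  shows "vp_kernel n N t \<le> 2 * real N * ((1 + c) / 2) ^ N"
proof -
  have le: "4 ^ N / (2 * real N) \<le> real ((2 * N) choose N)" by (rule central_binomial_lower_bound[OF N])
  have "vp_kernel n N t \<le> (2 + 2 * c) ^ N / (4 ^ N / (2 * real N))"
    unfolding vp_kernel_eq
  proof (rule frac_le)
    have "-1 \<le> cos (2 ^ n * t)" by simp
    then show "0 \<le> (2 + 2 * c) ^ N" using c by (intro zero_le_power) linarith
    show "(2 + 2 * cos (2 ^ n * t)) ^ N \<le> (2 + 2 * c) ^ N"
      using \<open>-1 \<le> cos (2 ^ n * t)\<close> c by (intro power_mono) linarith+
  qed (use N le in auto)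
  also have "(2 + 2 * c) ^ N = 4 ^ N * ((1 + c) / 2) ^ N"
    unfolding power_mult_distrib[symmetric] by (rule arg_cong[where f="\<lambda>x. x ^ N"]) (simp add: field_simps)
  finally show ?thesis by (simp add: field_simps)
qed

lemma integrable_vp_product:
  assumes u: "u \<in> borel_measurable (arc_measure n)" "\<And>t. t \<in> {- half_arc n..half_arc n} \<Longrightarrow> cmod (u t) \<le> B"
  shows "integrable (arc_measure n) (\<lambda>t. u t * of_real (vp_kernel n N (t - s)))"
proof -
  have k: "integrable (arc_measure n) (\<lambda>t. complex_of_real (vp_kernel n N (t - s)))"
    by (intro arc_continuous continuous_intros)
  then have [measurable]: "(\<lambda>t. complex_of_real (vp_kernel n N (t - s))) \<in> borel_measurable (arc_measure n)"
    by (rule borel_measurable_integrable)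
  have [measurable]: "u \<in> borel_measurable (arc_measure n)" by (rule u)
  have "integrable (arc_measure n) (\<lambda>t. of_real B * complex_of_real (vp_kernel n N (t - s)))"
    using k by simp
  then show ?thesis
  proof (rule Bochner_Integration.integrable_bound)
    show "AE t in arc_measure n. norm (u t * of_real (vp_kernel n N (t - s)))
        \<le> norm (of_real B * complex_of_real (vp_kernel n N (t - s)))"
    proof (rule AE_I2)
      fix t assume "t \<in> space (arc_measure n)"
      then have "cmod (u t) \<le> B" using u(2) by (simp del: arc_measure_space add: space_arc_measure)
      then show "norm (u t * of_real (vp_kernel n N (t - s))) \<le> norm (of_real B * complex_of_real (vp_kernel n N (t - s)))"
        by (simp add: norm_mult mult_right_mono)
    qed
  qed measurable
qed

lemma integrable_vp_kernel: "integrable (arc_measure n) (\<lambda>t. vp_kernel n N (t - s))"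
proof -
  have "integrable (arc_measure n) (\<lambda>t. complex_of_real (vp_kernel n N (t - s)))"
    by (intro arc_continuous continuous_intros)
  then show ?thesis using complex_of_real_integrable_eq by blast
qed

text \<open>Kernel and measure both have mass one, so the pointwise bound integrates to
  \<open>e + d\<close>. The part of an estimate near the peak goes into \<open>e\<close>, the far
  part into \<open>d\<close>.\<close>

lemma norm_vp_integral_le:
  assumes u: "u \<in> borel_measurable (arc_measure n)"
    and le: "\<And>t. t \<in> {- half_arc n..half_arc n} \<Longrightarrow> cmod (u t) * vp_kernel n N (t - s) \<le> e * vp_kernel n N (t - s) + d"
    and B: "\<And>t. t \<in> {- half_arc n..half_arc n} \<Longrightarrow> cmod (u t) \<le> B"
  shows "cmod (vp_mean n N u s) \<le> e + d"
proof -
  have c: "integrable (arc_measure n) (\<lambda>_. d)" by (rule integrable_arc_bounded[of _ _ "\<bar>d\<bar>"]) auto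
  have "cmod (vp_mean n N u s) \<le> (\<integral>t. cmod (u t * of_real (vp_kernel n N (t - s))) \<partial>arc_measure n)"
    unfolding vp_mean_def by (rule integral_norm_bound)
  also have "\<dots> \<le> (\<integral>t. e * vp_kernel n N (t - s) + d \<partial>arc_measure n)"
  proof (rule integral_mono)
    show "integrable (arc_measure n) (\<lambda>t. cmod (u t * of_real (vp_kernel n N (t - s))))"
      by (intro integrable_norm integrable_vp_product[OF u B])
    show "integrable (arc_measure n) (\<lambda>t. e * vp_kernel n N (t - s) + d)"
      by (intro Bochner_Integration.integrable_add integrable_mult_right integrable_vp_kernel c)
    fix t assume "t \<in> space (arc_measure n)"
    then show "cmod (u t * of_real (vp_kernel n N (t - s))) \<le> e * vp_kernel n N (t - s) + d"
      using le by (simp add: norm_mult space_arc_measure del: arc_measure_space)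
  qed
  also have "\<dots> = e + d"
    using c by (simp add: integrable_vp_kernel integral_vp_kernel integral_arc_const del: lebesgue_integral_const)
  finally show ?thesis .
qed

lemma norm_vp_mean_le:
  assumes "u \<in> borel_measurable (arc_measure n)"
    and "\<And>t. t \<in> {- half_arc n..half_arc n} \<Longrightarrow> cmod (u t) \<le> B"
  shows "cmod (vp_mean n N u s) \<le> B"
proof -
  have "cmod (vp_mean n N u s) \<le> B + 0"
    by (rule norm_vp_integral_le[OF assms(1) _ assms(2)]) (simp_all add: assms(2) mult_right_mono)
  then show ?thesis by simp
qed

text \<open>The point is an inner one because \<open>u\<close> may have different values at the two
  ends, and the periodic kernel at an end point would see both. Near \<open>s\<close> continuity
  controls the integrand, elsewhere the kernel is small.\<close>

lemma vp_mean_tendsto: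
  assumes u: "continuous_on {- half_arc n..half_arc n} u" and s: "s \<in> {- half_arc n<..<half_arc n}"
  shows "(\<lambda>N. vp_mean n N u s) \<longlonglongrightarrow> u s"
proof (rule LIMSEQ_I)
  fix r :: real assume r: "r > 0"
  let ?I = "{- half_arc n..half_arc n}"
  have sI: "s \<in> ?I" using s by auto
  have meas: "(\<lambda>t. u t - u s) \<in> borel_measurable (arc_measure n)" 
    by (intro arc_measurable_continuous continuous_intros u)
  obtain B where B: "\<And>t. t \<in> ?I \<Longrightarrow> cmod (u t) \<le> B"
    using compact_imp_bounded[OF compact_continuous_image[OF u compact_Icc]]
    unfolding bounded_iff by blast
  have B': "cmod (u t - u s) \<le> 2 * B" if "t \<in> ?I" for t
    using B[OF that] B[OF sI] norm_triangle_ineq4[of "u t" "u s"] by linarith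
  have B0: "B \<ge> 0" using B[OF sI] norm_ge_zero order_trans by blast
  obtain d0 where d0: "d0 > 0" "\<And>t. t \<in> ?I \<Longrightarrow> dist t s < d0 \<Longrightarrow> dist (u t) (u s) < r / 2"
    using u sI r unfolding continuous_on_iff by (meson half_gt_zero)
  \<comment> \<open>The second entry keeps \<open>t - s\<close> also away from the next peaks of the
    periodic kernel, at plus and minus \<open>2 * half_arc n\<close>.\<close>
  define d where "d = min d0 (half_arc n - \<bar>s\<bar>)"
  have d: "d > 0" "d \<le> d0" "d \<le> half_arc n - \<bar>s\<bar>" using d0(1) s by (auto simp: d_def)
  define q where "q = (1 + cos (2 ^ n * d)) / 2"
  have md: "0 < 2 ^ n * d" "2 ^ n * d \<le> pi"
    using d s by (auto simp: half_arc_scale[of n, symmetric])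
  have "cos (2 ^ n * d) < cos 0" using md by (intro cos_monotone_0_pi) auto
  then have q: "0 \<le> q" "q < 1" using cos_ge_minus_one[of "2 ^ n * d"] by (auto simp: q_def simp del: cos_ge_minus_one)
  have cos_le: "cos (2 ^ n * (t - s)) \<le> cos (2 ^ n * d)" if t: "t \<in> ?I" "d \<le> \<bar>t - s\<bar>" for t
  proof -
    define x where "x = 2 ^ n * \<bar>t - s\<bar>"
    have "\<bar>t - s\<bar> \<le> 2 * half_arc n - d" using t d by (auto simp: abs_if split: if_splits)
    then have "x \<le> 2 ^ n * (2 * half_arc n - d)" unfolding x_def by (intro mult_left_mono) auto
    then have x2: "x \<le> 2 * pi - 2 ^ n * d" using half_arc_scale[of n] by (simp add: algebra_simps)
    have x1: "2 ^ n * d \<le> x" unfolding x_def using t by (intro mult_left_mono) auto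
    have "cos (2 ^ n * (t - s)) = cos x"
      unfolding x_def using cos_abs_real[of "2 ^ n * (t - s)"] by (simp add: abs_mult)
    also have "\<dots> \<le> cos (2 ^ n * d)"
    proof (cases "x \<le> pi")
      case True
      then show ?thesis using x1 md by (intro cos_monotone_0_pi_le) auto
    next
      case False
      have "cos x = cos (2 * pi - x)" by (simp add: cos_diff)
      also have "\<dots> \<le> cos (2 ^ n * d)" using False x2 md by (intro cos_monotone_0_pi_le) auto
      finally show ?thesis .
    qed
    finally show ?thesis .
  qed
  have "(\<lambda>N. real N * q ^ N) \<longlonglongrightarrow> 0" using q by (intro powser_times_n_limit_0) auto
  \<comment> \<open>Of the factor \<open>4 * B\<close>, the part \<open>2 * B\<close> bounds the
    difference of values and the remaining 2 comes from \<open>vp_kernel_le\<close>.\<close>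
  then have "(\<lambda>N. 4 * B * (real N * q ^ N)) \<longlonglongrightarrow> 4 * B * 0" by (intro tendsto_mult_left)
  then have "\<forall>\<^sub>F N in sequentially. 4 * B * (real N * q ^ N) < r / 2"
    by (rule order_tendstoD) (use r in auto)
  then obtain N0 where N0: "\<And>N. N \<ge> N0 \<Longrightarrow> 4 * B * (real N * q ^ N) < r / 2"
    unfolding eventually_sequentially by blast
  show "\<exists>no. \<forall>N\<ge>no. cmod (vp_mean n N u s - u s) < r"
  proof (intro exI[of _ "Suc N0"] allI impI)
    fix N assume N: "Suc N0 \<le> N"
    let ?K = "\<lambda>t. vp_kernel n N (t - s)"
    have "vp_mean n N u s - u s = vp_mean n N u s - u s * of_real (\<integral>t. ?K t \<partial>arc_measure n)"
      by (simp add: integral_vp_kernel)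
    also have "\<dots> = (\<integral>t. u t * of_real (?K t) - u s * of_real (?K t) \<partial>arc_measure n)"
      unfolding vp_mean_def using integrable_vp_kernel[of n N s]
      by (subst Bochner_Integration.integral_diff)
        (auto intro!: integrable_vp_product[OF arc_measurable_continuous[OF u] B])
    also have "\<dots> = vp_mean n N (\<lambda>t. u t - u s) s"
      unfolding vp_mean_def by (simp add: algebra_simps)
    finally have "cmod (vp_mean n N u s - u s) = cmod (vp_mean n N (\<lambda>t. u t - u s) s)" by simp
    also have "\<dots> \<le> r / 2 + 4 * B * (real N * q ^ N)"
    proof (rule norm_vp_integral_le[OF meas _ B'])
      fix t assume t: "t \<in> ?I"
      show "cmod (u t - u s) * ?K t \<le> r / 2 * ?K t + 4 * B * (real N * q ^ N)"
      proof (cases "d \<le> \<bar>t - s\<bar>")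
        case True
        have "?K t \<le> 2 * real N * q ^ N"
          unfolding q_def using N by (intro vp_kernel_le cos_le t True) auto
        then have "cmod (u t - u s) * ?K t \<le> (2 * B) * (2 * real N * q ^ N)"
          using B'[OF t] B0 by (intro mult_mono) auto
        moreover have "0 \<le> r / 2 * ?K t" using r by simp
        ultimately show ?thesis by (simp add: algebra_simps)
      next
        case False
        then have "cmod (u t - u s) \<le> r / 2" using d0(2)[OF t] d by (simp add: dist_norm less_imp_le)
        then have "cmod (u t - u s) * ?K t \<le> r / 2 * ?K t" by (intro mult_right_mono) auto
        moreover have "0 \<le> 4 * B * (real N * q ^ N)" using B0 q by simp
        ultimately show ?thesis by linarith
      qed
    qed
    also have "\<dots> < r" using N0[of N] N by simp
    finally show "cmod (vp_mean n N u s - u s) < r" .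
  qed
qed

text \<open>Translation invariance for a function known on one period only: the shift of the
  periodic \<open>k\<close> is moved to \<open>u\<close>, whose overhang reappears at the other end.
  Cutting at \<open>- l + d\<close> reduces this to translations of two intervals.\<close>

lemma integral_rotate:
  fixes u k :: "real \<Rightarrow> complex"
  assumes u: "continuous_on {-l..l} u" and ends: "u l = u (-l)" and k: "continuous_on UNIV k"
    and per: "\<And>t. k (t + 2 * l) = k t" and d: "0 \<le> d" "d \<le> 2 * l"
  shows "integral {-l..l} (\<lambda>t. u t * k (t - d))
    = integral {-l..l} (\<lambda>t. (if t \<le> l - d then u (t + d) else u (t + d - 2 * l)) * k t)"
    and "continuous_on {-l..l} (\<lambda>t. if t \<le> l - d then u (t + d) else u (t + d - 2 * l))"
proof -
  let ?F = "\<lambda>t. u t * k (t - d)"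
  let ?v = "\<lambda>t. if t \<le> l - d then u (t + d) else u (t + d - 2 * l)"
  let ?G = "\<lambda>t. ?v t * k t"
  have "continuous_on ({-l..l - d} \<union> {l - d..l}) ?v"
    by (rule continuous_on_cases) (use d ends in \<open>auto intro!: continuous_intros continuous_on_compose2[OF u]\<close>)
  moreover have "{-l..l - d} \<union> {l - d..l} = {-l..l}" using d by auto
  ultimately show v: "continuous_on {-l..l} ?v" by simp
  have k': "continuous_on S k" for S using k continuous_on_subset by blast
  have F: "continuous_on {-l..l} ?F"
    by (intro continuous_intros u continuous_on_compose2[OF k]) auto
  have G: "continuous_on {-l..l} ?G" by (intro continuous_on_mult v k')
  have "integral {-l..l} ?F = integral {-l..-l + d} ?F + integral {-l + d..l} ?F"
    using d by (intro Henstock_Kurzweil_Integration.integral_combine[symmetric] integrable_continuous_real F) auto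
  also have "integral {-l + d..l} ?F = integral {-l..l - d} ?G"
  proof -
    have "integral {-l + d..l} ?F = integral {-l..l - d} (\<lambda>t. ?F (t + d))"
      using integral_shift_real_ivl[of "-l + d" d l ?F] by simp
    also have "\<dots> = integral {-l..l - d} ?G"
      by (rule Henstock_Kurzweil_Integration.integral_cong) auto
    finally show ?thesis .
  qed
  also have "integral {-l..-l + d} ?F = integral {l - d..l} ?G"
  proof -
    have "integral {-l..-l + d} ?F = integral {l - d..l} (\<lambda>t. ?F (t + (d - 2 * l)))"
      using integral_shift_real_ivl[of "-l" "d - 2 * l" "- l + d" ?F] by (simp add: algebra_simps)
    also have "\<dots> = integral {l - d..l} ?G"
    proof (rule Henstock_Kurzweil_Integration.integral_cong)
      fix t assume t: "t \<in> {l - d..l}"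
      have "?v t = u (t + (d - 2 * l))" using t ends by (cases "t = l - d") (auto simp: algebra_simps)
      moreover have "k (t + (d - 2 * l) - d) = k t" using per[of "t - 2 * l"] by (simp add: algebra_simps)
      ultimately show "?F (t + (d - 2 * l)) = ?G t" by simp
    qed
    finally show ?thesis .
  qed
  also have "integral {l - d..l} ?G + integral {-l..l - d} ?G = integral {-l..l} ?G"
    using d Henstock_Kurzweil_Integration.integral_combine[of "-l" "l - d" l ?G] integrable_continuous_real[OF G]
    by (simp add: add.commute)
  finally show "integral {-l..l} ?F = integral {-l..l} ?G" .
qed

text \<open>A translate of the mean is the mean of the rotated function, which differs from
  \<open>u\<close> by at most \<open>d\<close> everywhere: where the rotation wraps around, the way
  across the seam still has length \<open>d\<close>.\<close>

lemma vp_mean_lipschitz: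
  assumes lip: "\<And>s t. s \<in> {- half_arc n..half_arc n} \<Longrightarrow> t \<in> {- half_arc n..half_arc n} \<Longrightarrow> cmod (u s - u t) \<le> \<bar>s - t\<bar>"
    and ends: "u (half_arc n) = u (- half_arc n)"
    and d: "0 \<le> d" "d \<le> 2 * half_arc n"
  shows "cmod (vp_mean n N u (s + d) - vp_mean n N u s) \<le> d"
proof -
  let ?l = "half_arc n"
  have "1-lipschitz_on {- ?l..?l} u"
    by (rule lipschitz_onI) (use lip in \<open>auto simp: dist_norm\<close>)
  then have u: "continuous_on {- ?l..?l} u" by (rule lipschitz_on_continuous_on)
  let ?v = "\<lambda>t. if t \<le> ?l - d then u (t + d) else u (t + d - 2 * ?l)"
  define k where "k t = complex_of_real (vp_kernel n N (t - s))" for t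
  have k: "continuous_on S k" for S unfolding k_def by (intro continuous_intros)
  have per: "k (t + 2 * ?l) = k t" for t
    using vp_kernel_period[of n N "t - s"] by (simp add: k_def algebra_simps)
  note rot = integral_rotate[OF u ends k per d]
  have "vp_mean n N u (s + d) = (1 / (2 * ?l)) *\<^sub>R integral {- ?l..?l} (\<lambda>t. u t * k (t - d))"
  proof -
    have "k (t - d) = complex_of_real (vp_kernel n N (t - (s + d)))" for t
      unfolding k_def by (simp add: algebra_simps)
    then show ?thesis
      unfolding vp_mean_def using u k
      by (subst arc_continuous(2)) (auto intro!: continuous_intros)
  qed
  also have "\<dots> = vp_mean n N ?v s"
    unfolding rot(1) vp_mean_def k_def[symmetric]
    by (rule arc_continuous(2)[symmetric]) (intro continuous_on_mult rot(2) k)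
  finally have "vp_mean n N u (s + d) - vp_mean n N u s = vp_mean n N ?v s - vp_mean n N u s" by simp
  also have "\<dots> = vp_mean n N (\<lambda>t. ?v t - u t) s"
    unfolding vp_mean_def k_def[symmetric] left_diff_distrib
    by (rule Bochner_Integration.integral_diff[symmetric]; intro arc_continuous(1) continuous_on_mult rot(2) u k)
  also have "cmod \<dots> \<le> d"
  proof (rule norm_vp_mean_le)
    show "(\<lambda>t. ?v t - u t) \<in> borel_measurable (arc_measure n)"
      by (intro arc_measurable_continuous continuous_on_diff rot(2) u)
    fix t assume t: "t \<in> {- ?l..?l}"
    show "cmod (?v t - u t) \<le> d"
    proof (cases "t \<le> ?l - d")
      case True
      then show ?thesis using lip[of "t + d" t] t d by auto
    next
      case False
      let ?t = "t + d - 2 * ?l"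
      have t': "?t \<in> {- ?l..?l}" using False t d by auto
      have l: "?l \<in> {- ?l..?l}" "- ?l \<in> {- ?l..?l}" using half_arc_pos[of n] by (auto simp del: half_arc_pos)
      have "?v t - u t = (u ?t - u (- ?l)) + (u ?l - u t)" using False ends by simp
      also have "cmod \<dots> \<le> \<bar>?t - (- ?l)\<bar> + \<bar>?l - t\<bar>"
        by (rule order_trans[OF norm_triangle_ineq add_mono]) (intro lip l t t')+
      also have "\<dots> = d" using False t by auto
      finally show ?thesis .
    qed
  qed
  finally show ?thesis .
qed

text \<open>Difference quotients with small positive step are bounded by 1, and they approximate the
  derivative.\<close>

lemma norm_vp_mean_deriv_le:
  assumes lip: "\<And>s t. s \<in> {- half_arc n..half_arc n} \<Longrightarrow> t \<in> {- half_arc n..half_arc n} \<Longrightarrow> cmod (u s - u t) \<le> \<bar>s - t\<bar>"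
    and ends: "u (half_arc n) = u (- half_arc n)"
  shows "cmod (vp_mean_deriv n N u s) \<le> 1"
proof -
  have "1-lipschitz_on {- half_arc n..half_arc n} u"
    by (rule lipschitz_onI) (use lip in \<open>auto simp: dist_norm\<close>)
  then have u: "integrable (arc_measure n) u" by (intro arc_continuous lipschitz_on_continuous_on)
  let ?D = "vp_mean_deriv n N u s"
  show ?thesis
  proof (rule field_le_epsilon)
    fix e :: real assume e: "e > 0"
    have "(vp_mean n N u has_derivative (\<lambda>x. x *\<^sub>R ?D)) (at s within UNIV)"
      using vp_mean_has_derivative[OF u] unfolding has_vector_derivative_def .
    then obtain d where d: "d > 0" "\<And>y. norm (y - s) < d \<Longrightarrow>
        norm (vp_mean n N u y - vp_mean n N u s - (y - s) *\<^sub>R ?D) \<le> e * norm (y - s)"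
      unfolding has_derivative_within_alt using e by blast
    define h where "h = min (d / 2) (half_arc n)"
    have h: "0 < h" "h < d" "h \<le> half_arc n" using d(1) half_arc_pos[of n] by (auto simp: h_def min_def)
    have "cmod (h *\<^sub>R ?D) \<le> cmod (vp_mean n N u (s + h) - vp_mean n N u s)
        + cmod (vp_mean n N u (s + h) - vp_mean n N u s - h *\<^sub>R ?D)"
      using norm_triangle_ineq4[of "vp_mean n N u (s + h) - vp_mean n N u s"
          "vp_mean n N u (s + h) - vp_mean n N u s - h *\<^sub>R ?D"] by simp
    also have "\<dots> \<le> h + e * h"
      using d(2)[of "s + h"] h half_arc_pos[of n]
      by (intro add_mono vp_mean_lipschitz lip ends) (auto simp del: half_arc_pos)
    finally have "h * cmod ?D \<le> h * (1 + e)" using h by (simp add: algebra_simps)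
    then show "cmod ?D \<le> 1 + e" using h by simp
  qed
qed

text \<open>Completeness of the characters. Orthogonality passes from trigonometric polynomials to
  continuous \<open>u\<close> through the uniformly bounded means, and then to the conjugate phase
  of \<open>x\<close>, which turns the integrand into \<open>cmod (x t)\<close>.\<close>

lemma fcoeff_eq_0_imp:
  assumes x: "integrable (arc_measure n) x" and 0: "\<And>k. fcoeff n k x = 0"
  shows "AE t in arc_measure n. x t = 0"
proof -
  let ?I = "{- half_arc n..half_arc n}"
  have [measurable]: "x \<in> borel_measurable (arc_measure n)" using x by simp
  have cont0: "(\<integral>t. u t * x t \<partial>arc_measure n) = 0" if u: "continuous_on ?I u" for u
  proof -
    obtain B where B: "\<And>t. t \<in> ?I \<Longrightarrow> cmod (u t) \<le> B"
      using compact_imp_bounded[OF compact_continuous_image[OF u compact_Icc]]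
      unfolding bounded_iff by blast
    have ui: "integrable (arc_measure n) u" by (rule arc_continuous[OF u])
    have [measurable]: "u \<in> borel_measurable (arc_measure n)" by (rule arc_measurable_continuous[OF u])
    have mm: "vp_mean n N u \<in> borel_measurable (arc_measure n)" for N
      by (intro arc_measurable_continuous continuous_vp_mean ui)
    have "(\<lambda>N. \<integral>t. vp_mean n N u t * x t \<partial>arc_measure n) \<longlonglongrightarrow> (\<integral>t. u t * x t \<partial>arc_measure n)"
    proof (rule integral_dominated_convergence)
      show "integrable (arc_measure n) (\<lambda>t. B * cmod (x t))" using x by simp
      show "(\<lambda>t. vp_mean n N u t * x t) \<in> borel_measurable (arc_measure n)" for N using mm by measurable
      show "AE t in arc_measure n. (\<lambda>N. vp_mean n N u t * x t) \<longlonglongrightarrow> u t * x t"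
      proof (rule AE_arc_negligible)
        show "negligible {- half_arc n, half_arc n}" by simp
        fix t assume "t \<in> ?I" "t \<notin> {- half_arc n, half_arc n}"
        then show "(\<lambda>N. vp_mean n N u t * x t) \<longlonglongrightarrow> u t * x t"
          by (intro tendsto_mult tendsto_const vp_mean_tendsto[OF u]) auto
      qed
      show "AE t in arc_measure n. norm (vp_mean n N u t * x t) \<le> B * cmod (x t)" for N
        using norm_vp_mean_le[of u n B N] B by (auto simp: norm_mult intro!: mult_right_mono)
    qed measurable
    moreover have "(\<integral>t. vp_mean n N u t * x t \<partial>arc_measure n) = 0" for N
    proof -
      have 1: "(\<integral>t. character n m t * x t \<partial>arc_measure n) = 0" for m
        using 0[of "- m"] by (simp add: fcoeff_def cnj_character)
      have i: "integrable (arc_measure n) (\<lambda>t. c * (character n m t * x t))" for m c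
        by (intro integrable_mult_right integrable_character_mult[OF x])
      have "(\<integral>t. vp_mean n N u t * x t \<partial>arc_measure n)
        = (\<integral>t. (\<Sum>j\<le>N. \<Sum>k\<le>N. (of_real (vp_coeff N j * vp_coeff N k) * fcoeff n (int j - int k) u) *
           (character n (int j - int k) t * x t)) \<partial>arc_measure n)"
        unfolding vp_mean_eq[OF ui] by (simp add: sum_distrib_left sum_distrib_right mult_ac)
      also have "\<dots> = (\<Sum>j\<le>N. \<integral>t. (\<Sum>k\<le>N. (of_real (vp_coeff N j * vp_coeff N k) * fcoeff n (int j - int k) u) *
           (character n (int j - int k) t * x t)) \<partial>arc_measure n)"
        by (intro Bochner_Integration.integral_sum Bochner_Integration.integrable_sum i)
      also have "\<dots> = 0"
        by (intro sum.neutral ballI, subst Bochner_Integration.integral_sum)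
          (auto intro!: i sum.neutral simp: 1)
      finally show ?thesis .
    qed
    ultimately show ?thesis by (simp add: LIMSEQ_const_iff)
  qed
  define s where "s t = cnj (sgn (x t))" for t
  have sx: "s t * x t = of_real (cmod (x t))" for t
    unfolding s_def by (rule cnj_sgn_mult)
  have ns: "cmod (s t) \<le> 1" for t by (simp add: s_def norm_sgn)
  have sm[measurable]: "s \<in> borel_measurable (arc_measure n)"
    unfolding s_def sgn_eq by measurable
  then have "s measurable_on ?I"
    unfolding borel_measurable_arc by (subst measurable_on_iff_borel_measurable) auto
  then obtain Z g where Z: "negligible Z" and g: "\<And>k. continuous_on UNIV (g k)"
    "\<And>t. t \<notin> Z \<Longrightarrow> (\<lambda>k. g k t) \<longlonglongrightarrow> (if t \<in> ?I then s t else 0)"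
    unfolding measurable_on_def by blast
  \<comment> \<open>Radial truncation to the unit disc permits dominated convergence and keeps the
    limit, because \<open>cmod (s t) \<le> 1\<close>.\<close>
  define h where "h k t = g k t / of_real (max 1 (cmod (g k t)))" for k :: nat and t
  have h: "continuous_on ?I (h k)" for k
    unfolding h_def by (intro continuous_intros continuous_on_max continuous_on_subset[OF g(1)]) (auto simp: max_def)
  have h1: "cmod (h k t) \<le> 1" for k t
    by (simp add: h_def norm_divide)
  have [measurable]: "h k \<in> borel_measurable (arc_measure n)" for k by (rule arc_measurable_continuous[OF h])
  have hlim: "(\<lambda>k. h k t) \<longlonglongrightarrow> s t" if "t \<in> ?I" "t \<notin> Z" for t
  proof -
    have "(\<lambda>k. g k t) \<longlonglongrightarrow> s t" using g(2)[OF that(2)] that(1) by simp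
    then have "(\<lambda>k. h k t) \<longlonglongrightarrow> s t / of_real (max 1 (cmod (s t)))"
      unfolding h_def by (intro tendsto_intros tendsto_max) auto
    then show ?thesis using ns[of t] by (simp add: max_absorb1)
  qed
  have "(\<lambda>k. \<integral>t. h k t * x t \<partial>arc_measure n) \<longlonglongrightarrow> (\<integral>t. s t * x t \<partial>arc_measure n)"
  proof (rule integral_dominated_convergence)
    show "integrable (arc_measure n) (\<lambda>t. cmod (x t))" using x by simp
    show "AE t in arc_measure n. (\<lambda>k. h k t * x t) \<longlonglongrightarrow> s t * x t"
      by (rule AE_arc_negligible[OF Z]) (intro tendsto_mult tendsto_const hlim)
    show "AE t in arc_measure n. norm (h k t * x t) \<le> cmod (x t)" for k
      using h1 by (auto simp: norm_mult intro!: mult_left_le_one_le)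
  qed measurable
  then have "(\<integral>t. s t * x t \<partial>arc_measure n) = 0"
    by (simp add: cont0[OF h] LIMSEQ_const_iff)
  then have "(\<integral>t. cmod (x t) \<partial>arc_measure n) = 0"
    by (simp add: sx)
  then have "AE t in arc_measure n. cmod (x t) = 0"
    by (subst (asm) integral_nonneg_eq_0_iff_AE) (use x in auto)
  then show ?thesis by simp
qed

subsection \<open>Completeness of the Hilbert space\<close>

lemma square_integrable_diff:
  assumes "square_integrable M f" "square_integrable M g"
  shows "square_integrable M (\<lambda>t. f t - g t)"
  using square_integrable_add[OF assms(1) square_integrable_cmult[OF assms(2), of "-1"]] by simp

lemma square_integrable_integrable:
  assumes "finite_measure M" "square_integrable M f"
  shows "integrable M f"
proof -
  interpret finite_measure M by fact
  have "integrable M (\<lambda>t. 1 + (cmod (f t))\<^sup>2)" using assms(2) by (simp add: square_integrable_def)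
  then show ?thesis
  proof (rule Bochner_Integration.integrable_bound)
    have "cmod z \<le> 1 + (cmod z)\<^sup>2" for z
    proof -
      have "2 * cmod z \<le> 1 + (cmod z)\<^sup>2"
        using zero_le_power2[of "cmod z - 1"] by (simp add: power2_eq_square algebra_simps)
      then show ?thesis using norm_ge_zero[of z] by linarith
    qed
    then show "AE t in M. norm (f t) \<le> norm (1 + (cmod (f t))\<^sup>2)" by (intro AE_I2) simp
  qed (use assms(2) in \<open>simp add: square_integrable_def\<close>)
qed

text \<open>The classical Riesz-Fischer argument: a fast subsequence converges almost everywhere,
  and Fatou's lemma bounds the distance to its limit.\<close>

lemma L2_complete:
  fixes f :: "nat \<Rightarrow> 'a \<Rightarrow> complex"
  assumes fin: "finite_measure M" and sq: "\<And>n. square_integrable M (f n)"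
    and Cauchy: "\<And>e. e > 0 \<Longrightarrow> \<exists>K. \<forall>m\<ge>K. \<forall>n\<ge>K. (\<integral>t. (cmod (f m t - f n t))\<^sup>2 \<partial>M) < e"
  shows "\<exists>g. square_integrable M g \<and> (\<lambda>n. \<integral>t. (cmod (f n t - g t))\<^sup>2 \<partial>M) \<longlonglongrightarrow> 0"
proof -
  interpret finite_measure M by fact
  have [measurable]: "f n \<in> borel_measurable M" for n using sq by (simp add: square_integrable_def)
  have sqd: "integrable M (\<lambda>t. (cmod (f m t - f n t))\<^sup>2)" for m n
    using square_integrable_diff[OF sq sq] by (simp add: square_integrable_def)
  have "\<forall>k. \<exists>K. \<forall>m\<ge>K. \<forall>n\<ge>K. (\<integral>t. (cmod (f m t - f n t))\<^sup>2 \<partial>M) < (1/4)^k"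
    \<comment> \<open>With the rate \<open>(1/4)^k\<close>, the weight \<open>2^k\<close> in the
      bound for \<open>D\<close> below still leaves a summable sequence.\<close>
    using Cauchy by simp
  then obtain K where K: "\<And>k m n. m \<ge> K k \<Longrightarrow> n \<ge> K k \<Longrightarrow> (\<integral>t. (cmod (f m t - f n t))\<^sup>2 \<partial>M) < (1/4)^k"
    by metis
  \<comment> \<open>The sum over all \<open>K i\<close> with \<open>i \<le> k\<close> makes
    \<open>r\<close> monotone and at least \<open>K k\<close>; the summand \<open>k\<close> makes it
    unbounded.\<close>
  define r where "r k = (\<Sum>i\<le>k. K i) + k" for k
  have rK: "K k \<le> r k" for k unfolding r_def by (rule trans_le_add1, rule member_le_sum) auto
  have rmono: "r k \<le> r (Suc k)" for k by (simp add: r_def)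
  have rk: "k \<le> r k" for k by (simp add: r_def)
  define D where "D k t = cmod (f (r (Suc k)) t - f (r k) t)" for k t
  have [measurable]: "D k \<in> borel_measurable M" for k unfolding D_def by measurable
  \<comment> \<open>From the square of \<open>2^k * D k t - 1\<close> being nonnegative; this bounds
    the integral of \<open>D\<close> by that of its square without the Cauchy-Schwarz
    inequality.\<close>
  have Dle: "D k t \<le> (1/2)^k + 2^k * (D k t)\<^sup>2" for k t
  proof -
    have "0 \<le> (2^k * D k t - 1)\<^sup>2 * (1/2)^k" by simp
    also have "\<dots> = 2^k * (D k t)\<^sup>2 - 2 * D k t + (1/2)^k"
      by (simp add: power2_eq_square algebra_simps power_divide)
    finally show ?thesis using norm_ge_zero[of "f (r (Suc k)) t - f (r k) t"] unfolding D_def[symmetric] by linarith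
  qed
  have Dint: "integrable M (\<lambda>t. (1/2)^k + 2^k * (D k t)\<^sup>2)" for k
    unfolding D_def using sqd by simp
  define C where "C = measure M (space M) + 1"
  have DC: "(\<integral>t. (1/2)^k + 2^k * (D k t)\<^sup>2 \<partial>M) \<le> C * (1/2)^k" for k
  proof -
    have "(\<integral>t. (1/2)^k + 2^k * (D k t)\<^sup>2 \<partial>M) = measure M (space M) * (1/2)^k + 2^k * (\<integral>t. (D k t)\<^sup>2 \<partial>M)"
      unfolding D_def using sqd by simp
    also have "(\<integral>t. (D k t)\<^sup>2 \<partial>M) \<le> (1/4)^k"
      unfolding D_def using rK[of k] rmono[of k] by (intro less_imp_le[OF K]) linarith+
    also have "2^k * (1/4)^k = (1/2 :: real)^k"
      by (simp flip: power_mult_distrib)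
    finally show ?thesis by (simp add: C_def algebra_simps)
  qed
  have "(\<integral>\<^sup>+t. (\<Sum>k. ennreal (D k t)) \<partial>M) = (\<Sum>k. \<integral>\<^sup>+t. ennreal (D k t) \<partial>M)"
    by (rule nn_integral_suminf) measurable
  also have "\<dots> \<le> (\<Sum>k. ennreal (C * (1/2)^k))"
  proof (intro suminf_le summableI)
    fix k
    have "(\<integral>\<^sup>+t. ennreal (D k t) \<partial>M) \<le> (\<integral>\<^sup>+t. ennreal ((1/2)^k + 2^k * (D k t)\<^sup>2) \<partial>M)"
      using Dle by (intro nn_integral_mono ennreal_leI) auto
    also have "\<dots> = ennreal (\<integral>t. (1/2)^k + 2^k * (D k t)\<^sup>2 \<partial>M)"
      by (rule nn_integral_eq_integral[OF Dint]) auto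
    also have "\<dots> \<le> ennreal (C * (1/2)^k)" by (intro ennreal_leI DC)
    finally show "(\<integral>\<^sup>+t. ennreal (D k t) \<partial>M) \<le> ennreal (C * (1/2)^k)" .
  qed
  also have "\<dots> = ennreal (\<Sum>k. C * (1/2)^k)"
    by (intro suminf_ennreal2) (auto simp: C_def)
  also have "\<dots> < \<infinity>" by simp
  finally have "AE t in M. (\<Sum>k. ennreal (D k t)) \<noteq> \<infinity>"
    by (intro nn_integral_PInf_AE) auto
  then have conv: "AE t in M. convergent (\<lambda>k. f (r k) t)"
  proof eventually_elim
    case (elim t)
    then have "summable (\<lambda>k. D k t)" by (intro summable_suminf_not_top) (auto simp: D_def)
    then have "summable (\<lambda>k. f (r (Suc k)) t - f (r k) t)"
      unfolding D_def by (rule summable_norm_cancel)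
    then have "convergent (\<lambda>n. \<Sum>k<n. f (r (Suc k)) t - f (r k) t)"
      by (simp add: summable_iff_convergent)
    then have "convergent (\<lambda>n. (f (r n) t - f (r 0) t) + f (r 0) t)"
      unfolding sum_lessThan_telescope[of "\<lambda>k. f (r k) t"] by (intro convergent_add convergent_const)
    then show ?case by simp
  qed
  define g where "g t = lim (\<lambda>k. f (r k) t)" for t
  have [measurable]: "g \<in> borel_measurable M"
    unfolding g_def by (rule borel_measurable_lim_metric) measurable
  have glim: "AE t in M. (\<lambda>k. f (r k) t) \<longlonglongrightarrow> g t"
    using conv by eventually_elim (simp add: g_def convergent_LIMSEQ_iff)
  \<comment> \<open>Fatou's lemma, stated for nonnegative integrals since integrability of the
    left-hand side is only concluded from it.\<close>
  have bound: "(\<integral>\<^sup>+t. ennreal ((cmod (f n t - g t))\<^sup>2) \<partial>M) \<le> ennreal e"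
    if n: "\<And>m. m \<ge> n \<Longrightarrow> (\<integral>t. (cmod (f n t - f m t))\<^sup>2 \<partial>M) \<le> e" for n e
  proof -
    have "(\<integral>\<^sup>+t. ennreal ((cmod (f n t - g t))\<^sup>2) \<partial>M) = (\<integral>\<^sup>+t. liminf (\<lambda>k. ennreal ((cmod (f n t - f (r k) t))\<^sup>2)) \<partial>M)"
    proof (rule nn_integral_cong_AE)
      show "AE t in M. ennreal ((cmod (f n t - g t))\<^sup>2) = liminf (\<lambda>k. ennreal ((cmod (f n t - f (r k) t))\<^sup>2))"
        using glim
      proof eventually_elim
        case (elim t)
        have "(\<lambda>k. ennreal ((cmod (f n t - f (r k) t))\<^sup>2)) \<longlonglongrightarrow> ennreal ((cmod (f n t - g t))\<^sup>2)"
          by (intro tendsto_ennrealI tendsto_power tendsto_norm tendsto_diff tendsto_const elim)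
        then show ?case by (rule lim_imp_Liminf[OF trivial_limit_sequentially, symmetric])
      qed
    qed
    also have "\<dots> \<le> liminf (\<lambda>k. \<integral>\<^sup>+t. ennreal ((cmod (f n t - f (r k) t))\<^sup>2) \<partial>M)"
      by (rule nn_integral_liminf) measurable
    also have "\<dots> \<le> ennreal e"
    proof (rule order_trans[OF Liminf_le_Limsup[OF trivial_limit_sequentially] Limsup_bounded])
      show "\<forall>\<^sub>F k in sequentially. (\<integral>\<^sup>+t. ennreal ((cmod (f n t - f (r k) t))\<^sup>2) \<partial>M) \<le> ennreal e"
        unfolding eventually_sequentially
      proof (intro exI[of _ n] allI impI)
        fix k assume "n \<le> k"
        then have "n \<le> r k" using rk[of k] by simp
        have "(\<integral>\<^sup>+t. ennreal ((cmod (f n t - f (r k) t))\<^sup>2) \<partial>M) = ennreal (\<integral>t. (cmod (f n t - f (r k) t))\<^sup>2 \<partial>M)"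
          by (rule nn_integral_eq_integral[OF sqd]) auto
        also have "\<dots> \<le> ennreal e" using n[OF \<open>n \<le> r k\<close>] by (rule ennreal_leI)
        finally show "(\<integral>\<^sup>+t. ennreal ((cmod (f n t - f (r k) t))\<^sup>2) \<partial>M) \<le> ennreal e" .
      qed
    qed
    finally show ?thesis .
  qed
  have sqg: "integrable M (\<lambda>t. (cmod (f n t - g t))\<^sup>2)" "e \<ge> 0 \<Longrightarrow> (\<integral>t. (cmod (f n t - g t))\<^sup>2 \<partial>M) \<le> e"
    if "\<And>m. m \<ge> n \<Longrightarrow> (\<integral>t. (cmod (f n t - f m t))\<^sup>2 \<partial>M) \<le> e" for n e
  proof -
    have "(\<integral>\<^sup>+t. ennreal (norm ((cmod (f n t - g t))\<^sup>2)) \<partial>M) < \<infinity>"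
      using bound[OF that] by (simp add: le_less_trans)
    then show i: "integrable M (\<lambda>t. (cmod (f n t - g t))\<^sup>2)" by (intro integrableI_bounded) measurable
    have "ennreal (\<integral>t. (cmod (f n t - g t))\<^sup>2 \<partial>M) \<le> ennreal e"
      using bound[OF that] unfolding nn_integral_eq_integral[OF i AE_I2[OF zero_le_power2]] .
    then show "(\<integral>t. (cmod (f n t - g t))\<^sup>2 \<partial>M) \<le> e" if "e \<ge> 0" using that by (simp add: ennreal_le_iff)
  qed
  have "(\<integral>t. (cmod (f (K 0) t - f m t))\<^sup>2 \<partial>M) \<le> (1/4)^0" if "m \<ge> K 0" for m
    using K[of 0 "K 0" m] that by auto
  then have "square_integrable M (\<lambda>t. f (K 0) t - g t)"
    using sqg(1)[of "K 0" "(1/4)^0"] by (simp add: square_integrable_def)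
  then have "square_integrable M (\<lambda>t. f (K 0) t - (f (K 0) t - g t))" by (rule square_integrable_diff[OF sq])
  then have "square_integrable M g" by simp
  moreover have "(\<lambda>n. \<integral>t. (cmod (f n t - g t))\<^sup>2 \<partial>M) \<longlonglongrightarrow> 0"
  proof (rule LIMSEQ_I)
    fix e :: real assume e: "e > 0"
    then obtain L where L: "\<And>m n. m \<ge> L \<Longrightarrow> n \<ge> L \<Longrightarrow> (\<integral>t. (cmod (f m t - f n t))\<^sup>2 \<partial>M) < e / 2"
      using Cauchy[of "e / 2"] by auto
    have "(\<integral>t. (cmod (f n t - g t))\<^sup>2 \<partial>M) \<le> e / 2" if "n \<ge> L" for n
      using that e by (intro sqg(2) less_imp_le[OF L]) auto
    then show "\<exists>no. \<forall>n\<ge>no. norm ((\<integral>t. (cmod (f n t - g t))\<^sup>2 \<partial>M) - 0) < e"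
    proof (intro exI[of _ L] allI impI)
      fix n assume n: "L \<le> n"
      from this[THEN \<open>\<And>n. n \<ge> L \<Longrightarrow> (\<integral>t. (cmod (f n t - g t))\<^sup>2 \<partial>M) \<le> e / 2\<close>] e
      have "(\<integral>t. (cmod (f n t - g t))\<^sup>2 \<partial>M) < e" by linarith
      then show "norm ((\<integral>t. (cmod (f n t - g t))\<^sup>2 \<partial>M) - 0) < e" by simp
    qed
  qed
  ultimately show ?thesis by blast
qed

lemma direct_sum_eq_refl: "direct_sum_eq \<psi> \<psi> \<longleftrightarrow> direct_sum_carrier \<psi>"
  by (auto simp: direct_sum_eq_def)

lemma gasket_l2_cases:
  obtains \<psi> where "direct_sum_carrier \<psi>" "x = abs_gasket_l2 \<psi>"
  using Quotient3_abs_rep[OF Quotient3_gasket_l2, of x] Quotient3_rep_reflp[OF Quotient3_gasket_l2, of x]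
  by (metis direct_sum_eq_refl)

lemma direct_sum_carrier_diff:
  assumes "direct_sum_carrier \<psi>" "direct_sum_carrier \<eta>"
  shows "direct_sum_carrier (\<lambda>w t. \<psi> w t - \<eta> w t)"
  using direct_sum_carrier_add[OF assms(1) direct_sum_carrier_cmult[OF assms(2), of "-1"]] by simp

lemma abs_gasket_l2_diff:
  assumes "direct_sum_carrier \<psi>" "direct_sum_carrier \<eta>"
  shows "abs_gasket_l2 \<psi> - abs_gasket_l2 \<eta> = abs_gasket_l2 (\<lambda>w t. \<psi> w t - \<eta> w t)"
  unfolding minus_gasket_l2_def uminus_gasket_l2_def
  using assms direct_sum_carrier_cmult[OF assms(2), of "-1"]
  by (simp add: scaleC.abs_eq plus_gasket_l2.abs_eq direct_sum_eq_refl)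

lemma cinner_abs:
  assumes "direct_sum_carrier \<psi>" "direct_sum_carrier \<eta>"
  shows "cinner (abs_gasket_l2 \<psi>) (abs_gasket_l2 \<eta>) = (\<Sum>\<^sub>\<infinity>w. \<integral>t. cnj (\<psi> w t) * \<eta> w t \<partial>arc_measure (length w))"
  using assms by (simp add: cinner.abs_eq direct_sum_eq_refl)

lemma norm_abs_gasket_l2:
  assumes "direct_sum_carrier \<psi>"
  shows "(norm (abs_gasket_l2 \<psi>))\<^sup>2 = (\<Sum>\<^sub>\<infinity>w. \<integral>t. (cmod (\<psi> w t))\<^sup>2 \<partial>arc_measure (length w))"
proof -
  have "(norm (abs_gasket_l2 \<psi>))\<^sup>2 = Re (cinner (abs_gasket_l2 \<psi>) (abs_gasket_l2 \<psi>))"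
    by (simp add: power2_norm_eq_inner inner_gasket_l2_def)
  also have "\<dots> = (\<Sum>\<^sub>\<infinity>w. Re (\<integral>t. cnj (\<psi> w t) * \<psi> w t \<partial>arc_measure (length w)))"
    unfolding cinner_abs[OF assms assms]
    by (rule infsum_Re[symmetric]) (rule direct_sum_inner_summable[OF assms assms])
  finally show ?thesis by (simp add: square_integral_conv)
qed

lemma norm_component_le:
  assumes "direct_sum_carrier \<psi>" "finite W"
  shows "(\<Sum>w\<in>W. \<integral>t. (cmod (\<psi> w t))\<^sup>2 \<partial>arc_measure (length w)) \<le> (norm (abs_gasket_l2 \<psi>))\<^sup>2"
  unfolding norm_abs_gasket_l2[OF assms(1)]
  using assms by (intro finite_sum_le_infsum) (auto simp: direct_sum_carrier_def)

text \<open>Needed for the convergence of series over the Fourier basis. Limits are taken triangle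
  by triangle, and the Cauchy estimates are kept uniform over finite sets of triangles so that they
  can be summed.\<close>

instance gasket_l2 :: complete_space
proof
  fix X :: "nat \<Rightarrow> gasket_l2"
  assume X: "Cauchy X"
  let ?M = "\<lambda>w::corner list. arc_measure (length w)"
  have "\<forall>n. \<exists>\<psi>. direct_sum_carrier \<psi> \<and> X n = abs_gasket_l2 \<psi>" using gasket_l2_cases by metis
  then obtain f where f: "\<And>n. direct_sum_carrier (f n)" "\<And>n. X n = abs_gasket_l2 (f n)" by metis
  have sq: "square_integrable (?M w) (f n w)" for n w using f(1) by (simp add: direct_sum_carrier_def)
  have diff: "X m - X n = abs_gasket_l2 (\<lambda>w t. f m w t - f n w t)" for m n
    unfolding f(2) by (rule abs_gasket_l2_diff[OF f(1) f(1)])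
  have small: "\<exists>K. \<forall>m\<ge>K. \<forall>n\<ge>K. \<forall>W. finite W \<longrightarrow> (\<Sum>w\<in>W. \<integral>t. (cmod (f m w t - f n w t))\<^sup>2 \<partial>?M w) < e" if e: "e > 0" for e
  proof -
    obtain K where K: "\<And>m n. m \<ge> K \<Longrightarrow> n \<ge> K \<Longrightarrow> norm (X m - X n) < sqrt e"
      using X e unfolding Cauchy_iff by (metis real_sqrt_gt_zero)
    show ?thesis
    proof (intro exI[of _ K] allI impI)
      fix m n and W :: "corner list set" assume mn: "m \<ge> K" "n \<ge> K" "finite W"
      have "(\<Sum>w\<in>W. \<integral>t. (cmod (f m w t - f n w t))\<^sup>2 \<partial>?M w) \<le> (norm (X m - X n))\<^sup>2"
        unfolding diff by (rule norm_component_le[OF direct_sum_carrier_diff[OF f(1) f(1)] mn(3)])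
      also have "\<dots> < (sqrt e)\<^sup>2" using K[OF mn(1,2)] by (intro power_strict_mono) auto
      finally show "(\<Sum>w\<in>W. \<integral>t. (cmod (f m w t - f n w t))\<^sup>2 \<partial>?M w) < e" using e by simp
    qed
  qed
  have "\<exists>g. square_integrable (?M w) g \<and> (\<lambda>n. \<integral>t. (cmod (f n w t - g t))\<^sup>2 \<partial>?M w) \<longlonglongrightarrow> 0" for w
  proof (rule L2_complete[OF finite_measure_arc_measure sq])
    fix e :: real assume "e > 0"
    from small[OF this] obtain K where "\<And>m n W. m \<ge> K \<Longrightarrow> n \<ge> K \<Longrightarrow> finite W \<Longrightarrow>
        (\<Sum>w\<in>W. \<integral>t. (cmod (f m w t - f n w t))\<^sup>2 \<partial>?M w) < e" by blast
    from this[of _ _ "{w}"] show "\<exists>K. \<forall>m\<ge>K. \<forall>n\<ge>K. (\<integral>t. (cmod (f m w t - f n w t))\<^sup>2 \<partial>?M w) < e"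
      by (intro exI[of _ K]) simp
  qed
  then have "\<exists>g. \<forall>w. square_integrable (?M w) (g w) \<and> (\<lambda>n. \<integral>t. (cmod (f n w t - g w t))\<^sup>2 \<partial>?M w) \<longlonglongrightarrow> 0"
    by (intro choice allI)
  then obtain g where gg: "\<forall>w. square_integrable (?M w) (g w) \<and>
      (\<lambda>n. \<integral>t. (cmod (f n w t - g w t))\<^sup>2 \<partial>?M w) \<longlonglongrightarrow> 0" by (rule exE)
  note g = conjunct1[OF spec[OF gg]] conjunct2[OF spec[OF gg]]
  have fg: "integrable (?M w) (\<lambda>t. (cmod (f n w t - g w t))\<^sup>2)" for n w
    using square_integrable_diff[OF sq g(1)] by (simp add: square_integrable_def)
  have ff: "integrable (?M w) (\<lambda>t. (cmod (f n w t - f m w t))\<^sup>2)" for n m w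
    using square_integrable_diff[OF sq[of w n] sq[of w m]] unfolding square_integrable_def by simp
  have close: "\<exists>K. \<forall>n\<ge>K. \<forall>W. finite W \<longrightarrow> (\<Sum>w\<in>W. \<integral>t. (cmod (f n w t - g w t))\<^sup>2 \<partial>?M w) \<le> e" if e: "e > 0" for e
  proof -
    have "e / 2 > 0" using e by simp
    from small[OF this] obtain K where K: "\<And>m n W. m \<ge> K \<Longrightarrow> n \<ge> K \<Longrightarrow> finite W \<Longrightarrow>
        (\<Sum>w\<in>W. \<integral>t. (cmod (f m w t - f n w t))\<^sup>2 \<partial>?M w) < e / 2" by blast
    show ?thesis
    proof (intro exI[of _ K] allI impI)
      fix n and W :: "corner list set" assume n: "n \<ge> K" "finite W"
      \<comment> \<open>For squares the triangle inequality holds only up to the factor 2, hence the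
        Cauchy estimate with \<open>e / 2\<close>; the last term vanishes as \<open>m\<close>
        grows.\<close>
      have le: "(\<integral>t. (cmod (f n w t - g w t))\<^sup>2 \<partial>?M w)
          \<le> 2 * (\<integral>t. (cmod (f n w t - f m w t))\<^sup>2 \<partial>?M w) + 2 * (\<integral>t. (cmod (f m w t - g w t))\<^sup>2 \<partial>?M w)" for m w
      proof -
        have "(\<integral>t. (cmod (f n w t - g w t))\<^sup>2 \<partial>?M w)
          \<le> (\<integral>t. 2 * (cmod (f n w t - f m w t))\<^sup>2 + 2 * (cmod (f m w t - g w t))\<^sup>2 \<partial>?M w)"
        proof (rule integral_mono)
          show "(cmod (f n w t - g w t))\<^sup>2 \<le> 2 * (cmod (f n w t - f m w t))\<^sup>2 + 2 * (cmod (f m w t - g w t))\<^sup>2" for t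
            using cmod_add_square_le[of "f n w t - f m w t" "f m w t - g w t"] by simp
        qed (intro Bochner_Integration.integrable_add integrable_mult_right fg ff)+
        also have "\<dots> = 2 * (\<integral>t. (cmod (f n w t - f m w t))\<^sup>2 \<partial>?M w) + 2 * (\<integral>t. (cmod (f m w t - g w t))\<^sup>2 \<partial>?M w)"
          by (subst Bochner_Integration.integral_add) (intro integrable_mult_right fg ff, intro integrable_mult_right fg ff, simp)
        finally show ?thesis .
      qed
      have lim: "(\<lambda>m. e + (\<Sum>w\<in>W. 2 * (\<integral>t. (cmod (f m w t - g w t))\<^sup>2 \<partial>?M w))) \<longlonglongrightarrow> e + (\<Sum>w\<in>W. 2 * 0)"
        by (intro tendsto_add tendsto_const tendsto_sum tendsto_mult g(2))
      have "(\<Sum>w\<in>W. \<integral>t. (cmod (f n w t - g w t))\<^sup>2 \<partial>?M w) \<le> e + (\<Sum>w\<in>W. 2 * 0)"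
      proof (rule LIMSEQ_le_const[OF lim], intro exI[of _ K] allI impI)
        fix m assume m: "K \<le> m"
        have "(\<Sum>w\<in>W. \<integral>t. (cmod (f n w t - g w t))\<^sup>2 \<partial>?M w)
          \<le> 2 * (\<Sum>w\<in>W. \<integral>t. (cmod (f n w t - f m w t))\<^sup>2 \<partial>?M w) + (\<Sum>w\<in>W. 2 * (\<integral>t. (cmod (f m w t - g w t))\<^sup>2 \<partial>?M w))"
          unfolding sum_distrib_left sum.distrib[symmetric] by (intro sum_mono le)
        then show "(\<Sum>w\<in>W. \<integral>t. (cmod (f n w t - g w t))\<^sup>2 \<partial>?M w) \<le> e + (\<Sum>w\<in>W. 2 * (\<integral>t. (cmod (f m w t - g w t))\<^sup>2 \<partial>?M w))"
          using K[OF n(1) m n(2)] by linarith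
      qed
      then show "(\<Sum>w\<in>W. \<integral>t. (cmod (f n w t - g w t))\<^sup>2 \<partial>?M w) \<le> e" by simp
    qed
  qed
  have fgc: "direct_sum_carrier (\<lambda>w t. f n w t - g w t)"
    if "\<And>W. finite W \<Longrightarrow> (\<Sum>w\<in>W. \<integral>t. (cmod (f n w t - g w t))\<^sup>2 \<partial>?M w) \<le> e" for n e
    unfolding direct_sum_carrier_def
  proof (intro conjI allI square_integrable_diff sq g)
    show "(\<lambda>w. \<integral>t. (cmod (f n w t - g w t))\<^sup>2 \<partial>?M w) summable_on UNIV"
      by (rule nonneg_bdd_above_summable_on) (use that in \<open>auto intro!: bdd_aboveI\<close>)
  qed
  obtain K0 where "\<And>W. finite W \<Longrightarrow> (\<Sum>w\<in>W. \<integral>t. (cmod (f K0 w t - g w t))\<^sup>2 \<partial>?M w) \<le> 1"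
    using close[OF zero_less_one] by blast
  then have "direct_sum_carrier (\<lambda>w t. f K0 w t - g w t)" by (rule fgc)
  from direct_sum_carrier_diff[OF f(1)[of K0] this] have gc: "direct_sum_carrier g" by simp
  have "X \<longlonglongrightarrow> abs_gasket_l2 g"
  proof (rule LIMSEQ_I)
    fix e :: real assume e: "e > 0"
    have "(e / 2)\<^sup>2 > 0" using e by simp
    from close[OF this] obtain K where K: "\<And>n W. n \<ge> K \<Longrightarrow> finite W \<Longrightarrow>
        (\<Sum>w\<in>W. \<integral>t. (cmod (f n w t - g w t))\<^sup>2 \<partial>?M w) \<le> (e / 2)\<^sup>2" by blast
    show "\<exists>no. \<forall>n\<ge>no. norm (X n - abs_gasket_l2 g) < e"
    proof (intro exI[of _ K] allI impI)
      fix n assume n: "K \<le> n"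
      have c: "direct_sum_carrier (\<lambda>w t. f n w t - g w t)" by (rule direct_sum_carrier_diff[OF f(1) gc])
      have "(norm (X n - abs_gasket_l2 g))\<^sup>2 \<le> (e / 2)\<^sup>2"
        unfolding f(2) abs_gasket_l2_diff[OF f(1) gc] norm_abs_gasket_l2[OF c]
        by (rule infsum_le_finite_sums) (use c K[OF n] in \<open>auto simp: direct_sum_carrier_def\<close>)
      then have "norm (X n - abs_gasket_l2 g) \<le> e / 2" by (rule power2_le_imp_le) (use e in auto)
      then show "norm (X n - abs_gasket_l2 g) < e" using e by linarith
    qed
  qed
  then show "convergent X" by (auto simp: convergent_def)
qed

instance gasket_l2 :: banach ..

section \<open>Complex scalars and the inner product\<close>

lemma zero_gasket_l2_abs: "0 = abs_gasket_l2 (\<lambda>_ _. 0)"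
  by (simp add: zero_gasket_l2_def)

lemma scaleC_zero_left [simp]: "0 *\<^sub>C x = 0"
  by transfer (auto simp: direct_sum_eq_def direct_sum_carrier_zero)

lemma scaleC_add_right: "c *\<^sub>C (x + y) = c *\<^sub>C x + c *\<^sub>C y"
  by transfer (auto simp: direct_sum_eq_def direct_sum_carrier_add direct_sum_carrier_cmult algebra_simps)

lemma scaleC_add_left: "(c + d) *\<^sub>C x = c *\<^sub>C x + d *\<^sub>C x"
  by transfer (auto simp: direct_sum_eq_def direct_sum_carrier_add direct_sum_carrier_cmult algebra_simps)

lemma scaleC_scaleC: "c *\<^sub>C d *\<^sub>C x = (c * d) *\<^sub>C x"
  by transfer (auto simp: direct_sum_eq_def direct_sum_carrier_cmult algebra_simps)

lemma diff_eq_scaleC: "x - y = x + (- 1) *\<^sub>C (y :: gasket_l2)"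
  by (simp add: minus_gasket_l2_def uminus_gasket_l2_def)

lemma cinner_add_right: "cinner x (y + z) = cinner x y + cinner x z"
  by (metis cinner_add_left cnj_cinner complex_cnj_add)

lemma cinner_scaleC_right: "cinner x (c *\<^sub>C y) = c * cinner x y"
  by (metis cinner_scaleC_left cnj_cinner complex_cnj_mult complex_cnj_cnj)

lemma cinner_zero [simp]: "cinner x 0 = 0" "cinner 0 x = 0"
  using cinner_scaleC_right[of x 0 0] cinner_scaleC_left[of 0 0 x] by simp_all

lemma cinner_diff_right: "cinner x (y - z) = cinner x y - cinner x z"
  by (simp add: diff_eq_scaleC cinner_add_right cinner_scaleC_right)

lemma cinner_sum_right: "cinner x (\<Sum>i\<in>F. g i) = (\<Sum>i\<in>F. cinner x (g i))"
  by (induction F rule: infinite_finite_induct) (auto simp: cinner_add_right)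

lemma cinner_sum_left: "cinner (\<Sum>i\<in>F. g i) x = (\<Sum>i\<in>F. cinner (g i) x)"
  by (induction F rule: infinite_finite_induct) (auto simp: cinner_add_left)

lemma cinner_self: "cinner x x = of_real ((norm x)\<^sup>2)"
proof (rule complex_eqI)
  show "Re (cinner x x) = Re (of_real ((norm x)\<^sup>2))"
    by (simp add: power2_norm_eq_inner inner_gasket_l2_def del: of_real_power)
  show "Im (cinner x x) = Im (of_real ((norm x)\<^sup>2))"
    using arg_cong[OF cnj_cinner[of x x], of Im] by (simp del: of_real_power)
qed

lemma norm_scaleC: "norm (c *\<^sub>C (x :: gasket_l2)) = cmod c * norm x"
proof -
  have "complex_of_real ((norm (c *\<^sub>C x))\<^sup>2) = of_real ((cmod c * norm x)\<^sup>2)"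
    unfolding cinner_self[symmetric] cinner_scaleC_left cinner_scaleC_right
    using complex_norm_square[of c] by (simp add: cinner_self power_mult_distrib mult_ac)
  then have "(norm (c *\<^sub>C x))\<^sup>2 = (cmod c * norm x)\<^sup>2" by (simp only: of_real_eq_iff)
  then show ?thesis by (rule power2_eq_imp_eq) auto
qed

lemma norm_cinner_le: "cmod (cinner x y) \<le> norm x * norm y"
proof -
  define u where "u = sgn (cinner x y)"
  have "cmod (cinner x y) = Re (cinner (u *\<^sub>C x) y)"
    by (simp add: u_def cinner_scaleC_left cnj_sgn_mult)
  also have "\<dots> = inner (u *\<^sub>C x) y" by (simp add: inner_gasket_l2_def)
  also have "\<dots> \<le> norm (u *\<^sub>C x) * norm y" by (rule norm_cauchy_schwarz)
  also have "\<dots> \<le> norm x * norm y"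
    unfolding norm_scaleC by (intro mult_right_mono mult_left_le_one_le) (auto simp: u_def norm_sgn)
  finally show ?thesis .
qed

lemma bounded_linear_cinner: "bounded_linear (cinner x)"
proof (rule bounded_linear_intro[of _ "norm x"])
  show "cinner x (r *\<^sub>R y) = r *\<^sub>R cinner x y" for r y
    by (simp add: scaleR_gasket_l2_def cinner_scaleC_right scaleR_conv_of_real)
  show "norm (cinner x y) \<le> norm y * norm x" for y using norm_cinner_le[of x y] by (simp add: mult.commute)
qed (rule cinner_add_right)

lemma bounded_linear_scaleC: "bounded_linear (scaleC c)"
proof (rule bounded_linear_intro[of _ "cmod c"])
  show "c *\<^sub>C (r *\<^sub>R y) = r *\<^sub>R (c *\<^sub>C y)" for r y
    by (simp add: scaleR_gasket_l2_def scaleC_scaleC mult.commute)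
qed (auto simp: scaleC_add_right norm_scaleC mult.commute)

subsection \<open>The Fourier basis\<close>

text \<open>Pairs as indices make one orthonormal family of the characters of all triangles, in
  which \<open>dirac\<close> is diagonal.\<close>

definition basis_vec :: "corner list \<times> int \<Rightarrow> gasket_l2" where
  "basis_vec i = fourier_vec (fst i) (snd i)"

lemma fourier_vec_abs: "fourier_vec w k = abs_gasket_l2 (\<lambda>v t. if v = w then character (length w) k t else 0)"
  by (simp add: fourier_vec_def map_fun_def character_exp cong: if_cong)

lemma square_integrable_character: "square_integrable (arc_measure n) (character n k)"
proof -
  interpret finite_measure "arc_measure n" by (rule finite_measure_arc_measure)
  show ?thesis by (simp add: square_integrable_def)
qed

lemma cinner_fourier_vec:
  assumes "direct_sum_carrier \<psi>"
  shows "cinner (fourier_vec w k) (abs_gasket_l2 \<psi>) = fcoeff (length w) k (\<psi> w)"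
proof -
  have c: "direct_sum_carrier (\<lambda>v t. if v = w then character (length w) k t else 0)"
    by (intro direct_sum_carrier_single square_integrable_character)
  have "cinner (fourier_vec w k) (abs_gasket_l2 \<psi>)
      = (\<Sum>\<^sub>\<infinity>v. \<integral>t. cnj (if v = w then character (length w) k t else 0) * \<psi> v t \<partial>arc_measure (length v))"
    unfolding fourier_vec_abs by (rule cinner_abs[OF c assms])
  also have "\<dots> = (\<Sum>\<^sub>\<infinity>v\<in>{w}. \<integral>t. cnj (if v = w then character (length w) k t else 0) * \<psi> v t \<partial>arc_measure (length v))"
    by (rule infsum_cong_neutral) auto
  finally show ?thesis by (simp add: fcoeff_def)
qed

lemma fcoeff_character: "fcoeff n k (character n l) = (if k = l then 1 else 0)"
proof -
  have "fcoeff n k (character n l) = integral\<^sup>L (arc_measure n) (character n (- k + l))"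
    unfolding fcoeff_def cnj_character character_add[symmetric] ..
  then show ?thesis by (auto simp: integral_character)
qed

lemma cinner_basis: "cinner (basis_vec i) (basis_vec j) = (if i = j then 1 else 0)"
proof -
  have c: "direct_sum_carrier (\<lambda>v t. if v = fst j then character (length (fst j)) (snd j) t else 0)"
    by (intro direct_sum_carrier_single square_integrable_character)
  have "cinner (basis_vec i) (basis_vec j)
      = fcoeff (length (fst i)) (snd i) (\<lambda>t. if fst i = fst j then character (length (fst j)) (snd j) t else 0)"
    unfolding basis_vec_def fourier_vec_abs[of "fst j"] by (rule cinner_fourier_vec[OF c])
  then show ?thesis
    by (cases "fst i = fst j") (auto simp: fcoeff_character prod_eq_iff, simp add: fcoeff_def)
qed

definition coef :: "gasket_l2 \<Rightarrow> corner list \<times> int \<Rightarrow> complex" where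
  "coef x i = cinner (basis_vec i) x"

lemma coef_add: "coef (x + y) i = coef x i + coef y i"
  and coef_diff: "coef (x - y) i = coef x i - coef y i"
  and coef_scaleC: "coef (c *\<^sub>C x) i = c * coef x i"
  and coef_basis: "coef (basis_vec j) i = (if i = j then 1 else 0)"
  by (simp_all add: coef_def cinner_add_right cinner_diff_right cinner_scaleC_right cinner_basis)

text \<open>The components are integrable, as the measure is finite, so the completeness of the
  characters applies in each triangle.\<close>

lemma coef_eq_0_imp:
  assumes "\<And>i. coef x i = 0"
  shows "x = 0"
proof -
  obtain \<psi> where \<psi>: "direct_sum_carrier \<psi>" "x = abs_gasket_l2 \<psi>" by (rule gasket_l2_cases)
  have "AE t in arc_measure (length w). \<psi> w t = 0" for w
  proof (rule fcoeff_eq_0_imp)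
    show "integrable (arc_measure (length w)) (\<psi> w)"
      using \<psi>(1) by (intro square_integrable_integrable finite_measure_arc_measure) (simp add: direct_sum_carrier_def)
    show "fcoeff (length w) k (\<psi> w) = 0" for k
      using assms[of "(w, k)"] cinner_fourier_vec[OF \<psi>(1)] by (simp add: coef_def basis_vec_def \<psi>(2))
  qed
  then have "direct_sum_eq \<psi> (\<lambda>_ _. 0)"
    using \<psi>(1) direct_sum_carrier_zero by (simp add: direct_sum_eq_def)
  then show ?thesis
    unfolding \<psi>(2) zero_gasket_l2_abs by (rule Quotient3_rel_abs[OF Quotient3_gasket_l2])
qed

lemma coef_eqI: "(\<And>i. coef x i = coef y i) \<Longrightarrow> x = y"
  using coef_eq_0_imp[of "x - y"] by (simp add: coef_diff)

lemma cinner_sum_basis: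
  assumes "finite F"
  shows "cinner (\<Sum>i\<in>F. c i *\<^sub>C basis_vec i) x = (\<Sum>i\<in>F. cnj (c i) * coef x i)"
  by (simp add: cinner_sum_left cinner_scaleC_left coef_def)

lemma coef_sum_basis:
  assumes "finite F"
  shows "coef (\<Sum>i\<in>F. c i *\<^sub>C basis_vec i) j = (if j \<in> F then c j else 0)"
proof -
  have "coef (\<Sum>i\<in>F. c i *\<^sub>C basis_vec i) j = (\<Sum>i\<in>F. if j = i then c i else 0)"
    unfolding coef_def cinner_sum_right cinner_scaleC_right cinner_basis by (intro sum.cong) auto
  then show ?thesis using assms by simp
qed

lemma norm_sum_basis:
  assumes "finite F"
  shows "(norm (\<Sum>i\<in>F. c i *\<^sub>C basis_vec i))\<^sup>2 = (\<Sum>i\<in>F. (cmod (c i))\<^sup>2)"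
proof -
  have "complex_of_real ((norm (\<Sum>i\<in>F. c i *\<^sub>C basis_vec i))\<^sup>2) = (\<Sum>i\<in>F. cnj (c i) * c i)"
    unfolding cinner_self[symmetric] cinner_sum_basis[OF assms] coef_sum_basis[OF assms]
    by (intro sum.cong) auto
  also have "\<dots> = of_real (\<Sum>i\<in>F. (cmod (c i))\<^sup>2)"
    by (simp add: complex_norm_square mult.commute del: of_real_power)
  finally show ?thesis by (simp only: of_real_eq_iff)
qed

text \<open>For the projection \<open>y\<close> of \<open>x\<close> onto finitely many basis
  vectors, \<open>cinner y x\<close> is the square of \<open>norm y\<close>, so the Cauchy-Schwarz
  inequality gives \<open>norm y \<le> norm x\<close>.\<close>

lemma bessel:
  assumes "finite F"
  shows "(\<Sum>i\<in>F. (cmod (coef x i))\<^sup>2) \<le> (norm x)\<^sup>2"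
proof -
  define y where "y = (\<Sum>i\<in>F. coef x i *\<^sub>C basis_vec i)"
  have y: "(norm y)\<^sup>2 = (\<Sum>i\<in>F. (cmod (coef x i))\<^sup>2)" unfolding y_def by (rule norm_sum_basis[OF assms])
  have "cinner y x = (\<Sum>i\<in>F. cnj (coef x i) * coef x i)" unfolding y_def by (rule cinner_sum_basis[OF assms])
  also have "\<dots> = of_real ((norm y)\<^sup>2)"
    unfolding y by (simp add: complex_norm_square mult.commute del: of_real_power)
  finally have "(norm y)\<^sup>2 \<le> norm y * norm x"
    using norm_cinner_le[of y x] by (simp add: norm_power)
  then have "norm y \<le> norm x" by (cases "norm y = 0") (auto simp: power2_eq_square)
  then show ?thesis unfolding y[symmetric] by (intro power_mono) auto
qed

lemma coef_summable: "(\<lambda>i. (cmod (coef x i))\<^sup>2) summable_on I"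
  by (rule nonneg_bdd_above_summable_on) (auto intro!: bdd_aboveI[of _ "(norm x)\<^sup>2"] bessel)

text \<open>Unordered sums converge along the filter of finite subsets, and that filter is Cauchy
  here: two partial sums beyond \<open>F0\<close> differ only by parts disjoint from
  \<open>F0\<close>.\<close>

lemma summable_on_CauchyI:
  fixes f :: "'a \<Rightarrow> 'b::banach"
  assumes "\<And>e. e > 0 \<Longrightarrow> \<exists>F0. finite F0 \<and> F0 \<subseteq> A \<and>
    (\<forall>F. finite F \<and> F \<subseteq> A \<and> F \<inter> F0 = {} \<longrightarrow> norm (sum f F) < e)"
  shows "f summable_on A"
proof -
  have "\<exists>P. eventually P (finite_subsets_at_top A) \<and> (\<forall>F F'. P F \<and> P F' \<longrightarrow> dist (sum f F) (sum f F') < e)"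
    if e: "e > 0" for e
  proof -
    have "e / 2 > 0" using e by simp
    from assms[OF this] obtain F0 where "finite F0 \<and> F0 \<subseteq> A \<and>
      (\<forall>F. finite F \<and> F \<subseteq> A \<and> F \<inter> F0 = {} \<longrightarrow> norm (sum f F) < e / 2)" by (rule exE)
    then have F0: "finite F0" "F0 \<subseteq> A"
      "\<And>F. finite F \<Longrightarrow> F \<subseteq> A \<Longrightarrow> F \<inter> F0 = {} \<Longrightarrow> norm (sum f F) < e / 2" by simp_all
    define P where "P F \<longleftrightarrow> finite F \<and> F0 \<subseteq> F \<and> F \<subseteq> A" for F
    have "eventually P (finite_subsets_at_top A)"
      unfolding eventually_finite_subsets_at_top using F0 by (intro exI[of _ F0]) (auto simp: P_def)
    moreover have "dist (sum f F) (sum f F') < e" if "P F" "P F'" for F F'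
    proof -
      have split: "sum f G = sum f F0 + sum f (G - F0)" if "P G" for G
        using that sum.subset_diff[of F0 G f] by (simp add: P_def add.commute)
      have "norm (sum f (G - F0)) < e / 2" if "P G" for G
        using that by (intro F0(3)) (auto simp: P_def)
      from this[OF \<open>P F\<close>] this[OF \<open>P F'\<close>] show ?thesis
        unfolding dist_norm split[OF \<open>P F\<close>] split[OF \<open>P F'\<close>]
        using norm_triangle_ineq4[of "sum f (F - F0)" "sum f (F' - F0)"] by simp
    qed
    ultimately show ?thesis by blast
  qed
  then have "cauchy_filter (filtermap (sum f) (finite_subsets_at_top A))"
    by (simp add: cauchy_filter_metric_filtermap)
  moreover have "complete (UNIV::'b set)"
    by (meson Cauchy_convergent UNIV_I complete_def convergent_def)
  ultimately obtain L' where "(sum f \<longlongrightarrow> L') (finite_subsets_at_top A)"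
    using complete_uniform[where S=UNIV] by (force simp add: filterlim_def)
  then show ?thesis
    using summable_on_def has_sum_def by blast
qed

lemma summable_on_tail:
  fixes f :: "'a \<Rightarrow> real"
  assumes "f summable_on A" "\<And>i. i \<in> A \<Longrightarrow> 0 \<le> f i" "e > 0"
  shows "\<exists>F0. finite F0 \<and> F0 \<subseteq> A \<and> (\<forall>F. finite F \<and> F \<subseteq> A \<and> F \<inter> F0 = {} \<longrightarrow> sum f F < e)"
proof -
  have "(sum f \<longlongrightarrow> infsum f A) (finite_subsets_at_top A)"
    using has_sum_infsum[OF assms(1)] by (simp add: has_sum_def)
  then have "\<forall>\<^sub>F F in finite_subsets_at_top A. infsum f A - e < sum f F"
    by (rule order_tendstoD) (use assms(3) in simp)
  then obtain F0 where F0: "finite F0" "F0 \<subseteq> A" "infsum f A - e < sum f F0"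
    unfolding eventually_finite_subsets_at_top by blast
  have "sum f F < e" if "finite F" "F \<subseteq> A" "F \<inter> F0 = {}" for F
  proof -
    have "sum f (F \<union> F0) \<le> infsum f A"
      using that F0 assms by (intro finite_sum_le_infsum) auto
    moreover have "sum f (F \<union> F0) = sum f F + sum f F0"
      using that F0 by (intro sum.union_disjoint) auto
    ultimately show ?thesis using F0(3) by linarith
  qed
  then show ?thesis using F0 by blast
qed

text \<open>Orthonormality turns tails of the vector series into tails of the square sum.\<close>

lemma riesz_fischer:
  assumes "(\<lambda>i. (cmod (c i))\<^sup>2) summable_on I"
  shows "(\<lambda>i. c i *\<^sub>C basis_vec i) summable_on I"
proof (rule summable_on_CauchyI)
  fix e :: real assume e: "e > 0"
  then have "e\<^sup>2 > 0" by simp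
  from summable_on_tail[OF assms zero_le_power2 this] obtain F0 where "finite F0 \<and> F0 \<subseteq> I \<and>
    (\<forall>F. finite F \<and> F \<subseteq> I \<and> F \<inter> F0 = {} \<longrightarrow> (\<Sum>i\<in>F. (cmod (c i))\<^sup>2) < e\<^sup>2)" by (rule exE)
  then have F0: "finite F0" "F0 \<subseteq> I"
    "\<And>F. finite F \<Longrightarrow> F \<subseteq> I \<Longrightarrow> F \<inter> F0 = {} \<Longrightarrow> (\<Sum>i\<in>F. (cmod (c i))\<^sup>2) < e\<^sup>2" by simp_all
  have "norm (\<Sum>i\<in>F. c i *\<^sub>C basis_vec i) < e" if F: "finite F" "F \<subseteq> I" "F \<inter> F0 = {}" for F
  proof (rule power2_less_imp_less)
    show "(norm (\<Sum>i\<in>F. c i *\<^sub>C basis_vec i))\<^sup>2 < e\<^sup>2"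
      unfolding norm_sum_basis[OF F(1)] by (rule F0(3)[OF F])
  qed (use e in auto)
  then show "\<exists>F0. finite F0 \<and> F0 \<subseteq> I \<and> (\<forall>F. finite F \<and> F \<subseteq> I \<and> F \<inter> F0 = {} \<longrightarrow>
      norm (\<Sum>i\<in>F. c i *\<^sub>C basis_vec i) < e)"
    using F0(1,2) by blast
qed

lemma coef_infsum:
  assumes "(\<lambda>i. c i *\<^sub>C basis_vec i) summable_on I"
  shows "coef (\<Sum>\<^sub>\<infinity>i\<in>I. c i *\<^sub>C basis_vec i) j = (if j \<in> I then c j else 0)"
proof -
  have "((\<lambda>i. cinner (basis_vec j) (c i *\<^sub>C basis_vec i)) has_sum coef (\<Sum>\<^sub>\<infinity>i\<in>I. c i *\<^sub>C basis_vec i) j) I"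
    unfolding coef_def by (intro has_sum_bounded_linear[OF bounded_linear_cinner] has_sum_infsum assms)
  then have "coef (\<Sum>\<^sub>\<infinity>i\<in>I. c i *\<^sub>C basis_vec i) j = (\<Sum>\<^sub>\<infinity>i\<in>I. cinner (basis_vec j) (c i *\<^sub>C basis_vec i))"
    by (simp add: infsumI)
  also have "\<dots> = (\<Sum>\<^sub>\<infinity>i\<in>(if j \<in> I then {j} else {}). cinner (basis_vec j) (c i *\<^sub>C basis_vec i))"
    by (rule infsum_cong_neutral) (auto simp: cinner_scaleC_right cinner_basis split: if_splits)
  finally show ?thesis by (simp add: cinner_scaleC_right cinner_basis)
qed

text \<open>For the forward direction, Bessel's inequality is applied to the sum of the series,
  whose coefficients are \<open>c\<close>.\<close>

lemma basis_summable_iff: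
  "(\<lambda>i. c i *\<^sub>C basis_vec i) summable_on I \<longleftrightarrow> (\<lambda>i. (cmod (c i))\<^sup>2) summable_on I"
proof
  assume s: "(\<lambda>i. c i *\<^sub>C basis_vec i) summable_on I"
  have "(\<lambda>i. (cmod (coef (\<Sum>\<^sub>\<infinity>i\<in>I. c i *\<^sub>C basis_vec i) i))\<^sup>2) summable_on I" by (rule coef_summable)
  then show "(\<lambda>i. (cmod (c i))\<^sup>2) summable_on I"
    by (rule summable_on_cong[THEN iffD1, rotated]) (simp add: coef_infsum[OF s])
qed (rule riesz_fischer)

text \<open>The series converges and its sum has the same coefficients as \<open>x\<close>, which
  determine a vector.\<close>

lemma basis_expansion: "((\<lambda>i. coef x i *\<^sub>C basis_vec i) has_sum x) UNIV"
proof -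
  have s: "(\<lambda>i. coef x i *\<^sub>C basis_vec i) summable_on UNIV" by (intro riesz_fischer coef_summable)
  have "(\<Sum>\<^sub>\<infinity>i. coef x i *\<^sub>C basis_vec i) = x"
    by (rule coef_eqI) (simp add: coef_infsum[OF s])
  then show ?thesis using has_sum_infsum[OF s] by simp
qed

lemma norm_infsum_basis:
  assumes "(\<lambda>i. (cmod (c i))\<^sup>2) summable_on I"
  shows "(norm (\<Sum>\<^sub>\<infinity>i\<in>I. c i *\<^sub>C basis_vec i))\<^sup>2 = (\<Sum>\<^sub>\<infinity>i\<in>I. (cmod (c i))\<^sup>2)"
proof -
  have "(sum (\<lambda>i. c i *\<^sub>C basis_vec i) \<longlongrightarrow> (\<Sum>\<^sub>\<infinity>i\<in>I. c i *\<^sub>C basis_vec i)) (finite_subsets_at_top I)"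
    using has_sum_infsum[OF riesz_fischer[OF assms]] by (simp add: has_sum_def)
  then have "((\<lambda>F. (norm (\<Sum>i\<in>F. c i *\<^sub>C basis_vec i))\<^sup>2) \<longlongrightarrow> (norm (\<Sum>\<^sub>\<infinity>i\<in>I. c i *\<^sub>C basis_vec i))\<^sup>2) (finite_subsets_at_top I)"
    by (intro tendsto_intros)
  moreover have "\<forall>\<^sub>F F in finite_subsets_at_top I. (norm (\<Sum>i\<in>F. c i *\<^sub>C basis_vec i))\<^sup>2 = (\<Sum>i\<in>F. (cmod (c i))\<^sup>2)"
    by (rule eventually_finite_subsets_at_top_weakI) (rule norm_sum_basis)
  ultimately have "((\<lambda>F. \<Sum>i\<in>F. (cmod (c i))\<^sup>2) \<longlongrightarrow> (norm (\<Sum>\<^sub>\<infinity>i\<in>I. c i *\<^sub>C basis_vec i))\<^sup>2) (finite_subsets_at_top I)"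
    by (rule Lim_transform_eventually)
  then have "((\<lambda>i. (cmod (c i))\<^sup>2) has_sum (norm (\<Sum>\<^sub>\<infinity>i\<in>I. c i *\<^sub>C basis_vec i))\<^sup>2) I"
    by (simp add: has_sum_def)
  then show ?thesis by (simp add: infsumI)
qed

lemma parseval: "(norm x)\<^sup>2 = (\<Sum>\<^sub>\<infinity>i. (cmod (coef x i))\<^sup>2)"
  using norm_infsum_basis[OF coef_summable[of x UNIV]] infsumI[OF basis_expansion[of x]] by simp

subsection \<open>The Dirac operator in the Fourier basis\<close>

lemma coef_summand_proj: "coef (summand_proj w x) i = (if fst i = w then coef x i else 0)"
proof -
  obtain \<psi> where \<psi>: "direct_sum_carrier \<psi>" "x = abs_gasket_l2 \<psi>" by (rule gasket_l2_cases)
  have 1: "summand_proj w x = abs_gasket_l2 (\<lambda>v t. if v = w then \<psi> v t else 0)"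
    unfolding \<psi>(2) using \<psi>(1) by (simp add: summand_proj.abs_eq direct_sum_eq_refl)
  have eq: "(\<lambda>v t. if v = w then \<psi> v t else 0) = (\<lambda>v t. if v = w then \<psi> w t else 0)" by (intro ext) auto
  have c: "direct_sum_carrier (\<lambda>v t. if v = w then \<psi> v t else 0)"
    unfolding eq using \<psi>(1) by (intro direct_sum_carrier_single) (simp add: direct_sum_carrier_def)
  show ?thesis
    unfolding coef_def basis_vec_def 1 cinner_fourier_vec[OF c]
    unfolding \<psi>(2) cinner_fourier_vec[OF \<psi>(1)] by (simp add: fcoeff_def)
qed

definition eigenvalue :: "corner list \<times> int \<Rightarrow> complex" where
  "eigenvalue i = of_real (dirac_eigenvalue (fst i) (snd i))"

lemma inj_Pair: "inj (Pair w)"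
  by (simp add: inj_on_def)

lemma summand_series:
  "(\<lambda>k. (of_real (dirac_eigenvalue w k) * cinner (fourier_vec w k) (summand_proj w x)) *\<^sub>C fourier_vec w k)
    = (\<lambda>i. (eigenvalue i * coef x i) *\<^sub>C basis_vec i) \<circ> Pair w"
proof
  fix k
  show "(of_real (dirac_eigenvalue w k) * cinner (fourier_vec w k) (summand_proj w x)) *\<^sub>C fourier_vec w k
    = ((\<lambda>i. (eigenvalue i * coef x i) *\<^sub>C basis_vec i) \<circ> Pair w) k"
    using coef_summand_proj[of w x "(w, k)"] by (simp add: eigenvalue_def coef_def basis_vec_def)
qed

lemma dirac_summand_dom_iff:
  "summand_proj w x \<in> dirac_summand_dom w \<longleftrightarrow> (\<lambda>i. (cmod (eigenvalue i * coef x i))\<^sup>2) summable_on (range (Pair w))"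
  unfolding dirac_summand_dom_def mem_Collect_eq summand_series
  using summable_on_reindex[OF inj_Pair, of "\<lambda>i. (eigenvalue i * coef x i) *\<^sub>C basis_vec i" w]
  by (simp add: basis_summable_iff)

lemma dirac_summand_eq:
  "dirac_summand w (summand_proj w x) = (\<Sum>\<^sub>\<infinity>i\<in>range (Pair w). (eigenvalue i * coef x i) *\<^sub>C basis_vec i)"
  unfolding dirac_summand_def summand_series by (rule infsum_reindex[OF inj_Pair, symmetric])

text \<open>The domain is defined in two stages, over the characters of each triangle and then over
  the triangles. As all terms are nonnegative, the stages together amount to one summability over
  pairs.\<close>

lemma dirac_dom_iff: "x \<in> dirac_dom \<longleftrightarrow> (\<lambda>i. (cmod (eigenvalue i * coef x i))\<^sup>2) summable_on UNIV"
proof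
  let ?g = "\<lambda>i. (cmod (eigenvalue i * coef x i))\<^sup>2"
  have nrm: "(norm (dirac_summand w (summand_proj w x)))\<^sup>2 = (\<Sum>\<^sub>\<infinity>k. ?g (w, k))" if "?g summable_on range (Pair w)" for w
    unfolding dirac_summand_eq norm_infsum_basis[OF that] unfolding infsum_reindex[OF inj_Pair] by (simp add: o_def)
  have row: "(\<lambda>k. ?g (w, k)) summable_on UNIV" if "?g summable_on range (Pair w)" for w
    using that summable_on_reindex[OF inj_Pair, of ?g w] by (simp add: o_def)
  {
    assume x: "x \<in> dirac_dom"
    then have 1: "?g summable_on range (Pair w)" for w
      by (simp add: dirac_dom_def dirac_summand_dom_iff)
    have 2: "(\<lambda>w. \<Sum>\<^sub>\<infinity>k. ?g (w, k)) summable_on UNIV"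
      using x unfolding dirac_dom_def by (simp add: nrm[OF 1])
    have "?g summable_on (Sigma UNIV (\<lambda>_. UNIV))"
      by (rule summable_on_SigmaI[OF has_sum_infsum[OF row[OF 1]] 2]) simp
    then show "?g summable_on UNIV" by simp
  next
    assume s: "?g summable_on UNIV"
    then have 1: "?g summable_on range (Pair w)" for w by (rule summable_on_subset_banach) simp
    have "(\<lambda>w. \<Sum>\<^sub>\<infinity>k. ?g (w, k)) summable_on UNIV"
      using s by (intro summable_on_Sigma_banach) (simp add: case_prod_unfold)
    then show "x \<in> dirac_dom"
      using 1 by (simp add: dirac_dom_def dirac_summand_dom_iff nrm[OF 1])
  }
qed

lemma dirac_eq:
  assumes "x \<in> dirac_dom"
  shows "dirac x = (\<Sum>\<^sub>\<infinity>i. (eigenvalue i * coef x i) *\<^sub>C basis_vec i)"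
proof -
  let ?g = "\<lambda>i. (eigenvalue i * coef x i) *\<^sub>C basis_vec i"
  have "?g summable_on UNIV" using assms unfolding dirac_dom_iff by (rule riesz_fischer)
  then have "(\<lambda>(w, k). ?g (w, k)) summable_on (UNIV \<times> UNIV)" by (simp add: case_prod_unfold)
  then have "(\<Sum>\<^sub>\<infinity>w. \<Sum>\<^sub>\<infinity>k. ?g (w, k)) = (\<Sum>\<^sub>\<infinity>(w, k)\<in>UNIV \<times> UNIV. ?g (w, k))"
    by (rule infsum_Sigma'_banach)
  moreover have "dirac_summand w (summand_proj w x) = (\<Sum>\<^sub>\<infinity>k. ?g (w, k))" for w
    unfolding dirac_summand_eq infsum_reindex[OF inj_Pair] by (simp add: o_def)
  ultimately show ?thesis by (simp add: dirac_def case_prod_unfold)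
qed

lemma coef_dirac:
  assumes "x \<in> dirac_dom"
  shows "coef (dirac x) i = eigenvalue i * coef x i"
  unfolding dirac_eq[OF assms] using assms unfolding dirac_dom_iff
  by (subst coef_infsum[OF riesz_fischer]) auto

lemma basis_in_dirac_dom: "basis_vec j \<in> dirac_dom"
proof -
  have "(\<lambda>i. (cmod (eigenvalue i * coef (basis_vec j) i))\<^sup>2) summable_on {j}" by simp
  then show ?thesis
    unfolding dirac_dom_iff by (rule summable_on_cong_neutral[THEN iffD1, rotated -1]) (auto simp: coef_basis)
qed

lemma dirac_basis: "dirac (basis_vec j) = eigenvalue j *\<^sub>C basis_vec j"
  by (rule coef_eqI) (simp add: coef_dirac[OF basis_in_dirac_dom] coef_scaleC coef_basis)

lemma l2_summable_add:
  fixes f g :: "'a \<Rightarrow> complex"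
  assumes "(\<lambda>i. (cmod (f i))\<^sup>2) summable_on I" "(\<lambda>i. (cmod (g i))\<^sup>2) summable_on I"
  shows "(\<lambda>i. (cmod (f i + g i))\<^sup>2) summable_on I"
proof (rule summable_on_comparison_test)
  show "(\<lambda>i. 2 * (cmod (f i))\<^sup>2 + 2 * (cmod (g i))\<^sup>2) summable_on I"
    by (intro summable_on_add summable_on_cmult_right assms)
qed (auto intro: cmod_add_square_le)

lemma dirac_dom_add: "x \<in> dirac_dom \<Longrightarrow> y \<in> dirac_dom \<Longrightarrow> x + y \<in> dirac_dom"
  unfolding dirac_dom_iff coef_add distrib_left by (rule l2_summable_add)

lemma dirac_dom_scaleC: "x \<in> dirac_dom \<Longrightarrow> c *\<^sub>C x \<in> dirac_dom"
  unfolding dirac_dom_iff coef_scaleC mult.left_commute[of _ c]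
  unfolding norm_mult[of c] power_mult_distrib[of "cmod c"] by (rule summable_on_cmult_right)

lemma dirac_dom_sum: "(\<And>i. i \<in> F \<Longrightarrow> g i \<in> dirac_dom) \<Longrightarrow> sum g F \<in> dirac_dom"
proof (induction F rule: infinite_finite_induct)
  case (insert i F)
  then show ?case by (simp add: dirac_dom_add)
qed (use dirac_dom_scaleC[OF basis_in_dirac_dom, of 0] in auto)

lemma dirac_add: "x \<in> dirac_dom \<Longrightarrow> y \<in> dirac_dom \<Longrightarrow> dirac (x + y) = dirac x + dirac y"
  by (rule coef_eqI) (simp add: coef_dirac dirac_dom_add coef_add algebra_simps)

lemma dirac_scaleC: "x \<in> dirac_dom \<Longrightarrow> dirac (c *\<^sub>C x) = c *\<^sub>C dirac x"
  by (rule coef_eqI) (simp add: coef_dirac dirac_dom_scaleC coef_scaleC algebra_simps)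

lemma closure_dirac_dom: "closure dirac_dom = UNIV"
proof -
  have "x \<in> closure dirac_dom" for x
  proof (rule Lim_in_closed_set[OF closed_closure])
    show "(sum (\<lambda>i. coef x i *\<^sub>C basis_vec i) \<longlongrightarrow> x) (finite_subsets_at_top UNIV)"
      using basis_expansion[of x] by (simp add: has_sum_def)
    have "(\<Sum>i\<in>F. coef x i *\<^sub>C basis_vec i) \<in> dirac_dom" for F
      by (intro dirac_dom_sum dirac_dom_scaleC basis_in_dirac_dom)
    then show "\<forall>\<^sub>F F in finite_subsets_at_top UNIV. (\<Sum>i\<in>F. coef x i *\<^sub>C basis_vec i) \<in> closure dirac_dom"
      using closure_subset by (intro always_eventually) blast
  qed simp
  then show ?thesis by blast
qed

subsection \<open>Multiplication operators and commutators\<close>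

lemma mult_op_abs:
  assumes f: "continuous_on (gasket a) f" and \<psi>: "direct_sum_carrier \<psi>"
  shows "direct_sum_carrier (\<lambda>w t. f (cell_param a w t) * \<psi> w t)"
    and "mult_op a f (abs_gasket_l2 \<psi>) = abs_gasket_l2 (\<lambda>w t. f (cell_param a w t) * \<psi> w t)"
proof -
  have r: "direct_sum_eq \<psi> \<psi>" using \<psi> by (simp add: direct_sum_eq_refl)
  show "direct_sum_carrier (\<lambda>w t. f (cell_param a w t) * \<psi> w t)"
    using mult_op.rsp[THEN rel_funD, OF refl, THEN rel_funD, OF refl, THEN rel_funD, OF r, of a f] f
    by (simp add: direct_sum_eq_refl)
  show "mult_op a f (abs_gasket_l2 \<psi>) = abs_gasket_l2 (\<lambda>w t. f (cell_param a w t) * \<psi> w t)"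
    using mult_op.abs_eq[OF r, of a f] f by simp
qed

lemma coef_mult_op:
  assumes "continuous_on (gasket a) f" "direct_sum_carrier \<psi>"
  shows "coef (mult_op a f (abs_gasket_l2 \<psi>)) (w, k) = fcoeff (length w) k (\<lambda>t. f (cell_param a w t) * \<psi> w t)"
  unfolding coef_def basis_vec_def mult_op_abs(2)[OF assms] cinner_fourier_vec[OF mult_op_abs(1)[OF assms]] by simp

lemma coef_abs: "direct_sum_carrier \<psi> \<Longrightarrow> coef (abs_gasket_l2 \<psi>) (w, k) = fcoeff (length w) k (\<psi> w)"
  by (simp add: coef_def basis_vec_def cinner_fourier_vec)

lemma mult_op_scaleC:
  assumes f: "continuous_on (gasket a) f"
  shows "mult_op a f (c *\<^sub>C x) = c *\<^sub>C mult_op a f x"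
proof -
  obtain \<psi> where \<psi>: "direct_sum_carrier \<psi>" "x = abs_gasket_l2 \<psi>" by (rule gasket_l2_cases)
  show ?thesis
    unfolding \<psi>(2) using mult_op_abs[OF f \<psi>(1)] \<psi>(1)
      mult_op_abs(2)[OF f direct_sum_carrier_cmult[OF \<psi>(1), of c]]
    by (simp add: scaleC.abs_eq direct_sum_eq_refl mult.left_commute)
qed

lemma mult_op_add:
  assumes f: "continuous_on (gasket a) f"
  shows "mult_op a f (x + y) = mult_op a f x + mult_op a f y"
proof -
  obtain \<psi> where \<psi>: "direct_sum_carrier \<psi>" "x = abs_gasket_l2 \<psi>" by (rule gasket_l2_cases)
  obtain \<eta> where \<eta>: "direct_sum_carrier \<eta>" "y = abs_gasket_l2 \<eta>" by (rule gasket_l2_cases)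
  show ?thesis
    unfolding \<psi>(2) \<eta>(2) using mult_op_abs[OF f \<psi>(1)] mult_op_abs[OF f \<eta>(1)] \<psi>(1) \<eta>(1)
      mult_op_abs(2)[OF f direct_sum_carrier_add[OF \<psi>(1) \<eta>(1)]]
    by (simp add: plus_gasket_l2.abs_eq direct_sum_eq_refl distrib_left)
qed

lemma fcoeff_character_mult: "fcoeff n k (\<lambda>t. character n m t * u t) = fcoeff n (k - m) u"
proof -
  have "cnj (character n k t) * (character n m t * u t) = cnj (character n (k - m) t) * u t" for t
    unfolding cnj_character mult.assoc[symmetric] character_add[symmetric] by simp
  then show ?thesis by (simp only: fcoeff_def)
qed

text \<open>Within one triangle a multiplication operator is a Toeplitz matrix: multiplication by a
  character shifts frequencies.\<close>

lemma coef_mult_op_basis: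
  assumes f: "continuous_on (gasket a) f"
  shows "coef (mult_op a f (basis_vec (w, k))) (w, j) = fcoeff (length w) (j - k) (\<lambda>t. f (cell_param a w t))"
proof -
  have c: "direct_sum_carrier (\<lambda>v t. if v = w then character (length w) k t else 0)"
    by (intro direct_sum_carrier_single square_integrable_character)
  have "coef (mult_op a f (basis_vec (w, k))) (w, j)
      = fcoeff (length w) j (\<lambda>t. f (cell_param a w t) * character (length w) k t)"
    unfolding basis_vec_def fst_conv snd_conv fourier_vec_abs coef_mult_op[OF f c] by simp
  then show ?thesis
    using fcoeff_character_mult[of "length w" j k "\<lambda>t. f (cell_param a w t)"] by (simp add: mult.commute)
qed

lemma continuous_on_arc:
  assumes "continuous_on (gasket a) f"
  shows "continuous_on {- half_arc (length w)..half_arc (length w)} (\<lambda>t. f (cell_param a w t))"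
  by (intro continuous_on_compose2[OF assms] continuous_on_subset[OF continuous_on_cell_param])
    (auto simp: half_arc_def intro!: cell_param_in_gasket)

text \<open>The offset \<open>1 / 2\<close> of the spectrum cancels, so a commutator acts like
  differentiation.\<close>

lemma eigenvalue_diff: "eigenvalue (w, j) - eigenvalue (w, k) = 2 ^ length w * of_int (j - k)"
  by (simp add: eigenvalue_def dirac_eigenvalue_def algebra_simps)

text \<open>By the Toeplitz form, the entries of the commutator are, up to a factor \<i>, the
  Fourier coefficients of the derivative. Tested on both sides with the unit vector
  \<open>Q\<close>, they sum to the derivative of the mean at \<open>s\<close>.\<close>

lemma commutator_imp_deriv_bound:
  assumes f: "continuous_on (gasket a) f" and c: "commutator_le_1 scaleC dirac_dom dirac (mult_op a f)"
  shows "cmod (vp_mean_deriv (length w) N (\<lambda>t. f (cell_param a w t)) s) \<le> 1"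
proof -
  let ?n = "length w" and ?h = "\<lambda>t. f (cell_param a w t)"
  let ?B = "\<lambda>j. basis_vec (w, int j)"
  obtain T where T: "bounded_linear T" "\<And>c x. T (c *\<^sub>C x) = c *\<^sub>C T x" "onorm T \<le> 1"
    "\<And>x. x \<in> dirac_dom \<Longrightarrow> T x = dirac (mult_op a f x) - mult_op a f (dirac x)"
    and A: "mult_op a f ` dirac_dom \<subseteq> dirac_dom"
    using c unfolding commutator_le_1_def by blast
  have TB: "coef (T (?B k)) (w, int j) = (2 ^ ?n * of_int (int j - int k)) * fcoeff ?n (int j - int k) ?h" for j k
  proof -
    \<comment> \<open>This is where preservation of the domain enters: \<open>coef_dirac\<close>
      speaks only of vectors in the domain.\<close>
    have "mult_op a f (?B k) \<in> dirac_dom" using A basis_in_dirac_dom by blast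
    then show ?thesis
      unfolding T(4)[OF basis_in_dirac_dom] dirac_basis mult_op_scaleC[OF f] coef_diff coef_scaleC
      by (simp only: coef_dirac coef_mult_op_basis[OF f] left_diff_distrib[symmetric] eigenvalue_diff)
  qed
  \<comment> \<open>The phase moves the centre of the kernel from 0 to \<open>s\<close>.\<close>
  define c where "c j = of_real (vp_coeff N j) * character ?n (- int j) s" for j
  define Q where "Q = (\<Sum>j\<le>N. c j *\<^sub>C ?B j)"
  have cin: "cinner Q x = (\<Sum>j\<le>N. cnj (c j) * coef x (w, int j))" for x
    by (simp add: Q_def cinner_sum_left cinner_scaleC_left coef_def)
  have "complex_of_real ((norm Q)\<^sup>2) = (\<Sum>j\<le>N. cnj (c j) * coef Q (w, int j))"
    unfolding cinner_self[symmetric] by (rule cin)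
  also have "\<dots> = (\<Sum>j\<le>N. of_real ((vp_coeff N j)\<^sup>2))"
  proof (rule sum.cong)
    fix j assume j: "j \<in> {..N}"
    have "coef Q (w, int j) = (\<Sum>k\<le>N. if j = k then c k else 0)"
      unfolding Q_def coef_def cinner_sum_right cinner_scaleC_right cinner_basis by (intro sum.cong) auto
    then have "coef Q (w, int j) = c j" using j by simp
    moreover have "cnj (c j) * c j = of_real ((cmod (c j))\<^sup>2)"
      unfolding complex_norm_square by (rule mult.commute)
    ultimately show "cnj (c j) * coef Q (w, int j) = of_real ((vp_coeff N j)\<^sup>2)"
      by (simp add: c_def norm_mult)
  qed simp
  also have "\<dots> = of_real 1" unfolding of_real_sum[symmetric] vp_coeff_norm ..
  finally have "(norm Q)\<^sup>2 = 1" by (simp only: of_real_eq_iff)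
  then have Q1: "norm Q = 1" using norm_ge_zero[of Q] by (simp add: power2_eq_1_iff)
  have TQ: "T Q = (\<Sum>k\<le>N. c k *\<^sub>C T (?B k))"
    unfolding Q_def T(2)[symmetric] by (rule linear_sum[OF bounded_linear.linear[OF T(1)]])
  have "\<i> * cinner Q (T Q) = (\<Sum>j\<le>N. \<Sum>k\<le>N. \<i> * (cnj (c j) * (c k * coef (T (?B k)) (w, int j))))"
    unfolding cin TQ by (simp add: coef_def cinner_sum_right cinner_scaleC_right sum_distrib_left)
  also have "\<dots> = vp_mean_deriv ?n N ?h s"
    unfolding vp_mean_deriv_def
  proof (intro sum.cong refl)
    fix j k
    have "character ?n (int j) s * character ?n (- int k) s = character ?n (int j - int k) s"
      unfolding character_add[symmetric] by simp
    then have e: "cnj (c j) * c k = of_real (vp_coeff N j * vp_coeff N k) * character ?n (int j - int k) s"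
      by (simp add: c_def cnj_character mult_ac)
    have "\<i> * (cnj (c j) * (c k * coef (T (?B k)) (w, int j))) = (cnj (c j) * c k) * (\<i> * coef (T (?B k)) (w, int j))"
      by (simp only: mult_ac)
    also have "\<dots> = of_real (vp_coeff N j * vp_coeff N k) *
        fcoeff ?n (int j - int k) ?h * (\<i> * 2 ^ ?n * of_int (int j - int k)) * character ?n (int j - int k) s"
      unfolding e TB by (simp only: mult_ac)
    finally show "\<i> * (cnj (c j) * (c k * coef (T (?B k)) (w, int j))) = of_real (vp_coeff N j * vp_coeff N k) *
        fcoeff ?n (int j - int k) ?h * (\<i> * 2 ^ ?n * of_int (int j - int k)) * character ?n (int j - int k) s" .
  qed
  finally have "cmod (vp_mean_deriv ?n N ?h s) = cmod (cinner Q (T Q))"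
    by (metis norm_mult norm_ii mult_1)
  also have "\<dots> \<le> norm Q * norm (T Q)" by (rule norm_cinner_le)
  also have "\<dots> \<le> onorm T * norm Q" unfolding Q1 using onorm[OF T(1), of Q] by (simp add: Q1)
  also have "\<dots> \<le> 1" using T(3) Q1 by simp
  finally show ?thesis .
qed

text \<open>The means are 1-Lipschitz by the mean value inequality. Their limit is available at
  inner points, and continuity of \<open>f\<close> extends the bound to the closed interval.\<close>

lemma commutator_imp_lipschitz:
  assumes f: "continuous_on (gasket a) f" and c: "commutator_le_1 scaleC dirac_dom dirac (mult_op a f)"
    and st: "s \<in> {- (pi / 2 ^ length w)..pi / 2 ^ length w}" "t \<in> {- (pi / 2 ^ length w)..pi / 2 ^ length w}"
  shows "cmod (f (cell_param a w s) - f (cell_param a w t)) \<le> \<bar>s - t\<bar>"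
proof -
  let ?n = "length w" and ?h = "\<lambda>t. f (cell_param a w t)"
  let ?I = "{- half_arc ?n..half_arc ?n}" and ?J = "{- half_arc ?n<..<half_arc ?n}"
  have h: "continuous_on ?I ?h" by (rule continuous_on_arc[OF f])
  have mean: "cmod (vp_mean ?n N ?h s - vp_mean ?n N ?h t) \<le> 1 * norm (s - t)" for N s t
  proof (rule differentiable_bound[of UNIV])
    show "(vp_mean ?n N ?h has_derivative (\<lambda>y. y *\<^sub>R vp_mean_deriv ?n N ?h x)) (at x within UNIV)" for x
      using vp_mean_has_derivative[OF arc_continuous(1)[OF h]] unfolding has_vector_derivative_def .
    show "onorm (\<lambda>y. y *\<^sub>R vp_mean_deriv ?n N ?h x) \<le> 1" for x
      by (rule onorm_le) (simp add: mult_left_le commutator_imp_deriv_bound[OF f c])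
  qed auto
  have "1-lipschitz_on ?J ?h"
  proof (rule lipschitz_onI)
    fix s t assume "s \<in> ?J" "t \<in> ?J"
    then have "(\<lambda>N. cmod (vp_mean ?n N ?h s - vp_mean ?n N ?h t)) \<longlonglongrightarrow> cmod (?h s - ?h t)"
      by (intro tendsto_norm tendsto_diff vp_mean_tendsto h)
    then show "dist (?h s) (?h t) \<le> 1 * dist s t"
      unfolding dist_norm by (rule LIMSEQ_le_const2) (use mean in blast)
  qed simp
  moreover have cl: "closure ?J = ?I"
    using half_arc_pos[of ?n] by (intro closure_greaterThanLessThan) linarith
  ultimately have "1-lipschitz_on ?I ?h"
    using lipschitz_on_closure[of 1 ?J ?h] h by simp
  from lipschitz_onD[OF this, of s t] st show ?thesis
    by (simp add: half_arc_def dist_norm)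
qed

section \<open>From Lipschitz bounds back to the commutator\<close>

lemma bessel_fcoeff:
  fixes w :: "corner list"
  assumes g: "square_integrable (arc_measure (length w)) g" and J: "finite J"
  shows "(\<Sum>k\<in>J. (cmod (fcoeff (length w) k g))\<^sup>2) \<le> (\<integral>t. (cmod (g t))\<^sup>2 \<partial>arc_measure (length w))"
proof -
  \<comment> \<open>Placing \<open>g\<close> in the single component \<open>w\<close> makes Bessel's
    inequality of the direct sum available on one arc.\<close>
  let ?\<psi> = "\<lambda>v t. if v = w then g t else 0"
  have c: "direct_sum_carrier ?\<psi>" by (rule direct_sum_carrier_single[OF g])
  have "(\<Sum>k\<in>J. (cmod (fcoeff (length w) k g))\<^sup>2) = (\<Sum>i\<in>Pair w ` J. (cmod (coef (abs_gasket_l2 ?\<psi>) i))\<^sup>2)"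
    by (subst sum.reindex) (auto simp: inj_on_def coef_abs[OF c])
  also have "\<dots> \<le> (norm (abs_gasket_l2 ?\<psi>))\<^sup>2" by (rule bessel) (use J in simp)
  also have "\<dots> = (\<Sum>\<^sub>\<infinity>v\<in>{w}. \<integral>t. (cmod (?\<psi> v t))\<^sup>2 \<partial>arc_measure (length v))"
    unfolding norm_abs_gasket_l2[OF c] by (rule infsum_cong_neutral) auto
  finally show ?thesis by simp
qed

lemma fcoeff_trig_sum_mult:
  assumes u: "integrable (arc_measure n) u"
  shows "fcoeff n k (\<lambda>t. (\<Sum>j\<le>N. \<Sum>l\<le>M. b j l * character n (m j l) t) * u t)
    = (\<Sum>j\<le>N. \<Sum>l\<le>M. b j l * fcoeff n (k - m j l) u)"
proof -
  have i: "integrable (arc_measure n) (\<lambda>t. c * (cnj (character n k t) * u t))" for k c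
    unfolding cnj_character by (intro integrable_mult_right integrable_character_mult[OF u])
  have e: "cnj (character n k t) * (character n m t * u t) = cnj (character n (k - m) t) * u t" for t m
    unfolding cnj_character mult.assoc[symmetric] character_add[symmetric] by simp
  have "fcoeff n k (\<lambda>t. (\<Sum>j\<le>N. \<Sum>l\<le>M. b j l * character n (m j l) t) * u t)
    = (\<integral>t. (\<Sum>j\<le>N. \<Sum>l\<le>M. b j l * (cnj (character n (k - m j l) t) * u t)) \<partial>arc_measure n)"
    unfolding fcoeff_def e[symmetric] by (simp add: sum_distrib_left sum_distrib_right mult_ac)
  also have "\<dots> = (\<Sum>j\<le>N. \<integral>t. (\<Sum>l\<le>M. b j l * (cnj (character n (k - m j l) t) * u t)) \<partial>arc_measure n)"
    by (intro Bochner_Integration.integral_sum Bochner_Integration.integrable_sum i)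
  also have "\<dots> = (\<Sum>j\<le>N. \<Sum>l\<le>M. \<integral>t. b j l * (cnj (character n (k - m j l) t) * u t) \<partial>arc_measure n)"
    by (intro sum.cong refl Bochner_Integration.integral_sum i)
  finally show ?thesis by (simp add: fcoeff_def)
qed

lemma fcoeff_vp_mean_tendsto:
  assumes h: "continuous_on {- half_arc n..half_arc n} h" and u: "integrable (arc_measure n) u"
  shows "(\<lambda>N. fcoeff n k (\<lambda>t. vp_mean n N h t * u t)) \<longlonglongrightarrow> fcoeff n k (\<lambda>t. h t * u t)"
proof -
  have hi: "integrable (arc_measure n) h" by (rule arc_continuous[OF h])
  have [measurable]: "h \<in> borel_measurable (arc_measure n)" "u \<in> borel_measurable (arc_measure n)"
    using hi u by auto
  have [measurable]: "vp_mean n N h \<in> borel_measurable (arc_measure n)" for N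
    by (intro arc_measurable_continuous continuous_vp_mean hi)
  obtain B where B: "\<And>t. t \<in> {- half_arc n..half_arc n} \<Longrightarrow> cmod (h t) \<le> B"
    using compact_imp_bounded[OF compact_continuous_image[OF h compact_Icc]]
    unfolding bounded_iff by blast
  show ?thesis
    unfolding fcoeff_def
  proof (rule integral_dominated_convergence)
    show "integrable (arc_measure n) (\<lambda>t. B * cmod (u t))" using u by simp
    show "AE t in arc_measure n. (\<lambda>N. cnj (character n k t) * (vp_mean n N h t * u t)) \<longlonglongrightarrow> cnj (character n k t) * (h t * u t)"
    proof (rule AE_arc_negligible)
      show "negligible {- half_arc n, half_arc n}" by simp
      fix t assume "t \<in> {- half_arc n..half_arc n}" "t \<notin> {- half_arc n, half_arc n}"
      then show "(\<lambda>N. cnj (character n k t) * (vp_mean n N h t * u t)) \<longlonglongrightarrow> cnj (character n k t) * (h t * u t)"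
        by (intro tendsto_mult tendsto_const vp_mean_tendsto[OF h]) auto
    qed
    show "AE t in arc_measure n. norm (cnj (character n k t) * (vp_mean n N h t * u t)) \<le> B * cmod (u t)" for N
      using norm_vp_mean_le[of h n B N] B by (auto simp: norm_mult intro!: mult_right_mono)
  qed measurable
qed

text \<open>\<open>v\<close> stands for the Dirac operator applied to \<open>u\<close>. With a
  trigonometric polynomial in place of \<open>h\<close>, the coefficients of the commutator are, up
  to \<i>, those of the product of its derivative with \<open>u\<close>, so Bessel's inequality
  applies; finiteness of \<open>J\<close> permits the passage to the limit.\<close>

lemma commutator_component_bound:
  fixes w :: "corner list"
  defines "n \<equiv> length w"
  assumes lip: "\<And>s t. s \<in> {- half_arc n..half_arc n} \<Longrightarrow> t \<in> {- half_arc n..half_arc n} \<Longrightarrow> cmod (h s - h t) \<le> \<bar>s - t\<bar>"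
    and ends: "h (half_arc n) = h (- half_arc n)"
    and u: "square_integrable (arc_measure n) u" and v: "square_integrable (arc_measure n) v"
    and uv: "\<And>k. fcoeff n k v = eigenvalue (w, k) * fcoeff n k u"
    and J: "finite J"
  shows "(\<Sum>k\<in>J. (cmod (eigenvalue (w, k) * fcoeff n k (\<lambda>t. h t * u t) - fcoeff n k (\<lambda>t. h t * v t)))\<^sup>2)
    \<le> (\<integral>t. (cmod (u t))\<^sup>2 \<partial>arc_measure n)"
proof (rule LIMSEQ_le_const2)
  have "1-lipschitz_on {- half_arc n..half_arc n} h"
    by (rule lipschitz_onI) (use lip in \<open>auto simp: dist_norm\<close>)
  then have h: "continuous_on {- half_arc n..half_arc n} h" by (rule lipschitz_on_continuous_on)
  have hi: "integrable (arc_measure n) h" by (rule arc_continuous[OF h])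
  have ui: "integrable (arc_measure n) u" and vi: "integrable (arc_measure n) v"
    using u v by (auto intro: square_integrable_integrable finite_measure_arc_measure)
  let ?d = "\<lambda>N k. eigenvalue (w, k) * fcoeff n k (\<lambda>t. vp_mean n N h t * u t) - fcoeff n k (\<lambda>t. vp_mean n N h t * v t)"
  show "(\<lambda>N. \<Sum>k\<in>J. (cmod (?d N k))\<^sup>2) \<longlonglongrightarrow>
      (\<Sum>k\<in>J. (cmod (eigenvalue (w, k) * fcoeff n k (\<lambda>t. h t * u t) - fcoeff n k (\<lambda>t. h t * v t)))\<^sup>2)"
    by (intro tendsto_sum tendsto_power tendsto_norm tendsto_diff tendsto_mult tendsto_const
        fcoeff_vp_mean_tendsto[OF h] ui vi)
  have "(\<Sum>k\<in>J. (cmod (?d N k))\<^sup>2) \<le> (\<integral>t. (cmod (u t))\<^sup>2 \<partial>arc_measure n)" for N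
  proof -
    let ?D = "vp_mean_deriv n N h"
    define b where "b j l = of_real (vp_coeff N j * vp_coeff N l) * fcoeff n (int j - int l) h" for j l
    have mean: "vp_mean n N h = (\<lambda>t. \<Sum>j\<le>N. \<Sum>l\<le>N. b j l * character n (int j - int l) t)"
      using vp_mean_eq[OF hi] unfolding b_def by blast
    have deriv: "?D = (\<lambda>t. \<Sum>j\<le>N. \<Sum>l\<le>N. (b j l * (\<i> * 2 ^ n * of_int (int j - int l))) * character n (int j - int l) t)"
      unfolding vp_mean_deriv_def b_def by simp
    \<comment> \<open>A term of frequency \<open>m = int j - int l\<close> carries coefficient
      \<open>k - m\<close> of \<open>u\<close> to position \<open>k\<close>; the eigenvalues there
      differ by \<open>2 ^ n * m\<close>, which times \<i> is the factor from
      differentiation.\<close>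
    have "\<i> * ?d N k = fcoeff n k (\<lambda>t. ?D t * u t)" for k
    proof -
      have "\<i> * ?d N k = (\<Sum>j\<le>N. \<Sum>l\<le>N. \<i> * (b j l * ((eigenvalue (w, k) - eigenvalue (w, k - (int j - int l))) * fcoeff n (k - (int j - int l)) u)))"
        unfolding mean fcoeff_trig_sum_mult[OF ui] fcoeff_trig_sum_mult[OF vi] uv
        by (simp only: sum_distrib_left sum_subtractf[symmetric])
          (intro sum.cong refl, simp add: algebra_simps)
      also have "\<dots> = fcoeff n k (\<lambda>t. ?D t * u t)"
        unfolding deriv fcoeff_trig_sum_mult[OF ui] eigenvalue_diff n_def[symmetric]
        by (intro sum.cong refl) (simp add: mult_ac)
      finally show ?thesis .
    qed
    then have "cmod (?d N k) = cmod (fcoeff n k (\<lambda>t. ?D t * u t))" for k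
      by (metis norm_mult norm_ii mult_1)
    then have "(\<Sum>k\<in>J. (cmod (?d N k))\<^sup>2) = (\<Sum>k\<in>J. (cmod (fcoeff n k (\<lambda>t. ?D t * u t)))\<^sup>2)" by simp
    also have "\<dots> \<le> (\<integral>t. (cmod (?D t * u t))\<^sup>2 \<partial>arc_measure n)"
    proof -
      have [measurable]: "u \<in> borel_measurable (arc_measure n)" using u by (simp add: square_integrable_def)
      have [measurable]: "?D \<in> borel_measurable (arc_measure n)"
        unfolding deriv by measurable
      have "integrable (arc_measure n) (\<lambda>t. (cmod (u t))\<^sup>2)" using u by (simp add: square_integrable_def)
      then have "integrable (arc_measure n) (\<lambda>t. (cmod (?D t * u t))\<^sup>2)"
      proof (rule Bochner_Integration.integrable_bound)
        show "AE t in arc_measure n. norm ((cmod (?D t * u t))\<^sup>2) \<le> norm ((cmod (u t))\<^sup>2)"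
          using norm_vp_mean_deriv_le[OF lip ends]
          by (intro AE_I2) (auto simp: norm_mult power_mult_distrib intro!: mult_left_le_one_le power_le_one)
      qed measurable
      then have "square_integrable (arc_measure n) (\<lambda>t. ?D t * u t)" by (simp add: square_integrable_def)
      then show ?thesis unfolding n_def using J by (intro bessel_fcoeff) auto
    qed
    also have "\<dots> \<le> (\<integral>t. (cmod (u t))\<^sup>2 \<partial>arc_measure n)"
      using norm_vp_mean_deriv_le[OF lip ends] u
      by (intro integral_mono') (auto simp: square_integrable_def norm_mult power_mult_distrib intro!: mult_left_le_one_le power_le_one)
    finally show ?thesis .
  qed
  then show "\<exists>N. \<forall>m\<ge>N. (\<Sum>k\<in>J. (cmod (?d m k))\<^sup>2) \<le> (\<integral>t. (cmod (u t))\<^sup>2 \<partial>arc_measure n)" by blast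
qed

text \<open>The extension is summed along the basis: contractivity on finite combinations makes the
  series of images converge, and it also identifies the sum with \<open>S\<close> on the
  domain.\<close>

lemma contraction_extends:
  assumes S: "\<And>x y. x \<in> dirac_dom \<Longrightarrow> y \<in> dirac_dom \<Longrightarrow> S (x + y) = S x + S y"
    "\<And>c x. x \<in> dirac_dom \<Longrightarrow> S (c *\<^sub>C x) = c *\<^sub>C S x"
    "\<And>x. x \<in> dirac_dom \<Longrightarrow> norm (S x) \<le> norm x"
  shows "\<exists>T. bounded_linear T \<and> (\<forall>c x. T (c *\<^sub>C x) = c *\<^sub>C T x) \<and> onorm T \<le> 1 \<and> (\<forall>x\<in>dirac_dom. T x = S x)"
proof -
  let ?p = "\<lambda>x F. \<Sum>i\<in>F. coef x i *\<^sub>C basis_vec i"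
  let ?s = "\<lambda>x i. coef x i *\<^sub>C S (basis_vec i)"
  have S0: "S 0 = 0" using S(2)[OF basis_in_dirac_dom, of 0 "undefined"] by simp
  have pd: "?p x F \<in> dirac_dom" for x F by (intro dirac_dom_sum dirac_dom_scaleC basis_in_dirac_dom)
  have Sp: "S (?p x F) = (\<Sum>i\<in>F. ?s x i)" for x F
    by (induction F rule: infinite_finite_induct)
      (simp_all add: S0 S(1) S(2) pd dirac_dom_scaleC basis_in_dirac_dom)
  have plim: "(?p x \<longlongrightarrow> x) (finite_subsets_at_top UNIV)" for x
    using basis_expansion[of x] by (simp add: has_sum_def)
  have sm: "?s x summable_on UNIV" for x
  proof (rule summable_on_CauchyI)
    fix e :: real assume e: "e > 0"
    then have "e\<^sup>2 > 0" by simp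
    from summable_on_tail[OF coef_summable[of x UNIV] zero_le_power2 this] obtain F0 where "finite F0 \<and> F0 \<subseteq> UNIV \<and>
      (\<forall>F. finite F \<and> F \<subseteq> UNIV \<and> F \<inter> F0 = {} \<longrightarrow> (\<Sum>i\<in>F. (cmod (coef x i))\<^sup>2) < e\<^sup>2)" by (rule exE)
    then have F0: "finite F0" "\<And>F. finite F \<Longrightarrow> F \<inter> F0 = {} \<Longrightarrow> (\<Sum>i\<in>F. (cmod (coef x i))\<^sup>2) < e\<^sup>2" by simp_all
    have "norm (sum (?s x) F) < e" if F: "finite F" "F \<inter> F0 = {}" for F
    proof -
      have "norm (sum (?s x) F) \<le> norm (?p x F)" unfolding Sp[symmetric] by (rule S(3)[OF pd])
      also have "\<dots> < e"
      proof (rule power2_less_imp_less)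
        show "(norm (?p x F))\<^sup>2 < e\<^sup>2" unfolding norm_sum_basis[OF F(1)] by (rule F0(2)[OF F])
      qed (use e in simp)
      finally show ?thesis .
    qed
    then show "\<exists>F0. finite F0 \<and> F0 \<subseteq> UNIV \<and> (\<forall>F. finite F \<and> F \<subseteq> UNIV \<and> F \<inter> F0 = {} \<longrightarrow> norm (sum (?s x) F) < e)"
      using F0(1) by blast
  qed
  define T where "T x = (\<Sum>\<^sub>\<infinity>i. ?s x i)" for x
  have Tlim: "(sum (?s x) \<longlongrightarrow> T x) (finite_subsets_at_top UNIV)" for x
    using has_sum_infsum[OF sm[of x]] by (simp add: has_sum_def T_def)
  have Tadd: "T (x + y) = T x + T y" for x y
    unfolding T_def coef_add scaleC_add_left by (rule infsum_add[OF sm sm])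
  have TC: "T (c *\<^sub>C x) = c *\<^sub>C T x" for c x
    unfolding T_def coef_scaleC scaleC_scaleC[symmetric]
    by (rule infsumI[OF has_sum_bounded_linear[OF bounded_linear_scaleC has_sum_infsum[OF sm]]])
  have Tn: "norm (T x) \<le> norm x" for x
  proof (rule tendsto_le[OF finite_subsets_at_top_neq_bot tendsto_norm[OF plim] tendsto_norm[OF Tlim]])
    show "\<forall>\<^sub>F F in finite_subsets_at_top UNIV. norm (sum (?s x) F) \<le> norm (?p x F)"
      using S(3)[OF pd] unfolding Sp by (intro always_eventually allI)
  qed
  have "bounded_linear T"
    by (rule bounded_linear_intro[of _ 1]) (simp_all add: Tadd Tn scaleR_gasket_l2_def TC)
  moreover have "onorm T \<le> 1" by (rule onorm_bound) (simp_all add: Tn)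
  \<comment> \<open>The partial sums lie in the domain and converge to \<open>x\<close> in norm, and
    \<open>S\<close> is contractive on their differences from \<open>x\<close>.\<close>
  moreover have "T x = S x" if x: "x \<in> dirac_dom" for x
  proof -
    have "(sum (?s x) \<longlongrightarrow> S x) (finite_subsets_at_top UNIV)"
    proof (rule Lim_null[THEN iffD2], rule Lim_null_comparison)
      show "((\<lambda>F. norm (?p x F - x)) \<longlongrightarrow> 0) (finite_subsets_at_top UNIV)"
        using plim[of x] by (simp add: tendsto_norm_zero_iff flip: Lim_null)
      have "norm (sum (?s x) F - S x) \<le> norm (?p x F - x)" for F
      proof -
        have "sum (?s x) F - S x = S (?p x F + (-1) *\<^sub>C x)"
          unfolding Sp[symmetric] diff_eq_scaleC by (simp add: S(1,2) pd x dirac_dom_scaleC)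
        also have "norm \<dots> \<le> norm (?p x F + (-1) *\<^sub>C x)"
          by (intro S(3) dirac_dom_add pd dirac_dom_scaleC x)
        finally show ?thesis by (simp add: diff_eq_scaleC)
      qed
      then show "\<forall>\<^sub>F F in finite_subsets_at_top UNIV. norm (sum (?s x) F - S x) \<le> norm (?p x F - x)"
        by (intro always_eventually allI)
    qed
    then show ?thesis by (rule tendsto_unique[OF finite_subsets_at_top_neq_bot Tlim])
  qed
  ultimately show ?thesis using TC by blast
qed

text \<open>Each triangle contributes at most the squared norm of the component of \<open>x\<close>
  there. Summing over finitely many triangles gives a bound that yields both preservation of the
  domain and the norm of the commutator.\<close>

lemma lipschitz_imp_commutator:
  assumes f: "continuous_on (gasket a) f"
    and lip: "\<And>w s t. s \<in> {- (pi / 2 ^ length w)..pi / 2 ^ length w} \<Longrightarrow> t \<in> {- (pi / 2 ^ length w)..pi / 2 ^ length w}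
      \<Longrightarrow> cmod (f (cell_param a w s) - f (cell_param a w t)) \<le> \<bar>s - t\<bar>"
  shows "commutator_le_1 scaleC dirac_dom dirac (mult_op a f)"
proof -
  let ?A = "mult_op a f"
  define S where "S x = dirac (?A x) - ?A (dirac x)" for x
  \<comment> \<open>These formal coefficients of the commutator make sense before
    \<open>?A x\<close> is known to lie in the domain.\<close>
  define \<delta> where "\<delta> x i = eigenvalue i * coef (?A x) i - coef (?A (dirac x)) i" for x i
  have bound: "(\<Sum>i\<in>F. (cmod (\<delta> x i))\<^sup>2) \<le> (norm x)\<^sup>2" if x: "x \<in> dirac_dom" and F: "finite F" for x F
  proof -
    obtain \<psi> where \<psi>: "direct_sum_carrier \<psi>" "x = abs_gasket_l2 \<psi>" by (rule gasket_l2_cases)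
    obtain \<eta> where \<eta>: "direct_sum_carrier \<eta>" "dirac x = abs_gasket_l2 \<eta>" by (rule gasket_l2_cases)
    have \<delta>: "\<delta> x (w, k) = eigenvalue (w, k) * fcoeff (length w) k (\<lambda>t. f (cell_param a w t) * \<psi> w t)
        - fcoeff (length w) k (\<lambda>t. f (cell_param a w t) * \<eta> w t)" for w k
      unfolding \<delta>_def \<eta>(2) unfolding \<psi>(2) coef_mult_op[OF f \<psi>(1)] coef_mult_op[OF f \<eta>(1)] ..
    have uv: "fcoeff (length w) k (\<eta> w) = eigenvalue (w, k) * fcoeff (length w) k (\<psi> w)" for w k
      using coef_dirac[OF x, of "(w, k)"] unfolding \<eta>(2) unfolding \<psi>(2) coef_abs[OF \<psi>(1)] coef_abs[OF \<eta>(1)] .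
    \<comment> \<open>The finite set of pairs is enlarged to a rectangle, so that the sum splits by
      triangles.\<close>
    have "(\<Sum>i\<in>F. (cmod (\<delta> x i))\<^sup>2) \<le> (\<Sum>i\<in>fst ` F \<times> snd ` F. (cmod (\<delta> x i))\<^sup>2)"
      using F by (intro sum_mono2 subset_fst_snd) auto
    also have "\<dots> = (\<Sum>w\<in>fst ` F. \<Sum>k\<in>snd ` F. (cmod (\<delta> x (w, k)))\<^sup>2)"
      by (simp add: sum.cartesian_product case_prod_unfold)
    also have "\<dots> \<le> (\<Sum>w\<in>fst ` F. \<integral>t. (cmod (\<psi> w t))\<^sup>2 \<partial>arc_measure (length w))"
      unfolding \<delta>
    proof (intro sum_mono commutator_component_bound)
      fix w
      show "cmod (f (cell_param a w s) - f (cell_param a w t)) \<le> \<bar>s - t\<bar>"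
        if "s \<in> {- half_arc (length w)..half_arc (length w)}" "t \<in> {- half_arc (length w)..half_arc (length w)}" for s t
        using that unfolding half_arc_def by (rule lip)
      show "f (cell_param a w (half_arc (length w))) = f (cell_param a w (- half_arc (length w)))"
        unfolding half_arc_def cell_param_ends ..
    qed (use \<psi>(1) \<eta>(1) uv F in \<open>auto simp: direct_sum_carrier_def\<close>)
    also have "\<dots> \<le> (norm x)\<^sup>2"
      unfolding \<psi>(2) using F by (intro norm_component_le[OF \<psi>(1)]) simp
    finally show ?thesis .
  qed
  have summable: "(\<lambda>i. (cmod (\<delta> x i))\<^sup>2) summable_on UNIV" if "x \<in> dirac_dom" for x
    by (rule nonneg_bdd_above_summable_on) (use bound[OF that] in \<open>auto intro!: bdd_aboveI\<close>)
  have dom: "?A x \<in> dirac_dom" if x: "x \<in> dirac_dom" for x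
  proof -
    \<comment> \<open>Adding back the coefficients of \<open>?A (dirac x)\<close> leaves the
      eigenvalues times the coefficients of \<open>?A x\<close>, whose square summability is
      membership in the domain.\<close>
    have "(\<lambda>i. (cmod (\<delta> x i + coef (?A (dirac x)) i))\<^sup>2) summable_on UNIV"
      by (intro l2_summable_add summable[OF x] coef_summable)
    then show ?thesis unfolding dirac_dom_iff by (simp add: \<delta>_def)
  qed
  have coefS: "coef (S x) i = \<delta> x i" if x: "x \<in> dirac_dom" for x i
    by (simp add: S_def \<delta>_def coef_diff coef_dirac[OF dom[OF x]])
  have "\<exists>T. bounded_linear T \<and> (\<forall>c x. T (c *\<^sub>C x) = c *\<^sub>C T x) \<and> onorm T \<le> 1 \<and> (\<forall>x\<in>dirac_dom. T x = S x)"
  proof (rule contraction_extends)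
    fix x y and c :: complex
    assume x: "x \<in> dirac_dom"
    show "S (c *\<^sub>C x) = c *\<^sub>C S x"
      by (simp add: S_def dirac_scaleC x dom mult_op_scaleC[OF f] diff_eq_scaleC scaleC_add_right scaleC_scaleC)
    show "norm (S x) \<le> norm x"
    proof (rule power2_le_imp_le)
      show "(norm (S x))\<^sup>2 \<le> (norm x)\<^sup>2"
        unfolding parseval[of "S x"] coefS[OF x]
        by (rule infsum_le_finite_sums[OF summable[OF x]]) (rule bound[OF x])
    qed simp
    assume y: "y \<in> dirac_dom"
    show "S (x + y) = S x + S y"
      by (simp add: S_def dirac_add x y dom mult_op_add[OF f])
  qed
  then show ?thesis
    unfolding commutator_le_1_def using closure_dirac_dom dom by (auto simp: S_def)
qed

theorem theorem8p13:
  fixes a p q :: complex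
  assumes "p \<in> gasket a" and "q \<in> gasket a"
  shows "spectral_dist a p q = geodesic_dist (gasket a) p q"
proof (rule antisym)
  show "spectral_dist a p q \<le> geodesic_dist (gasket a) p q"
    unfolding spectral_dist_def geodesic_dist_def
  proof (intro SUP_least INF_greatest)
    fix f g
    assume "f \<in> {f. continuous_on (gasket a) f \<and> commutator_le_1 scaleC dirac_dom dirac (mult_op a f)}"
    then have f: "continuous_on (gasket a) f" "commutator_le_1 scaleC dirac_dom dirac (mult_op a f)" by auto
    assume "g \<in> {g. path g \<and> rectifiable g \<and> path_image g \<subseteq> gasket a \<and> pathstart g = p \<and> pathfinish g = q}"
    then have g: "path g" "path_image g \<subseteq> gasket a" "g 0 = p" "g 1 = q"
      by (auto simp: pathstart_def pathfinish_def)
    have "ereal (cmod (f (g 1) - f (g 0))) \<le> curve_length g"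
      by (rule increment_le_curve_length[OF commutator_imp_lipschitz[OF f] f(1) g(1,2)])
    then show "ereal (cmod (f p - f q)) \<le> curve_length g"
      by (simp add: g(3,4) norm_minus_commute)
  qed
  \<comment> \<open>This function vanishes at \<open>p\<close>, so once it is admissible it alone
    realizes the geodesic distance to \<open>q\<close>.\<close>
  let ?f = "\<lambda>x. complex_of_real (geodesic_fun a p x)"
  have f: "continuous_on (gasket a) ?f"
    by (intro continuous_intros continuous_on_geodesic_fun assms)
  have "commutator_le_1 scaleC dirac_dom dirac (mult_op a ?f)"
  proof (rule lipschitz_imp_commutator[OF f])
    fix w :: "corner list" and s t :: real
    assume "s \<in> {- (pi / 2 ^ length w)..pi / 2 ^ length w}" "t \<in> {- (pi / 2 ^ length w)..pi / 2 ^ length w}"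
    then show "cmod (?f (cell_param a w s) - ?f (cell_param a w t)) \<le> \<bar>s - t\<bar>"
      unfolding of_real_diff[symmetric] norm_of_real by (rule geodesic_fun_cell_param[OF assms(1)])
  qed
  then have "ereal (cmod (?f p - ?f q)) \<le> spectral_dist a p q"
    unfolding spectral_dist_def using f by (intro SUP_upper) simp
  moreover have "geodesic_fun a p p = 0"
    using geodesic_dist_self[OF assms(1)] geodesic_dist_finite[OF assms(1,1)] by simp
  moreover have "geodesic_dist (gasket a) p q = ereal (geodesic_fun a p q)" "0 \<le> geodesic_fun a p q"
    using geodesic_dist_finite[OF assms] geodesic_dist_nonneg[of "gasket a" p q] by auto
  ultimately show "geodesic_dist (gasket a) p q \<le> spectral_dist a p q" by simp
qed

end
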